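(* Bipartite Matching is not in $\tilde{\mathrm C}$PTime$^+$; that is, there is no PTime program with InputSize that accepts every instance of Bipartite Matching that has a perfect matching and rejects every instance of Bipartite Matching that has no perfect matching.
   Context: Bipartite Matching. Instance: a finite bipartite undirected graph $G=(V,E)$ with its two parts (of "boys" and "girls" respectively) of the same size, the graph being presented as a relational structure on $V$ with the binary edge relation $E$ and unary relations for the two parts. Question: does $G$ have a perfect matching, i.e. a set $F\subseteq E$ of edges such that every vertex is incident to exactly one edge in $F$? ASM MODEL. "Object" means an atom (a non-set) or a set. For a finite set $X$ of atoms, $\mathrm{HF}(X)$ is the smallest set $Y$ such that $X\subseteq Y$ and every finite subset of $Y$ is a member of $Y$. $\mathrm{TC}(x)$ is the least transitive set $Y$ with $x\in Y$. Natural numbers are von Neumann ordinals; $\mathit{false}=0=\emptyset$, $\mathit{true}=1=\{\emptyset\}$. Vocabulary: finitely many function names with arities (some marked relational, called predicates), consisting of: static logic predicates ($=$, nullary $\mathit{true},\mathit{false}$, Boolean connectives); static set-theoretic names (binary predicate $\in$; nullary $\emptyset$, $\mathrm{Atoms}$; unary $\bigcup$, $\mathrm{TheUnique}$; binary $\mathrm{Pair}$); an additional static nullary name $\mathrm{InputSize}$; finitely many static input predicates; finitely many dynamic names, including nullary predicates $\mathrm{Halt}$ and $\mathrm{Output}$. State: a structure with base set $\mathrm{HF}(X)$, $X$ a finite set of atoms. Predicates take values in $\{0,1\}$; Boolean connectives are as usual on $\{0,1\}$ and $0$ if some argument is not Boolean; $\in,\emptyset$ are standard; $\mathrm{Atoms}=X$;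 $\bigcup a$ is the union of those elements of $a$ that are sets ($\emptyset$ if $a$ is an atom); $\mathrm{TheUnique}(a)$ is the unique element of $a$ if $a$ is a singleton and $\emptyset$ otherwise; $\mathrm{Pair}(a,b)=\{a,b\}$; input predicates hold only of tuples of atoms; for each dynamic $f$ of arity $j$ the set $\mathrm{Extent}(f)=\{(x_0,\dots,x_j): f(x_0,\dots,x_{j-1})=x_j\neq 0\}$ is finite. An input structure is a finite structure of the input vocabulary (replaced by an isomorphic copy whose elements are atoms); it determines the initial state whose atoms with the input predicates form that structure, in which all dynamic functions have empty extent, and in which $\mathrm{InputSize}$ is the von Neumann ordinal for the number $n$ of atoms. Terms: variables; $f(t_1,\dots,t_j)$ (Boolean if $f$ is a predicate); $\{t(v):v\in r:g(v)\}$ with $r$ a term without $v$ free and $g$ a Boolean term ($v$ becomes bound), whose value is the set of values of $t(v)$ for those $v\in r$ with $g(v)$ true. Rules: Skip; $f(t_1,\dots,t_j):=t_0$ with $f$ dynamic ($t_0$ Boolean if $f$ is relational); "if $g$ then $R_1$ else $R_2$ endif" with $g$ a Boolean term; "do forall $v\in r$, $R_0(v)$ enddo" with $r$ a term without $v$ free ($v$ becomes bound). An expanded state is a state with an assignment of values to finitely many variables; $A(v\mapsto a)$ is $A$ with $v$ (re)assigned $a$. $\mathrm{Den}(R,A)$ is a set of updates $(f,\bar a,b)$: $\mathrm{Den}(\text{Skip},A)=\emptyset$; for $f(\bar s):=t$ it is $\{(f,\mathrm{Val}_A(\bar s),\mathrm{Val}_A(t))\}$; for a conditional it is $\mathrm{Den}(R_1,A)$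 or $\mathrm{Den}(R_2,A)$ according as $g$ is true or not in $A$; for do-forall it is $\bigcup\{\mathrm{Den}(R_0(v),A(v\mapsto a)):a\in\mathrm{Val}_A(r)\}$. The sequel of $A$ with respect to $R$ is obtained by simultaneously setting $f(\bar a)=b$ for all $(f,\bar a,b)\in\mathrm{Den}(R,A)$ if no two updates clash (same $(f,\bar a)$, different $b$); otherwise it is the state $A$ itself. A program is a rule without free variables. The run of a program $\Pi$ on an input structure $I$ is the finite or infinite sequence $A_0,A_1,\dots$ with $A_0$ the initial state of $I$ and each $A_{i+1}$ the sequel of $A_i$ with respect to $\Pi$, which stops at the first state in which $\mathrm{Halt}$ holds (and is infinite if there is none). The length of a finite run $\langle A_i:i\le l\rangle$ is $l$. PTIME PROGRAMS. An object is critical at a state if it is an atom, or $0$ or $1$, or a value of a dynamic function, or a component of a location (argument tuple) where some dynamic function takes a value different from $\emptyset$. It is active at a state if it belongs to $\mathrm{TC}(y)$ for some critical $y$, and active in a run if active at some state of the run. A PTime program (with InputSize) is $\bar\Pi=(\Pi,p(n),q(n))$ with $\Pi$ a program (that is, a rule without free variables over a vocabulary consisting of the static logic and set-theoretic names, the static nullary name $\mathrm{InputSize}$, finitely many static input predicates, and finitely many dynamic names including $\mathrm{Halt}$ and $\mathrm{Output}$) and $p,q$ integer polynomials; its run on an input structure $I$ of size $n$ is the longest initial segment of the run of $\Pi$ on $I$ that has length $\le p(n)$ and at most $q(n)$ active objects. $\bar\Pi$ accepts (rejects) $I$ if this run halts (i.e. $\mathrm{Halt}$ holds in its final state) and $\mathrm{Output}$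 is true (false) in the final state. $\tilde{\mathrm C}$PTIME$^+$. A pair $(K_1,K_2)$ of disjoint classes of finite structures of the same vocabulary is in $\tilde{\mathrm C}$PTime$^+$ if there is a PTime program with InputSize that accepts all structures in $K_1$ and rejects all structures in $K_2$; a decision problem is in $\tilde{\mathrm C}$PTime$^+$ if the pair (yes-instances, no-instances) is. *)

theory Defs
  imports
    "HOL-Library.FSet"
    "HOL-Library.Infinite_Typeclass"
    "HOL-Computational_Algebra.Polynomial"
begin

section \<open>Objects\<close>

datatype 'a obj = Atom 'a | HSet "'a obj fset"

text \<open>
  Atoms have no elements, so \<open>elems\<close> does not separate an atom from the empty set.
\<close>

fun elems :: "'a obj \<Rightarrow> 'a obj fset" where
  "elems (Atom a) = {||}"
| "elems (HSet F) = F"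

inductive_set HF :: "'a set \<Rightarrow> 'a obj set" for X :: "'a set" where
  atom: "a \<in> X \<Longrightarrow> Atom a \<in> HF X"
| hset: "(\<And>x. x |\<in>| F \<Longrightarrow> x \<in> HF X) \<Longrightarrow> HSet F \<in> HF X"

inductive_set TC :: "'a obj \<Rightarrow> 'a obj set" for y :: "'a obj" where
  self: "y \<in> TC y"
| elem: "z \<in> TC y \<Longrightarrow> w |\<in>| elems z \<Longrightarrow> w \<in> TC y"

definition ff :: "'a obj" where
  "ff = HSet {||}"

definition tt :: "'a obj" where
  "tt = HSet {|ff|}"

definition boolean :: "'a obj \<Rightarrow> bool" where
  "boolean x \<longleftrightarrow> x = ff \<or> x = tt"

definition truth :: "bool \<Rightarrow> 'a obj" where
  "truth b = (if b then tt else ff)"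

primrec ordinal :: "nat \<Rightarrow> 'a obj" where
  "ordinal 0 = HSet {||}"
| "ordinal (Suc n) = HSet (finsert (ordinal n) (elems (ordinal n)))"

definition connective :: "(bool \<Rightarrow> bool \<Rightarrow> bool) \<Rightarrow> 'a obj \<Rightarrow> 'a obj \<Rightarrow> 'a obj" where
  "connective c x y = truth (boolean x \<and> boolean y \<and> c (x = tt) (y = tt))"

definition the_unique :: "'a obj \<Rightarrow> 'a obj" where
  "the_unique x = (if \<exists>y. elems x = {|y|} then THE y. elems x = {|y|} else ff)"


section \<open>Vocabularies, structures, states\<close>

datatype dname = Halt | Output | Dyn nat

datatype 'i fname =
    FEq | FTrue | FFalse | FNot | FAnd | FOr | FImp | FIff
  | FMem | FEmpty | FAtoms | FUnion | FTheUnique | FPair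
  | FInputSize
  | FInput 'i
  | FDyn dname

text \<open>
  The partial arity functions have the names of the vocabulary as their domain; \<open>dyn_preds\<close> are the
  dynamic names marked relational. All input names are predicates.
\<close>

record 'i vocabulary =
  input_arity :: "'i \<Rightarrow> nat option"
  dyn_arity :: "dname \<Rightarrow> nat option"
  dyn_preds :: "dname set"

definition is_vocabulary :: "'i vocabulary \<Rightarrow> bool" where
  "is_vocabulary \<Upsilon> \<longleftrightarrow>
     finite (dom (input_arity \<Upsilon>)) \<and> finite (dom (dyn_arity \<Upsilon>)) \<and>
     dyn_preds \<Upsilon> \<subseteq> dom (dyn_arity \<Upsilon>) \<and>
     dyn_arity \<Upsilon> Halt = Some 0 \<and> dyn_arity \<Upsilon> Output = Some 0 \<and>
     Halt \<in> dyn_preds \<Upsilon> \<and> Output \<in> dyn_preds \<Upsilon>"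

primrec name_arity :: "'i vocabulary \<Rightarrow> 'i fname \<Rightarrow> nat option" where
  "name_arity \<Upsilon> FEq = Some 2"
| "name_arity \<Upsilon> FTrue = Some 0"
| "name_arity \<Upsilon> FFalse = Some 0"
| "name_arity \<Upsilon> FNot = Some 1"
| "name_arity \<Upsilon> FAnd = Some 2"
| "name_arity \<Upsilon> FOr = Some 2"
| "name_arity \<Upsilon> FImp = Some 2"
| "name_arity \<Upsilon> FIff = Some 2"
| "name_arity \<Upsilon> FMem = Some 2"
| "name_arity \<Upsilon> FEmpty = Some 0"
| "name_arity \<Upsilon> FAtoms = Some 0"
| "name_arity \<Upsilon> FUnion = Some 1"
| "name_arity \<Upsilon> FTheUnique = Some 1"
| "name_arity \<Upsilon> FPair = Some 2"
| "name_arity \<Upsilon> FInputSize = Some 0"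
| "name_arity \<Upsilon> (FInput P) = input_arity \<Upsilon> P"
| "name_arity \<Upsilon> (FDyn f) = dyn_arity \<Upsilon> f"

definition is_predicate :: "'i vocabulary \<Rightarrow> 'i fname \<Rightarrow> bool" where
  "is_predicate \<Upsilon> f \<longleftrightarrow>
     (case f of
        FDyn h \<Rightarrow> h \<in> dyn_preds \<Upsilon>
      | _ \<Rightarrow> f \<notin> {FEmpty, FAtoms, FUnion, FTheUnique, FPair, FInputSize})"

record ('i, 'a) fin_structure =
  universe :: "'a fset"
  rel :: "'i \<Rightarrow> 'a list set"

definition is_structure :: "('i \<Rightarrow> nat option) \<Rightarrow> ('i, 'a) fin_structure \<Rightarrow> bool" where
  "is_structure \<sigma> I \<longleftrightarrow>
     (\<forall>P xs. xs \<in> rel I P \<longrightarrow> \<sigma> P = Some (length xs) \<and> set xs \<subseteq> fset (universe I))"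

text \<open>
  The elements of the input structure serve as the atoms. The type of \<open>dyn\<close> leaves room for arguments
  of the wrong length or outside the base set; there the functions are constantly \<open>ff\<close>, see
  \<open>is_state\<close>, which holds initially and is preserved by programs (lemmas \<open>is_state_initial\<close> and
  \<open>is_state_sequel\<close> below).
\<close>

record ('i, 'a) state =
  structure_of :: "('i, 'a) fin_structure"
  dyn :: "dname \<Rightarrow> 'a obj list \<Rightarrow> 'a obj"

definition atoms :: "('i, 'a) state \<Rightarrow> 'a fset" where
  "atoms A = universe (structure_of A)"

definition extent :: "('i, 'a) state \<Rightarrow> dname \<Rightarrow> ('a obj list \<times> 'a obj) set" where
  "extent A f = {(xs, y). dyn A f xs = y \<and> y \<noteq> ff}"

definition is_state :: "'i vocabulary \<Rightarrow> ('i, 'a) state \<Rightarrow> bool" where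
  "is_state \<Upsilon> A \<longleftrightarrow>
     is_structure (input_arity \<Upsilon>) (structure_of A) \<and>
     (\<forall>f. finite (extent A f)) \<and>
     (\<forall>f xs y. (xs, y) \<in> extent A f \<longrightarrow>
        dyn_arity \<Upsilon> f = Some (length xs) \<and>
        set xs \<subseteq> HF (fset (atoms A)) \<and> y \<in> HF (fset (atoms A)) \<and>
        (f \<in> dyn_preds \<Upsilon> \<longrightarrow> boolean y))"

definition initial_state :: "('i, 'a) fin_structure \<Rightarrow> ('i, 'a) state" where
  "initial_state I = \<lparr>structure_of = I, dyn = (\<lambda>f xs. ff)\<rparr>"


section \<open>Terms\<close>

text \<open>\<open>Compr t v r g\<close> is the term \<open>{t(v) : v \<in> r : g(v)}\<close>.\<close>

datatype 'i tm =
    Var nat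
  | App "'i fname" "'i tm list"
  | Compr "'i tm" nat "'i tm" "'i tm"

fun fv_tm :: "'i tm \<Rightarrow> nat set" where
  "fv_tm (Var v) = {v}"
| "fv_tm (App f ts) = (\<Union>t\<in>set ts. fv_tm t)"
| "fv_tm (Compr t v r g) = fv_tm r \<union> ((fv_tm t \<union> fv_tm g) - {v})"

fun boolean_tm :: "'i vocabulary \<Rightarrow> 'i tm \<Rightarrow> bool" where
  "boolean_tm \<Upsilon> (App f ts) \<longleftrightarrow> is_predicate \<Upsilon> f"
| "boolean_tm \<Upsilon> _ \<longleftrightarrow> False"

fun wf_tm :: "'i vocabulary \<Rightarrow> 'i tm \<Rightarrow> bool" where
  "wf_tm \<Upsilon> (Var v) \<longleftrightarrow> True"
| "wf_tm \<Upsilon> (App f ts) \<longleftrightarrow> name_arity \<Upsilon> f = Some (length ts) \<and> (\<forall>t\<in>set ts. wf_tm \<Upsilon> t)"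
| "wf_tm \<Upsilon> (Compr t v r g) \<longleftrightarrow>
     wf_tm \<Upsilon> t \<and> wf_tm \<Upsilon> r \<and> wf_tm \<Upsilon> g \<and> boolean_tm \<Upsilon> g \<and> v \<notin> fv_tm r"

text \<open>Only argument lists whose length is the arity of the name matter.\<close>

primrec interp :: "('i, 'a) state \<Rightarrow> 'i fname \<Rightarrow> 'a obj list \<Rightarrow> 'a obj" where
  "interp A FEq xs = truth (xs ! 0 = xs ! 1)"
| "interp A FTrue xs = tt"
| "interp A FFalse xs = ff"
| "interp A FNot xs = truth (boolean (xs ! 0) \<and> xs ! 0 \<noteq> tt)"
| "interp A FAnd xs = connective (\<and>) (xs ! 0) (xs ! 1)"
| "interp A FOr xs = connective (\<or>) (xs ! 0) (xs ! 1)"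
| "interp A FImp xs = connective (\<longrightarrow>) (xs ! 0) (xs ! 1)"
| "interp A FIff xs = connective (\<longleftrightarrow>) (xs ! 0) (xs ! 1)"
| "interp A FMem xs = truth (xs ! 0 |\<in>| elems (xs ! 1))"
| "interp A FEmpty xs = HSet {||}"
| "interp A FAtoms xs = HSet (Atom |`| atoms A)"
| "interp A FUnion xs = HSet (ffUnion (elems |`| elems (xs ! 0)))"
| "interp A FTheUnique xs = the_unique (xs ! 0)"
| "interp A FPair xs = HSet {|xs ! 0, xs ! 1|}"
| "interp A FInputSize xs = ordinal (fcard (atoms A))"
| "interp A (FInput P) xs = truth (xs \<in> map Atom ` rel (structure_of A) P)"
| "interp A (FDyn f) xs = dyn A f xs"

text \<open>
  Assignments are total for convenience; \<open>val A \<rho> t\<close> depends only on the values of \<open>\<rho>\<close> on the free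
  variables of \<open>t\<close>.
\<close>

fun val :: "('i, 'a) state \<Rightarrow> (nat \<Rightarrow> 'a obj) \<Rightarrow> 'i tm \<Rightarrow> 'a obj" where
  "val A \<rho> (Var v) = \<rho> v"
| "val A \<rho> (App f ts) = interp A f (map (val A \<rho>) ts)"
| "val A \<rho> (Compr t v r g) =
     HSet ((\<lambda>a. val A (\<rho>(v := a)) t) |`|
            ffilter (\<lambda>a. val A (\<rho>(v := a)) g = tt) (elems (val A \<rho> r)))"


section \<open>Rules and programs\<close>

datatype 'i rule =
    Skip
  | Update dname "'i tm list" "'i tm"
  | Cond "'i tm" "'i rule" "'i rule"
  | Forall nat "'i tm" "'i rule"

primrec fv_rule :: "'i rule \<Rightarrow> nat set" where
  "fv_rule Skip = {}"
| "fv_rule (Update f ss t) = (\<Union>s\<in>set ss. fv_tm s) \<union> fv_tm t"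
| "fv_rule (Cond g R1 R2) = fv_tm g \<union> fv_rule R1 \<union> fv_rule R2"
| "fv_rule (Forall v r R) = fv_tm r \<union> (fv_rule R - {v})"

primrec wf_rule :: "'i vocabulary \<Rightarrow> 'i rule \<Rightarrow> bool" where
  "wf_rule \<Upsilon> Skip \<longleftrightarrow> True"
| "wf_rule \<Upsilon> (Update f ss t) \<longleftrightarrow>
     dyn_arity \<Upsilon> f = Some (length ss) \<and> (\<forall>s\<in>set ss. wf_tm \<Upsilon> s) \<and> wf_tm \<Upsilon> t \<and>
     (f \<in> dyn_preds \<Upsilon> \<longrightarrow> boolean_tm \<Upsilon> t)"
| "wf_rule \<Upsilon> (Cond g R1 R2) \<longleftrightarrow>
     wf_tm \<Upsilon> g \<and> boolean_tm \<Upsilon> g \<and> wf_rule \<Upsilon> R1 \<and> wf_rule \<Upsilon> R2"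
| "wf_rule \<Upsilon> (Forall v r R) \<longleftrightarrow> wf_tm \<Upsilon> r \<and> v \<notin> fv_tm r \<and> wf_rule \<Upsilon> R"

definition is_program :: "'i vocabulary \<Rightarrow> 'i rule \<Rightarrow> bool" where
  "is_program \<Upsilon> \<Pi> \<longleftrightarrow> is_vocabulary \<Upsilon> \<and> wf_rule \<Upsilon> \<Pi> \<and> fv_rule \<Pi> = {}"

type_synonym 'a update = "dname \<times> 'a obj list \<times> 'a obj"

primrec Den :: "'i rule \<Rightarrow> ('i, 'a) state \<Rightarrow> (nat \<Rightarrow> 'a obj) \<Rightarrow> 'a update set" where
  "Den Skip A \<rho> = {}"
| "Den (Update f ss t) A \<rho> = {(f, map (val A \<rho>) ss, val A \<rho> t)}"
| "Den (Cond g R1 R2) A \<rho> = (if val A \<rho> g = tt then Den R1 A \<rho> else Den R2 A \<rho>)"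
| "Den (Forall v r R) A \<rho> = (\<Union>a\<in>fset (elems (val A \<rho> r)). Den R A (\<rho>(v := a)))"

definition clash :: "'a update set \<Rightarrow> bool" where
  "clash U \<longleftrightarrow> (\<exists>f xs b c. (f, xs, b) \<in> U \<and> (f, xs, c) \<in> U \<and> b \<noteq> c)"

text \<open>Programs are closed, so the assignment used in \<open>sequel\<close> is immaterial.\<close>

definition sequel :: "'i rule \<Rightarrow> ('i, 'a) state \<Rightarrow> ('i, 'a) state" where
  "sequel \<Pi> A =
     (let U = Den \<Pi> A (\<lambda>v. ff) in
      if clash U then A
      else A\<lparr>dyn := \<lambda>f xs. if \<exists>b. (f, xs, b) \<in> U then THE b. (f, xs, b) \<in> U else dyn A f xs\<rparr>)"

definition halted :: "('i, 'a) state \<Rightarrow> bool" where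
  "halted A \<longleftrightarrow> dyn A Halt [] = tt"

text \<open>
  The run of \<open>\<Pi>\<close> on \<open>I\<close> consists of the states \<open>run_state \<Pi> I i\<close> with \<open>in_run \<Pi> I i\<close>.
\<close>

definition run_state :: "'i rule \<Rightarrow> ('i, 'a) fin_structure \<Rightarrow> nat \<Rightarrow> ('i, 'a) state" where
  "run_state \<Pi> I i = (sequel \<Pi> ^^ i) (initial_state I)"

definition in_run :: "'i rule \<Rightarrow> ('i, 'a) fin_structure \<Rightarrow> nat \<Rightarrow> bool" where
  "in_run \<Pi> I i \<longleftrightarrow> (\<forall>j<i. \<not> halted (run_state \<Pi> I j))"


section \<open>Polynomial time programs\<close>

definition critical :: "('i, 'a) state \<Rightarrow> 'a obj set" where
  "critical A =
     Atom ` fset (atoms A) \<union> {ff, tt} \<union> {dyn A f xs | f xs. True} \<union>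
     {x. \<exists>f xs. dyn A f xs \<noteq> ff \<and> x \<in> set xs}"

definition active :: "('i, 'a) state \<Rightarrow> 'a obj set" where
  "active A = (\<Union>y\<in>critical A. TC y)"

record 'i ptime_program =
  vocab :: "'i vocabulary"
  prog :: "'i rule"
  time_bound :: "int poly"
  space_bound :: "int poly"

definition is_ptime_program :: "'i ptime_program \<Rightarrow> bool" where
  "is_ptime_program \<Pi> \<longleftrightarrow> is_program (vocab \<Pi>) (prog \<Pi>)"

definition within_bounds :: "'i ptime_program \<Rightarrow> ('i, 'a) fin_structure \<Rightarrow> nat \<Rightarrow> bool" where
  "within_bounds \<Pi> I l \<longleftrightarrow>
     (let n = int (fcard (universe I));
          act = (\<Union>i\<le>l. active (run_state (prog \<Pi>) I i))
      in int l \<le> poly (time_bound \<Pi>) n \<and> finite act \<and> int (card act) \<le> poly (space_bound \<Pi>) n)"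

text \<open>
  \<open>final_index \<Pi> I l\<close>: the bounded run is the segment with states \<open>0, \<dots>, l\<close>. There is no such \<open>l\<close> if
  already the initial state alone violates the bounds; the input is then neither accepted nor rejected.
\<close>

definition final_index :: "'i ptime_program \<Rightarrow> ('i, 'a) fin_structure \<Rightarrow> nat \<Rightarrow> bool" where
  "final_index \<Pi> I l \<longleftrightarrow>
     in_run (prog \<Pi>) I l \<and> within_bounds \<Pi> I l \<and>
     (\<forall>l'. in_run (prog \<Pi>) I l' \<and> within_bounds \<Pi> I l' \<longrightarrow> l' \<le> l)"

definition accepts :: "'i ptime_program \<Rightarrow> ('i, 'a) fin_structure \<Rightarrow> bool" where
  "accepts \<Pi> I \<longleftrightarrow>
     (\<exists>l. final_index \<Pi> I l \<and> halted (run_state (prog \<Pi>) I l) \<and>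
          dyn (run_state (prog \<Pi>) I l) Output [] = tt)"

definition rejects :: "'i ptime_program \<Rightarrow> ('i, 'a) fin_structure \<Rightarrow> bool" where
  "rejects \<Pi> I \<longleftrightarrow>
     (\<exists>l. final_index \<Pi> I l \<and> halted (run_state (prog \<Pi>) I l) \<and>
          dyn (run_state (prog \<Pi>) I l) Output [] = ff)"

definition CPTime_plus ::
  "('i \<Rightarrow> nat option) \<Rightarrow> (('i, 'a) fin_structure set \<times> ('i, 'a) fin_structure set) set" where
  "CPTime_plus \<sigma> =
     {(K1, K2). \<exists>\<Pi>. is_ptime_program \<Pi> \<and> input_arity (vocab \<Pi>) = \<sigma> \<and>
        (\<forall>I\<in>K1. accepts \<Pi> I) \<and> (\<forall>I\<in>K2. rejects \<Pi> I)}"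


section \<open>Bipartite matching\<close>

datatype gname = Edge | Boy | Girl

fun graph_arity :: "gname \<Rightarrow> nat option" where
  "graph_arity Edge = Some 2"
| "graph_arity Boy = Some 1"
| "graph_arity Girl = Some 1"

definition boys :: "(gname, 'a) fin_structure \<Rightarrow> 'a set" where
  "boys G = {v. [v] \<in> rel G Boy}"

definition girls :: "(gname, 'a) fin_structure \<Rightarrow> 'a set" where
  "girls G = {v. [v] \<in> rel G Girl}"

definition edges :: "(gname, 'a) fin_structure \<Rightarrow> 'a set set" where
  "edges G = {{u, v} | u v. [u, v] \<in> rel G Edge}"

definition matching_instance :: "(gname, 'a) fin_structure \<Rightarrow> bool" where
  "matching_instance G \<longleftrightarrow>
     is_structure graph_arity G \<and>
     boys G \<union> girls G = fset (universe G) \<and> boys G \<inter> girls G = {} \<and>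
     card (boys G) = card (girls G) \<and>
     (\<forall>u v. [u, v] \<in> rel G Edge \<longrightarrow> [v, u] \<in> rel G Edge) \<and>
     (\<forall>u v. [u, v] \<in> rel G Edge \<longrightarrow> (u \<in> boys G \<longleftrightarrow> v \<in> girls G))"

definition has_perfect_matching :: "(gname, 'a) fin_structure \<Rightarrow> bool" where
  "has_perfect_matching G \<longleftrightarrow>
     (\<exists>F \<subseteq> edges G. \<forall>v \<in> fset (universe G). \<exists>!e. e \<in> F \<and> v \<in> e)"

definition matching_yes :: "(gname, 'a) fin_structure set" where
  "matching_yes = {G. matching_instance G \<and> has_perfect_matching G}"

definition matching_no :: "(gname, 'a) fin_structure set" where
  "matching_no = {G. matching_instance G \<and> \<not> has_perfect_matching G}"


section \<open>States are preserved along runs\<close>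

lemma ff_HF [simp]: "ff \<in> HF X"
  by (auto simp: ff_def intro: HF.intros)

lemma tt_HF [simp]: "tt \<in> HF X"
  by (auto simp: tt_def intro: HF.intros)

lemma truth_HF [simp]: "truth b \<in> HF X"
  by (simp add: truth_def)

lemma boolean_truth [simp]: "boolean (truth b)" "boolean tt" "boolean ff"
  by (auto simp: truth_def boolean_def)

lemma elems_HF: "x \<in> HF X \<Longrightarrow> y |\<in>| elems x \<Longrightarrow> y \<in> HF X"
  by (auto elim: HF.cases)

lemma ordinal_HF [simp]: "ordinal n \<in> HF X"
  by (induction n) (auto intro: HF.intros elems_HF)

lemma the_unique_HF: "x \<in> HF X \<Longrightarrow> the_unique x \<in> HF X"
  by (auto simp: the_unique_def intro: elems_HF)

lemma dyn_HF:
  assumes "is_state \<Upsilon> A"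
  shows "dyn A f xs \<in> HF (fset (atoms A))"
  using assms by (cases "dyn A f xs = ff") (auto simp: is_state_def extent_def)

lemma interp_HF:
  assumes "is_state \<Upsilon> A" "set xs \<subseteq> HF (fset (atoms A))" "name_arity \<Upsilon> f = Some (length xs)"
  shows "interp A f xs \<in> HF (fset (atoms A))"
proof -
  have nth: "xs ! i \<in> HF (fset (atoms A))" if "i < length xs" for i
    using that assms(2) by auto
  show ?thesis
  proof (cases f)
    case FAtoms
    then show ?thesis by (auto intro!: HF.hset HF.atom)
  next
    case FUnion
    with assms(3) have "xs ! 0 \<in> HF (fset (atoms A))" by (intro nth) auto
    then show ?thesis
      unfolding FUnion interp.simps
      by (intro HF.hset) (auto simp: ffUnion.rep_eq intro: elems_HF)
  next
    case FTheUnique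
    with assms(3) have "xs ! 0 \<in> HF (fset (atoms A))" by (intro nth) auto
    then show ?thesis by (simp add: FTheUnique the_unique_HF)
  next
    case FPair
    with assms(3) have "xs ! 0 \<in> HF (fset (atoms A))" "xs ! 1 \<in> HF (fset (atoms A))"
      by (auto intro: nth)
    then show ?thesis by (auto simp: FPair intro!: HF.hset)
  next
    case FEmpty
    then show ?thesis by (auto intro: HF.hset)
  qed (simp_all add: connective_def dyn_HF [OF assms(1)])
qed

lemma val_HF:
  assumes "is_state \<Upsilon> A" "wf_tm \<Upsilon> t" "\<And>v. \<rho> v \<in> HF (fset (atoms A))"
  shows "val A \<rho> t \<in> HF (fset (atoms A))"
  using assms(2,3)
proof (induction t arbitrary: \<rho>)
  case (App f ts)
  then show ?case by (auto intro!: interp_HF [OF assms(1)])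
next
  case (Compr t v r g)
  have "a \<in> HF (fset (atoms A))" if "a |\<in>| elems (val A \<rho> r)" for a
    using Compr.IH(2) [of \<rho>] Compr.prems that by (auto intro: elems_HF)
  with Compr show ?case by (auto intro!: HF.hset)
qed auto

lemma val_boolean:
  assumes "is_state \<Upsilon> A" "boolean_tm \<Upsilon> t"
  shows "boolean (val A \<rho> t)"
proof (cases t)
  case (App f ts)
  have "boolean (dyn A h xs)" if "h \<in> dyn_preds \<Upsilon>" for h xs
    using assms(1) that by (cases "dyn A h xs = ff") (auto simp: is_state_def extent_def)
  with App assms(2) show ?thesis
    by (cases f) (auto simp: connective_def is_predicate_def)
qed (use assms(2) in auto)

lemma Den_wf:
  assumes "is_state \<Upsilon> A" "wf_rule \<Upsilon> R" "\<And>v. \<rho> v \<in> HF (fset (atoms A))"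
  shows "finite (Den R A \<rho>) \<and>
    (\<forall>f xs b. (f, xs, b) \<in> Den R A \<rho> \<longrightarrow> dyn_arity \<Upsilon> f = Some (length xs) \<and>
      set xs \<subseteq> HF (fset (atoms A)) \<and> b \<in> HF (fset (atoms A)) \<and>
      (f \<in> dyn_preds \<Upsilon> \<longrightarrow> boolean b))"
  using assms(2,3)
proof (induction R arbitrary: \<rho>)
  case (Update f ss t)
  then show ?case
    by (auto intro!: val_HF [OF assms(1)] val_boolean [OF assms(1)])
next
  case (Forall v r R)
  have wf: "wf_tm \<Upsilon> r" "wf_rule \<Upsilon> R" using Forall.prems(1) by auto
  have "a \<in> HF (fset (atoms A))" if "a |\<in>| elems (val A \<rho> r)" for a
    using that Forall.prems(2) elems_HF [OF val_HF [OF assms(1) wf(1), of \<rho>]] by auto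
  then have IH: "finite (Den R A (\<rho>(v := a))) \<and>
    (\<forall>f xs b. (f, xs, b) \<in> Den R A (\<rho>(v := a)) \<longrightarrow> dyn_arity \<Upsilon> f = Some (length xs) \<and>
      set xs \<subseteq> HF (fset (atoms A)) \<and> b \<in> HF (fset (atoms A)) \<and>
      (f \<in> dyn_preds \<Upsilon> \<longrightarrow> boolean b))" if "a |\<in>| elems (val A \<rho> r)" for a
    using that Forall.prems(2) by (intro Forall.IH wf(2)) auto
  have "finite (Den (Forall v r R) A \<rho>)" using IH by simp
  moreover have "\<exists>a. a |\<in>| elems (val A \<rho> r) \<and> u \<in> Den R A (\<rho>(v := a))"
    if "u \<in> Den (Forall v r R) A \<rho>" for u
    using that by auto
  ultimately show ?case using IH by blast
next
  case (Cond g R1 R2)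
  have "wf_rule \<Upsilon> R1" "wf_rule \<Upsilon> R2" using Cond.prems(1) by auto
  with Cond.IH [OF _ Cond.prems(2)] show ?case by simp
qed simp

lemma is_state_initial:
  assumes "is_structure (input_arity \<Upsilon>) I"
  shows "is_state \<Upsilon> (initial_state I)"
proof -
  have "extent (initial_state I) f = {}" for f :: dname
    by (auto simp: extent_def initial_state_def)
  then show ?thesis
    using assms by (simp add: is_state_def initial_state_def)
qed

lemma is_state_sequel:
  assumes A: "is_state \<Upsilon> A" and "is_program \<Upsilon> \<Pi>"
  shows "is_state \<Upsilon> (sequel \<Pi> A)"
proof -
  define U where "U = Den \<Pi> A (\<lambda>v. ff)"
  have U: "finite U" "\<And>f xs b. (f, xs, b) \<in> U \<Longrightarrow> dyn_arity \<Upsilon> f = Some (length xs) \<and>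
      set xs \<subseteq> HF (fset (atoms A)) \<and> b \<in> HF (fset (atoms A)) \<and>
      (f \<in> dyn_preds \<Upsilon> \<longrightarrow> boolean b)"
    using Den_wf [OF A, of \<Pi> "\<lambda>v. ff"] assms(2) by (auto simp: is_program_def U_def)
  show ?thesis
  proof (cases "clash U")
    case True
    then show ?thesis using A by (simp add: sequel_def U_def)
  next
    case False
    then have the: "(THE b. (f, xs, b) \<in> U) = c" if "(f, xs, c) \<in> U" for f xs c
      using that by (auto simp: clash_def)
    have seq: "sequel \<Pi> A =
        A\<lparr>dyn := \<lambda>f xs. if \<exists>b. (f, xs, b) \<in> U then THE b. (f, xs, b) \<in> U else dyn A f xs\<rparr>"
      using False by (simp add: sequel_def Let_def flip: U_def)
    have at: "atoms (sequel \<Pi> A) = atoms A" "structure_of (sequel \<Pi> A) = structure_of A"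
      by (simp_all add: seq atoms_def)
    have ext: "(xs, y) \<in> extent A f \<or> (f, xs, y) \<in> U"
      if "(xs, y) \<in> extent (sequel \<Pi> A) f" for f xs y
    proof (cases "\<exists>b. (f, xs, b) \<in> U")
      case True
      then obtain b where b: "(f, xs, b) \<in> U" by blast
      then have "dyn (sequel \<Pi> A) f xs = b" using the [OF b] by (auto simp: seq)
      with b that show ?thesis by (simp add: extent_def)
    next
      case False
      then have "dyn (sequel \<Pi> A) f xs = dyn A f xs" by (simp add: seq)
      with that show ?thesis by (simp add: extent_def)
    qed
    then have "extent (sequel \<Pi> A) f \<subseteq> extent A f \<union> snd ` U" for f
      by force
    then have "finite (extent (sequel \<Pi> A) f)" for f
      using A U(1) by (meson finite_Un finite_imageI finite_subset is_state_def)
    moreover have "dyn_arity \<Upsilon> f = Some (length xs) \<and>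
        set xs \<subseteq> HF (fset (atoms A)) \<and> y \<in> HF (fset (atoms A)) \<and>
        (f \<in> dyn_preds \<Upsilon> \<longrightarrow> boolean y)" if "(xs, y) \<in> extent (sequel \<Pi> A) f" for f xs y
      using ext [OF that] U(2) A unfolding is_state_def by blast
    ultimately show ?thesis
      using A by (simp add: is_state_def at)
  qed
qed

lemma matching_disjoint: "matching_yes \<inter> matching_no = {}"
  by (auto simp: matching_yes_def matching_no_def)

end

theory Submission
  imports Defs
    "HOL-Combinatorics.Permutations"
    "HOL-Library.Cardinality"
    "HOL-Real_Asymp.Real_Asymp"
begin

text \<open>
  The instances are disjoint unions of two complete bipartite graphs, so all that matters is the sizes
  of the four sets of boys and girls in the two components; they are \<open>m, m, m, m\<close> for the yes-instance
  and \<open>m + 1, m, m - 1, m\<close> for the no-instance, which therefore have the same \<open>InputSize\<close>. An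
  active object has polynomially many conjugates under the colour-preserving permutations of the
  atoms, all of them active. By induction on the rank this forces every active object to have a support
  of constant size: atoms that are pairwise not exchangeable would give exponentially many
  conjugates, and a class of exchangeable atoms with a complement that is small but not constant would
  give too many. Hereditarily boundedly supported objects over the two instances can be compared by a
  back-and-forth relation along finite partial colour-preserving bijections. This relation respects
  equality and membership, and hence the evaluation of terms and rules, so that
  the two runs proceed in lockstep and end with the same output.
\<close>

section \<open>Supports\<close>

text \<open>Counting controls active objects only, whereas the values of subterms, comprehension
  terms above all, need not be active and may be too many for that argument. So two bounds are used:
  \<open>k\<close> for the supports of everything stored in a dynamic function, and
  \<open>K\<close>, computed from \<open>k\<close> and the syntax of the program, for what a single
  step can build from it. Merely propagating the relation would raise the bound at each of
  polynomially many steps. It is brought back from \<open>K\<close> to \<open>k\<close>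
  (\<open>sim_reduce\<close>) because a stored value is active and, by equivariance, fixed by every
  permutation that fixes its arguments. Constants: let \<open>n\<close> be the number of vertices
  and \<open>n ^ d\<close> a bound on the active objects. A colour class, of size about
  \<open>n / 4\<close>, has more than \<open>n ^ d\<close> subsets of each size \<open>e\<close>
  with \<open>d < e\<close> and \<open>e \<le> M\<close>, so at most \<open>d\<close> atoms per
  colour are exceptional and supports have at most \<open>4 * d\<close> atoms. \<open>M\<close> is
  of order \<open>log n\<close>: \<open>t\<close> separating transpositions yield
  \<open>2 ^ t > n ^ d\<close> conjugates and use up a constant number of atoms each.\<close>

type_synonym ('a, 'v) colouring = "'a \<Rightarrow> 'v option"

text \<open>The vertex set is \<open>dom c\<close> inside a larger type. Requiring the identity
  outside it gives a group of bijections of the whole type, which acts on objects by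
  \<open>map_obj\<close>.\<close>

definition cperm :: "('a, 'v) colouring \<Rightarrow> ('a \<Rightarrow> 'a) \<Rightarrow> bool" where
  "cperm c \<pi> \<longleftrightarrow> \<pi> permutes dom c \<and> c \<circ> \<pi> = c"

lemma cperm_id: "cperm c id"
  by (simp add: cperm_def permutes_id)

lemma cperm_comp: "cperm c \<pi> \<Longrightarrow> cperm c \<sigma> \<Longrightarrow> cperm c (\<pi> \<circ> \<sigma>)"
  unfolding cperm_def by (metis comp_assoc permutes_compose)

lemma cperm_bij: "cperm c \<pi> \<Longrightarrow> bij \<pi>"
  by (auto simp: cperm_def dest: permutes_bij)

lemma cperm_inv: "cperm c \<pi> \<Longrightarrow> cperm c (inv \<pi>)"
  unfolding cperm_def by (metis comp_assoc comp_id permutes_inv permutes_inv_o(1))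

lemma cperm_colour: "cperm c \<pi> \<Longrightarrow> c (\<pi> a) = c a"
  unfolding cperm_def by (metis comp_apply)

lemma cperm_transpose:
  assumes "c a = c b" "a \<in> dom c"
  shows "cperm c (transpose a b)"
  using assms by (auto simp: cperm_def fun_eq_iff transpose_def permutes_swap_id domIff)

section \<open>The action of permutations on hereditarily finite objects\<close>

lemma map_obj_comp: "map_obj \<pi> (map_obj \<sigma> x) = map_obj (\<pi> \<circ> \<sigma>) x"
  by (simp add: obj.map_comp)

lemma map_obj_id [simp]: "map_obj id x = x" "map_obj (\<lambda>a. a) x = x"
  by (simp_all add: obj.map_id obj.map_ident)

lemma map_obj_inv:
  assumes "bij \<pi>"
  shows "map_obj (inv \<pi>) (map_obj \<pi> x) = x" "map_obj \<pi> (map_obj (inv \<pi>) x) = x"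
  using assms by (simp_all add: map_obj_comp bij_is_inj surj_iff[THEN iffD1, OF bij_is_surj])

lemma map_obj_eq_iff [simp]: "bij \<pi> \<Longrightarrow> map_obj \<pi> x = map_obj \<pi> y \<longleftrightarrow> x = y"
  by (simp add: obj.inj_map bij_is_inj inj_eq)

lemma elems_map_obj: "elems (map_obj \<pi> x) = map_obj \<pi> |`| elems x"
  by (cases x) auto

lemma map_obj_mem_iff: "bij \<pi> \<Longrightarrow> map_obj \<pi> y |\<in>| elems (map_obj \<pi> x) \<longleftrightarrow> y |\<in>| elems x"
  by (auto simp: elems_map_obj)

definition supports :: "('a, 'v) colouring \<Rightarrow> 'a set \<Rightarrow> 'a obj \<Rightarrow> bool" where
  "supports c S x \<longleftrightarrow> (\<forall>\<pi>. cperm c \<pi> \<longrightarrow> (\<forall>a\<in>S. \<pi> a = a) \<longrightarrow> map_obj \<pi> x = x)"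

lemma supportsD: "supports c S x \<Longrightarrow> cperm c \<pi> \<Longrightarrow> (\<And>a. a \<in> S \<Longrightarrow> \<pi> a = a) \<Longrightarrow> map_obj \<pi> x = x"
  by (simp add: supports_def)

lemma supports_map_obj:
  assumes "supports c S x" "cperm c \<pi>"
  shows "supports c (\<pi> ` S) (map_obj \<pi> x)"
  unfolding supports_def
proof (intro allI impI)
  fix \<sigma> assume \<sigma>: "cperm c \<sigma>" "\<forall>a\<in>\<pi> ` S. \<sigma> a = a"
  have b: "bij \<pi>" using assms cperm_bij by blast
  have "map_obj (inv \<pi> \<circ> \<sigma> \<circ> \<pi>) x = x"
    by (rule supportsD[OF assms(1)]) (use \<sigma> assms b in \<open>auto intro!: cperm_comp cperm_inv simp: bij_is_inj inv_f_f\<close>)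
  then have "map_obj \<pi> (map_obj (inv \<pi>) (map_obj \<sigma> (map_obj \<pi> x))) = map_obj \<pi> x"
    by (simp add: map_obj_comp comp_assoc)
  then show "map_obj \<sigma> (map_obj \<pi> x) = map_obj \<pi> x"
    by (simp add: map_obj_inv b)
qed

text \<open>The pointwise stabiliser of \<open>S\<close> is generated by transpositions: if
  \<open>\<pi>\<close> moves \<open>a\<close>, composing it with the transposition of
  \<open>a\<close> and \<open>\<pi> a\<close> makes \<open>a\<close> a fixed point and moves no new
  atom. Induction on the number of moved atoms.\<close>

lemma supports_if_transpose:
  assumes fin: "finite (dom c)"
    and tr: "\<And>a b. a \<in> dom c \<Longrightarrow> a \<notin> S \<Longrightarrow> b \<notin> S \<Longrightarrow> c a = c b \<Longrightarrow> map_obj (transpose a b) x = x"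
  shows "supports c S x"
  unfolding supports_def
proof (intro allI impI)
  fix \<pi> assume "cperm c \<pi>" "\<forall>a\<in>S. \<pi> a = a"
  then show "map_obj \<pi> x = x"
  proof (induction "card {a. \<pi> a \<noteq> a}" arbitrary: \<pi> rule: less_induct)
    case less
    have sub: "{a. \<pi> a \<noteq> a} \<subseteq> dom c"
      using less.prems(1) by (auto simp: cperm_def permutes_def)
    have bij: "bij \<pi>" using less.prems(1) by (rule cperm_bij)
    show ?case
    proof (cases "\<exists>a. \<pi> a \<noteq> a")
      case False
      then have "\<pi> = id" by auto
      then show ?thesis by simp
    next
      case True
      then obtain a where a: "\<pi> a \<noteq> a" by blast
      have aS: "a \<notin> S" "\<pi> a \<notin> S" "a \<in> dom c" "c a = c (\<pi> a)"
        using a less.prems sub bij by (auto simp: cperm_colour bij_def inj_eq)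
      define \<sigma> where "\<sigma> = transpose a (\<pi> a) \<circ> \<pi>"
      have \<sigma>: "cperm c \<sigma>" unfolding \<sigma>_def using aS less.prems by (intro cperm_comp cperm_transpose) auto
      have ss: "{b. \<sigma> b \<noteq> b} \<subset> {a. \<pi> a \<noteq> a}"
      proof
        show "{b. \<sigma> b \<noteq> b} \<subseteq> {a. \<pi> a \<noteq> a}"
          using bij a by (auto simp: \<sigma>_def transpose_def bij_def inj_eq split: if_splits)
        have "a \<notin> {b. \<sigma> b \<noteq> b}" by (simp add: \<sigma>_def)
        then show "{b. \<sigma> b \<noteq> b} \<noteq> {a. \<pi> a \<noteq> a}" using a by blast
      qed
      have "map_obj \<sigma> x = x"
      proof (rule less.hyps[OF _ \<sigma>])
        show "card {b. \<sigma> b \<noteq> b} < card {a. \<pi> a \<noteq> a}"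
          using ss sub fin by (meson finite_subset psubset_card_mono)
        show "\<forall>b\<in>S. \<sigma> b = b"
          using less.prems(2) ss by auto
      qed
      moreover have "\<pi> = transpose a (\<pi> a) \<circ> \<sigma>"
        by (simp add: \<sigma>_def fun_eq_iff)
      ultimately have "map_obj \<pi> x = map_obj (transpose a (\<pi> a)) x"
        by (metis map_obj_comp)
      then show ?thesis using tr aS by metis
    qed
  qed
qed

text \<open>The recursion builds the set of all images of \<open>x\<close> under products of the transpositions chosen;
  the witness \<open>y\<close> of the transposition chosen first separates the two halves of that set.\<close>

lemma many_images:
  assumes el: "\<And>y. y |\<in>| elems x \<Longrightarrow> \<exists>S. finite S \<and> card S \<le> k \<and> supports c S y"
    and set: "x = HSet F"
    and fin: "finite Z" "card Z + t * (k + 2) \<le> M"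
    and tr: "\<And>Z. finite Z \<Longrightarrow> card Z \<le> M \<Longrightarrow> \<exists>a b. a \<in> dom c \<and> c a = c b \<and> a \<notin> Z \<and> b \<notin> Z \<and>
         map_obj (transpose a b) x \<noteq> x"
  shows "\<exists>W. finite W \<and> card W = 2 ^ t \<and>
     (\<forall>w\<in>W. \<exists>\<pi>. cperm c \<pi> \<and> (\<forall>z\<in>Z. \<pi> z = z) \<and> w = map_obj \<pi> x)"
  using fin
proof (induction t arbitrary: Z)
  case 0
  show ?case by (rule exI[of _ "{x}"]) (auto intro!: exI[of _ id] cperm_id)
next
  case (Suc t)
  obtain a b where ab: "a \<in> dom c" "c a = c b" "a \<notin> Z" "b \<notin> Z" "map_obj (transpose a b) x \<noteq> x"
    using tr[OF Suc.prems(1)] Suc.prems(2) by auto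
  define \<tau> where "\<tau> = map_obj (transpose a b)"
  have \<tau>: "cperm c (transpose a b)" using ab by (simp add: cperm_transpose)
  have b\<tau>: "bij (transpose a b)" by simp
  have \<tau>\<tau>: "\<tau> (\<tau> w) = w" for w unfolding \<tau>_def by (simp add: map_obj_comp)
  have inj\<tau>: "inj \<tau>" by (metis \<tau>\<tau> injI)
  have "\<exists>y. y |\<in>| F \<and> \<tau> y |\<notin>| F"
  proof (rule ccontr)
    assume "\<not> ?thesis"
    then have "\<tau> |`| F |\<subseteq>| F" by auto
    moreover have "F |\<subseteq>| \<tau> |`| F" using calculation \<tau>\<tau> by (metis (no_types, lifting) fimage_eqI fsubsetI fsubsetD)
    ultimately have "\<tau> |`| F = F" by (rule fsubset_antisym)
    then show False using ab(5) unfolding set \<tau>_def by simp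
  qed
  then obtain y where y: "y |\<in>| F" "\<tau> y |\<notin>| F" by blast
  obtain S where S: "finite S" "card S \<le> k" "supports c S y"
    using el[of y] y set by auto
  \<comment> \<open>Permutations fixing \<open>Z'\<close> pointwise fix \<open>y\<close> as well as
    \<open>\<tau> y\<close>, whose support lies in \<open>S \<union> {a, b}\<close>. The enlargement
    costs \<open>k + 2\<close> atoms per transposition.\<close>
  define Z' where "Z' = Z \<union> S \<union> {a, b}"
  have "card Z' \<le> card Z + card S + card {a,b}"
    unfolding Z'_def by (meson add_right_mono card_Un_le le_trans)
  also have "\<dots> \<le> card Z + k + 2" using S by (simp add: card_insert_if)
  finally have "card Z' + t * (k + 2) \<le> M" using Suc.prems(2) by simp
  moreover have "finite Z'" using Suc.prems S by (simp add: Z'_def)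
  ultimately obtain W where W: "finite W" "card W = 2 ^ t"
     "\<And>w. w\<in>W \<Longrightarrow> \<exists>\<pi>. cperm c \<pi> \<and> (\<forall>z\<in>Z'. \<pi> z = z) \<and> w = map_obj \<pi> x"
    using Suc.IH[of Z'] by blast
  have sep: "y |\<in>| elems w \<and> \<tau> y |\<notin>| elems w" if "w \<in> W" for w
  proof -
    obtain \<pi> where \<pi>: "cperm c \<pi>" "\<forall>z\<in>Z'. \<pi> z = z" "w = map_obj \<pi> x" using W(3) \<open>w \<in> W\<close> by blast
    have b: "bij \<pi>" using \<pi> cperm_bij by blast
    have 1: "map_obj \<pi> y = y" using supportsD[OF S(3) \<pi>(1)] \<pi>(2) by (auto simp: Z'_def)
    have "supports c (transpose a b ` S) (\<tau> y)"
      unfolding \<tau>_def by (rule supports_map_obj[OF S(3) \<tau>])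
    then have 2: "map_obj \<pi> (\<tau> y) = \<tau> y"
      by (rule supportsD[OF _ \<pi>(1)]) (use \<pi>(2) in \<open>auto simp: Z'_def transpose_def\<close>)
    show ?thesis
      using map_obj_mem_iff[OF b, of y x] map_obj_mem_iff[OF b, of "\<tau> y" x] y set 1 2 \<pi>(3) by simp
  qed
  have disj: "W \<inter> \<tau> ` W = {}"
  proof (rule ccontr)
    assume "\<not> ?thesis"
    then obtain w where w: "w \<in> W" "\<tau> w \<in> W" by blast
    then have "y |\<in>| elems (\<tau> w)" using sep by blast
    then have "\<tau> y |\<in>| elems (\<tau> (\<tau> w))" unfolding \<tau>_def by (simp add: map_obj_mem_iff)
    then show False using sep[OF w(1)] by (simp add: \<tau>\<tau>)
  qed
  show ?case
  proof (rule exI[of _ "W \<union> \<tau> ` W"], intro conjI ballI)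
    show "finite (W \<union> \<tau> ` W)" using W by simp
    show "card (W \<union> \<tau> ` W) = 2 ^ Suc t"
      using W disj inj\<tau> by (simp add: card_Un_disjoint card_image inj_on_subset)
    fix w assume "w \<in> W \<union> \<tau> ` W"
    then show "\<exists>\<pi>. cperm c \<pi> \<and> (\<forall>z\<in>Z. \<pi> z = z) \<and> w = map_obj \<pi> x"
    proof
      assume "w \<in> W" then show ?thesis using W(3) by (fastforce simp: Z'_def)
    next
      assume "w \<in> \<tau> ` W"
      then obtain v where v: "v \<in> W" "w = \<tau> v" by blast
      then obtain \<pi> where \<pi>: "cperm c \<pi>" "\<forall>z\<in>Z'. \<pi> z = z" "v = map_obj \<pi> x" using W(3) by blast
      show ?thesis
        using \<pi> v \<tau> ab by (intro exI[of _ "transpose a b \<circ> \<pi>"])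
          (auto simp: \<tau>_def map_obj_comp Z'_def transpose_def intro!: cperm_comp)
    qed
  qed
qed

text \<open>Homogeneity, the source of all permutations needed besides transpositions. A new pair
  \<open>(a, b)\<close> is added by composing with the transposition of \<open>\<pi> a\<close> and
  \<open>b\<close>; values already prescribed differ from both and stay as they are.\<close>

lemma cperm_extend:
  assumes "finite s" "single_valued s" "single_valued (s\<inverse>)"
    and "\<And>a b. (a, b) \<in> s \<Longrightarrow> a \<in> dom c \<and> c b = c a"
  shows "\<exists>\<pi>. cperm c \<pi> \<and> (\<forall>(a, b)\<in>s. \<pi> a = b)"
  using assms
proof (induction s rule: finite_induct)
  case empty
  show ?case using cperm_id by auto
next
  case (insert x s)
  obtain a b where x: "x = (a, b)" by fastforce
  have "single_valued s" "single_valued (s\<inverse>)"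
    using insert.prems(1,2) by (auto simp: single_valued_def)
  then have "\<exists>\<pi>. cperm c \<pi> \<and> (\<forall>(a, b)\<in>s. \<pi> a = b)"
    by (rule insert.IH) (use insert.prems(3) in blast)
  then obtain \<pi> where \<pi>: "cperm c \<pi>" "\<And>a' b'. (a', b') \<in> s \<Longrightarrow> \<pi> a' = b'"
    by fast
  have ab: "a \<in> dom c" "c b = c a" using insert.prems(3) x by auto
  have "cperm c (transpose (\<pi> a) b)"
    using ab cperm_colour[OF \<pi>(1), of a] by (intro cperm_transpose) auto
  then have "cperm c (transpose (\<pi> a) b \<circ> \<pi>)" using \<pi>(1) by (rule cperm_comp)
  moreover have "transpose (\<pi> a) b (\<pi> a') = b'" if "(a', b') \<in> insert x s" for a' b'
  proof (cases "(a', b') = (a, b)")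
    case False
    then have in_s: "(a', b') \<in> s" using that x by auto
    have "a' \<noteq> a" using insert.prems(1) insert.hyps(2) in_s x by (auto simp: single_valued_def)
    then have "b' \<noteq> \<pi> a" using \<pi>(2)[OF in_s] cperm_bij[OF \<pi>(1)] by (metis bij_pointE)
    moreover have "b' \<noteq> b" using insert.prems(2) insert.hyps(2) in_s x by (auto simp: single_valued_def)
    ultimately show ?thesis using \<pi>(2)[OF in_s] by (simp add: transpose_def)
  qed auto
  ultimately show ?case
    by (intro exI[of _ "transpose (\<pi> a) b \<circ> \<pi>"] conjI; force)
qed

section \<open>Exceptional atoms and the number of conjugates\<close>

definition colour_class :: "('a, 'v) colouring \<Rightarrow> 'v \<Rightarrow> 'a set" where
  "colour_class c v = {a. c a = Some v}"

text \<open>Exchangeability of atoms with respect to \<open>x\<close> is transitive, so in a colour class there is at most one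
  exchangeability class containing more than half of the atoms; \<open>exceptional\<close> is its complement.\<close>

definition exceptional :: "('a, 'v) colouring \<Rightarrow> 'v \<Rightarrow> 'a obj \<Rightarrow> 'a set" where
  "exceptional c v x = {a \<in> colour_class c v.
     2 * card {b \<in> colour_class c v. map_obj (transpose a b) x = x} \<le> card (colour_class c v)}"

lemma cperm_colour_class:
  assumes "cperm c \<pi>"
  shows "\<pi> a \<in> colour_class c v \<longleftrightarrow> a \<in> colour_class c v" "\<pi> ` colour_class c v = colour_class c v"
proof -
  show *: "\<pi> a \<in> colour_class c v \<longleftrightarrow> a \<in> colour_class c v" for a
    by (simp add: colour_class_def cperm_colour[OF assms])
  show "\<pi> ` colour_class c v = colour_class c v"
  proof
    show "colour_class c v \<subseteq> \<pi> ` colour_class c v"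
    proof
      fix a assume a: "a \<in> colour_class c v"
      obtain b where "a = \<pi> b" using cperm_bij[OF assms] by (metis bij_pointE)
      with a * show "a \<in> \<pi> ` colour_class c v" by blast
    qed
  qed (use * in blast)
qed

lemma map_obj_transpose_map_obj_iff:
  assumes "bij \<pi>"
  shows "map_obj (transpose (\<pi> a) (\<pi> b)) (map_obj \<pi> x) = map_obj \<pi> x \<longleftrightarrow> map_obj (transpose a b) x = x"
proof -
  have "transpose (\<pi> a) (\<pi> b) \<circ> \<pi> = \<pi> \<circ> transpose a b"
    using assms by (auto simp: fun_eq_iff transpose_def bij_def inj_eq)
  then have "map_obj (transpose (\<pi> a) (\<pi> b)) (map_obj \<pi> x) = map_obj \<pi> (map_obj (transpose a b) x)"
    by (simp add: map_obj_comp)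
  then show ?thesis using assms by simp
qed

lemma exceptional_map_obj:
  assumes "cperm c \<pi>"
  shows "exceptional c v (map_obj \<pi> x) = \<pi> ` exceptional c v x"
proof -
  have b: "bij \<pi>" by (rule cperm_bij[OF assms])
  have "{d \<in> colour_class c v. map_obj (transpose (\<pi> a) d) (map_obj \<pi> x) = map_obj \<pi> x}
      = \<pi> ` {d \<in> colour_class c v. map_obj (transpose a d) x = x}" for a
  proof -
    have "{d \<in> \<pi> ` colour_class c v. map_obj (transpose (\<pi> a) d) (map_obj \<pi> x) = map_obj \<pi> x}
      = \<pi> ` {d \<in> colour_class c v. map_obj (transpose a d) x = x}"
      using map_obj_transpose_map_obj_iff[OF b] by blast
    then show ?thesis by (simp add: cperm_colour_class(2)[OF assms])
  qed
  then have *: "card {d \<in> colour_class c v. map_obj (transpose (\<pi> a) d) (map_obj \<pi> x) = map_obj \<pi> x}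
      = card {d \<in> colour_class c v. map_obj (transpose a d) x = x}" for a
    by (simp add: card_image inj_on_subset[OF bij_is_inj[OF b]])
  have "{a \<in> \<pi> ` colour_class c v.
      2 * card {d \<in> colour_class c v. map_obj (transpose a d) (map_obj \<pi> x) = map_obj \<pi> x} \<le> card (colour_class c v)}
    = \<pi> ` exceptional c v x"
    unfolding exceptional_def using * by fastforce
  then show ?thesis
    unfolding exceptional_def by (simp add: cperm_colour_class(2)[OF assms])
qed

text \<open>Any subset \<open>B\<close> of the class with as many atoms as the exceptional set is
  the exceptional set of a conjugate of \<open>x\<close>: a bijection onto \<open>B\<close> extends
  to a permutation by \<open>cperm_extend\<close>. So there are at least as many conjugates as such
  subsets.\<close>

lemma choose_exceptional_le:
  assumes fin: "finite (dom c)" "finite A" and A: "\<And>\<pi>. cperm c \<pi> \<Longrightarrow> map_obj \<pi> x \<in> A"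
  shows "card (colour_class c v) choose card (exceptional c v x) \<le> card A"
proof -
  let ?C = "colour_class c v" and ?E = "exceptional c v x"
  have C: "finite ?C" by (rule finite_subset[OF _ fin(1)]) (auto simp: colour_class_def)
  have E: "?E \<subseteq> ?C" by (auto simp: exceptional_def)
  have "{B. B \<subseteq> ?C \<and> card B = card ?E} \<subseteq> exceptional c v ` A"
  proof
    fix B assume "B \<in> {B. B \<subseteq> ?C \<and> card B = card ?E}"
    then have B: "B \<subseteq> ?C" "card B = card ?E" by auto
    then obtain h where h: "bij_betw h ?E B"
      using C E by (metis finite_same_card_bij finite_subset)
    define s where "s = (\<lambda>a. (a, h a)) ` ?E"
    have "\<exists>\<pi>. cperm c \<pi> \<and> (\<forall>(a, b)\<in>s. \<pi> a = b)"
    proof (rule cperm_extend)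
      show "finite s" unfolding s_def using C E finite_subset by auto
      show "single_valued s" by (auto simp: s_def single_valued_def)
      show "single_valued (s\<inverse>)"
        using h by (auto simp: s_def single_valued_def bij_betw_def inj_on_def)
      show "a \<in> dom c \<and> c b = c a" if "(a, b) \<in> s" for a b
      proof -
        have "a \<in> ?E" "b \<in> B" using that h by (auto simp: s_def bij_betw_def)
        then have "a \<in> ?C" "b \<in> ?C" using E B(1) by auto
        then show ?thesis by (auto simp: colour_class_def)
      qed
    qed
    then obtain \<pi> where \<pi>: "cperm c \<pi>" "\<forall>(a, b)\<in>s. \<pi> a = b" by blast
    then have "\<pi> ` ?E = h ` ?E" by (auto simp: s_def)
    then have "exceptional c v (map_obj \<pi> x) = B"
      using exceptional_map_obj[OF \<pi>(1)] h by (simp add: bij_betw_def)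
    then show "B \<in> exceptional c v ` A" using A[OF \<pi>(1)] by blast
  qed
  then have "card {B. B \<subseteq> ?C \<and> card B = card ?E} \<le> card A"
    by (meson card_image_le card_mono fin(2) finite_imageI le_trans)
  then show ?thesis by (simp add: n_subsets[OF C])
qed

lemma map_obj_transpose_trans:
  assumes "map_obj (transpose a b) x = x" "map_obj (transpose b d) x = x"
  shows "map_obj (transpose a d) x = x"
proof (cases "a = d \<or> a = b \<or> b = d")
  case True
  then show ?thesis using assms by auto
next
  case False
  then have "transpose a d = transpose a b \<circ> (transpose b d \<circ> transpose a b)"
    by (auto simp: fun_eq_iff transpose_def)
  then show ?thesis using assms by (metis map_obj_comp)
qed

text \<open>Each of the two atoms is exchangeable with more than half of the class, hence both with
  a common atom \<open>d\<close>; exchangeability is transitive.\<close>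

lemma transpose_nonexceptional:
  assumes C: "finite (colour_class c v)"
    and "a \<in> colour_class c v - exceptional c v x" "b \<in> colour_class c v - exceptional c v x"
  shows "map_obj (transpose a b) x = x"
proof -
  let ?C = "colour_class c v"
  let ?A = "\<lambda>a. {d \<in> ?C. map_obj (transpose a d) x = x}"
  have "?A a \<inter> ?A b \<noteq> {}"
  proof
    assume "?A a \<inter> ?A b = {}"
    then have "card (?A a) + card (?A b) = card (?A a \<union> ?A b)"
      using C by (simp add: card_Un_disjoint)
    also have "\<dots> \<le> card ?C" using C by (intro card_mono) auto
    finally show False using assms(2,3) by (auto simp: exceptional_def)
  qed
  then obtain d where "map_obj (transpose a d) x = x" "map_obj (transpose b d) x = x" by blast
  then show ?thesis by (metis map_obj_transpose_trans transpose_commute)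
qed

text \<open>The bound is reached in two stages for each colour. If no set of at most
  \<open>M\<close> atoms had a complement of mutually exchangeable atoms, \<open>many_images\<close>
  would produce \<open>2 ^ t\<close> conjugates; so the exceptional set has at most \<open>M\<close>
  atoms. Then the binomial estimate excludes all sizes from \<open>k + 1\<close> to
  \<open>M\<close>. The induction supplies \<open>many_images\<close> with supports of the elements;
  they obey the same bound, which therefore does not grow with the rank.\<close>

theorem small_support:
  fixes c :: "('a, 'v::finite) colouring"
  assumes fin: "finite (dom c)" "finite A" and k: "1 \<le> k"
    and closed: "\<And>x \<pi>. x \<in> A \<Longrightarrow> cperm c \<pi> \<Longrightarrow> map_obj \<pi> x \<in> A"
      "\<And>x y. x \<in> A \<Longrightarrow> y |\<in>| elems x \<Longrightarrow> y \<in> A"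
    and t: "card A < 2 ^ t" and M: "t * (CARD('v) * k + 2) \<le> M"
    and large: "\<And>v. 2 * M < card (colour_class c v)"
      "\<And>v e. k < e \<Longrightarrow> e \<le> M \<Longrightarrow> card A < card (colour_class c v) choose e"
    and "x \<in> A"
  shows "\<exists>S. finite S \<and> S \<subseteq> dom c \<and> card S \<le> CARD('v) * k \<and> supports c S x"
  using \<open>x \<in> A\<close>
proof (induction x)
  case (Atom a)
  \<comment> \<open>The intersection keeps the support inside \<open>dom c\<close>; an atom outside
    is fixed by every \<open>cperm\<close> anyway.\<close>
  have "supports c ({a} \<inter> dom c) (Atom a)"
    unfolding supports_def
  proof (intro allI impI)
    fix \<pi> assume "cperm c \<pi>" "\<forall>b\<in>{a} \<inter> dom c. \<pi> b = b"
    then have "\<pi> a = a" by (cases "a \<in> dom c") (auto simp: cperm_def permutes_def)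
    then show "map_obj \<pi> (Atom a) = Atom a" by simp
  qed
  moreover have "card ({a} \<inter> dom c) \<le> CARD('v) * k"
  proof -
    have "card ({a} \<inter> dom c) \<le> card {a}" by (intro card_mono) auto
    also have "\<dots> \<le> CARD('v) * k" using k by (simp add: Suc_le_eq card_gt_0_iff)
    finally show ?thesis .
  qed
  ultimately show ?case by (intro exI[of _ "{a} \<inter> dom c"]) auto
next
  case (HSet F)
  let ?x = "HSet F"
  have C: "finite (colour_class c v)" for v
    by (rule finite_subset[OF _ fin(1)]) (auto simp: colour_class_def)
  have el: "\<exists>S. finite S \<and> card S \<le> CARD('v) * k \<and> supports c S y" if "y |\<in>| elems ?x" for y
    using HSet.IH[of y] that closed(2)[OF HSet.prems that] by auto
  have orb: "map_obj \<pi> ?x \<in> A" if "cperm c \<pi>" for \<pi> using closed(1)[OF HSet.prems that] .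
  have exc: "card (exceptional c v ?x) \<le> k" for v
  proof -
    have "\<exists>Z. finite Z \<and> card Z \<le> M \<and> (\<forall>a b. a \<in> colour_class c v - Z \<longrightarrow> b \<in> colour_class c v - Z \<longrightarrow>
        map_obj (transpose a b) ?x = ?x)"
    proof (rule ccontr)
      assume neg: "\<not> ?thesis"
      have "\<exists>W. finite W \<and> card W = 2 ^ t \<and>
          (\<forall>w\<in>W. \<exists>\<pi>. cperm c \<pi> \<and> (\<forall>z\<in>{}. \<pi> z = z) \<and> w = map_obj \<pi> ?x)"
      proof (rule many_images[OF el refl])
        show "card {} + t * (CARD('v) * k + 2) \<le> M" using M by simp
        fix Z :: "'a set" assume "finite Z" "card Z \<le> M"
        then obtain a b where "a \<in> colour_class c v - Z" "b \<in> colour_class c v - Z"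
            "map_obj (transpose a b) ?x \<noteq> ?x"
          using neg by blast
        then show "\<exists>a b. a \<in> dom c \<and> c a = c b \<and> a \<notin> Z \<and> b \<notin> Z \<and> map_obj (transpose a b) ?x \<noteq> ?x"
          by (intro exI[of _ a] exI[of _ b]) (auto simp: colour_class_def)
      qed auto
      then obtain W where W: "card W = 2 ^ t" "W \<subseteq> A" using orb by (metis subsetI)
      then have "2 ^ t \<le> card A" using fin(2) by (metis card_mono)
      then show False using t by simp
    qed
    then obtain Z where Z: "finite Z" "card Z \<le> M" "\<And>a b. a \<in> colour_class c v - Z \<Longrightarrow>
        b \<in> colour_class c v - Z \<Longrightarrow> map_obj (transpose a b) ?x = ?x"
      by blast
    \<comment> \<open>An atom of the class outside \<open>Z\<close> is exchangeable with all of the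
      class outside \<open>Z\<close>, which is more than half of it because
      \<open>2 * M < card (colour_class c v)\<close>.\<close>
    have "exceptional c v ?x \<subseteq> Z"
    proof
      fix a assume a: "a \<in> exceptional c v ?x"
      show "a \<in> Z"
      proof (rule ccontr)
        assume "a \<notin> Z"
        then have "colour_class c v - Z \<subseteq> {b \<in> colour_class c v. map_obj (transpose a b) ?x = ?x}"
          using Z(3) a by (auto simp: exceptional_def)
        then have "card (colour_class c v - Z) \<le> card {b \<in> colour_class c v. map_obj (transpose a b) ?x = ?x}"
          using C by (intro card_mono) auto
        moreover have "card (colour_class c v) \<le> card (colour_class c v - Z) + card Z"
          using Z(1) diff_card_le_card_Diff[of Z "colour_class c v"] by linarith
        ultimately show False using a large(1)[of v] Z(2) by (simp add: exceptional_def)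
      qed
    qed
    then have "card (exceptional c v ?x) \<le> M" using Z by (meson card_mono le_trans)
    then show ?thesis
      using choose_exceptional_le[OF fin orb, of v] large(2)[of "card (exceptional c v ?x)" v]
      by (meson leD leI)
  qed
  define S where "S = (\<Union>v. exceptional c v ?x)"
  have "card S \<le> (\<Sum>v\<in>UNIV. card (exceptional c v ?x))"
    unfolding S_def by (rule card_UN_le) simp
  also have "\<dots> \<le> (\<Sum>v\<in>(UNIV::'v set). k)" by (intro sum_mono exc)
  finally have card: "card S \<le> CARD('v) * k" by simp
  have sub: "S \<subseteq> dom c" by (auto simp: S_def exceptional_def colour_class_def)
  have "supports c S ?x"
  proof (rule supports_if_transpose[OF fin(1)])
    fix a b assume ab: "a \<in> dom c" "a \<notin> S" "b \<notin> S" "c a = c b"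
    then obtain v where "c a = Some v" by blast
    then show "map_obj (transpose a b) ?x = ?x"
      using ab by (intro transpose_nonexceptional[OF C[of v]]) (auto simp: S_def colour_class_def)
  qed
  then show ?case using card sub fin(1) finite_subset by blast
qed

section \<open>The back-and-forth relation\<close>

text \<open>As relations, partial bijections are reversed by \<open>converse\<close>, and the joint
  compatibility of several of them is expressed by their union. Since \<open>a\<close> has a colour,
  \<open>c' b = c a\<close> also puts \<open>b\<close> into \<open>dom c'\<close>.\<close>

definition pbij :: "('a, 'v) colouring \<Rightarrow> ('b, 'v) colouring \<Rightarrow> ('a \<times> 'b) set \<Rightarrow> bool" where
  "pbij c c' p \<longleftrightarrow> finite p \<and> single_valued p \<and> single_valued (p\<inverse>) \<and>
     (\<forall>(a, b)\<in>p. a \<in> dom c \<and> c' b = c a)"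

lemma pbijD:
  assumes "pbij c c' p"
  shows "finite p" "(a, b) \<in> p \<Longrightarrow> (a, b') \<in> p \<Longrightarrow> b = b'" "(a, b) \<in> p \<Longrightarrow> (a', b) \<in> p \<Longrightarrow> a = a'"
    "(a, b) \<in> p \<Longrightarrow> a \<in> dom c" "(a, b) \<in> p \<Longrightarrow> c' b = c a"
  using assms by (auto simp: pbij_def single_valued_def)

lemma pbijI:
  assumes "finite p" "\<And>a b b'. (a, b) \<in> p \<Longrightarrow> (a, b') \<in> p \<Longrightarrow> b = b'"
    "\<And>a a' b. (a, b) \<in> p \<Longrightarrow> (a', b) \<in> p \<Longrightarrow> a = a'"
    "\<And>a b. (a, b) \<in> p \<Longrightarrow> a \<in> dom c \<and> c' b = c a"
  shows "pbij c c' p"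
  using assms(1-3) assms(4) unfolding pbij_def single_valued_def by blast

lemma pbij_subset: "pbij c c' q \<Longrightarrow> p \<subseteq> q \<Longrightarrow> pbij c c' p"
  by (rule pbijI) (auto dest: pbijD intro: finite_subset)

lemma pbij_empty [simp]: "pbij c c' {}"
  by (simp add: pbij_def)

lemma pbij_converse: "pbij c' c (p\<inverse>) \<longleftrightarrow> pbij c c' p"
proof
  show *: "pbij c' c (p\<inverse>)" if p: "pbij c c' p" for c c' p
  proof (rule pbijI)
    fix b a assume "(b, a) \<in> p\<inverse>"
    then show "b \<in> dom c' \<and> c a = c' b" using pbijD(4,5)[OF p, of a b] by auto
  qed (use pbijD[OF p] in auto)
  show "pbij c' c (p\<inverse>) \<Longrightarrow> pbij c c' p" using *[of c' c "p\<inverse>"] by simp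
qed

lemma pbij_Un_converse: "pbij c' c (p\<inverse> \<union> q) \<longleftrightarrow> pbij c c' (p \<union> q\<inverse>)"
  by (metis converse_Un converse_converse pbij_converse)

lemma pbij_card_Domain: "pbij c c' p \<Longrightarrow> card (Domain p) = card p"
proof -
  assume p: "pbij c c' p"
  have "inj_on fst p" using pbijD(2)[OF p] by (auto simp: inj_on_def)
  then show ?thesis by (metis card_image fst_eq_Domain)
qed

lemma pbij_card_Range: "pbij c c' p \<Longrightarrow> card (Range p) = card p"
proof -
  assume p: "pbij c c' p"
  have "inj_on snd p" using pbijD(3)[OF p] by (auto simp: inj_on_def)
  then show ?thesis by (metis card_image snd_eq_Range)
qed

lemma pbij_relcomp:
  assumes "pbij c c' p" "pbij c' c'' q"
  shows "pbij c c'' (p O q)"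
proof (rule pbijI)
  show "finite (p O q)" using assms by (intro finite_relcomp) (auto dest: pbijD)
next
  fix x z z' assume "(x, z) \<in> p O q" "(x, z') \<in> p O q"
  then obtain y y' where "(x, y) \<in> p" "(y, z) \<in> q" "(x, y') \<in> p" "(y', z') \<in> q" by blast
  then show "z = z'" using pbijD(2)[OF assms(1)] pbijD(2)[OF assms(2)] by blast
next
  fix x x' z assume "(x, z) \<in> p O q" "(x', z) \<in> p O q"
  then obtain y y' where "(x, y) \<in> p" "(y, z) \<in> q" "(x', y') \<in> p" "(y', z) \<in> q" by blast
  then show "x = x'" using pbijD(3)[OF assms(1)] pbijD(3)[OF assms(2)] by blast
next
  fix x z assume "(x, z) \<in> p O q"
  then obtain y where "(x, y) \<in> p" "(y, z) \<in> q" by blast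
  then show "x \<in> dom c \<and> c'' z = c x"
    using pbijD(4,5)[OF assms(1), of x y] pbijD(5)[OF assms(2), of y z] by simp
qed

text \<open>
  \<open>T\<close> plays the role of a support of \<open>x\<close>. Requiring a match for every extension of \<open>p\<close> to \<open>T\<close>, rather
  than for some, makes equality and membership transfer without any mention of permutations.
\<close>

definition lifts ::
  "('a, 'v) colouring \<Rightarrow> ('b, 'v) colouring \<Rightarrow> nat \<Rightarrow> (('a \<times> 'b) set \<Rightarrow> 'x \<Rightarrow> 'y \<Rightarrow> bool) \<Rightarrow>
   ('a \<times> 'b) set \<Rightarrow> 'x set \<Rightarrow> 'y set \<Rightarrow> bool" where
  "lifts c c' k R p U V \<longleftrightarrow>
     (\<forall>x\<in>U. \<exists>T\<subseteq>dom c. finite T \<and> card T \<le> k \<and>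
        (\<forall>q. Domain q = T \<longrightarrow> pbij c c' (p \<union> q) \<longrightarrow> (\<exists>y\<in>V. R q x y)))"

lemma liftsD:
  assumes "lifts c c' k R p U V" "x \<in> U"
  obtains T where "T \<subseteq> dom c" "finite T" "card T \<le> k"
    "\<forall>q. Domain q = T \<longrightarrow> pbij c c' (p \<union> q) \<longrightarrow> (\<exists>y\<in>V. R q x y)"
proof -
  from assms have "\<exists>T\<subseteq>dom c. finite T \<and> card T \<le> k \<and>
      (\<forall>q. Domain q = T \<longrightarrow> pbij c c' (p \<union> q) \<longrightarrow> (\<exists>y\<in>V. R q x y))"
    unfolding lifts_def by (rule bspec)
  then show thesis by (elim exE conjE) (rule that)
qed

text \<open>Registered as a monotonicity rule because \<open>sim\<close> occurs under
  \<open>lifts\<close> in its own inductive definition.\<close>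

lemma lifts_mono_rel [mono]:
  "(\<And>q x y. R q x y \<longrightarrow> R' q x y) \<Longrightarrow> lifts c c' k R p U V \<longrightarrow> lifts c c' k R' p U V"
proof
  assume R: "\<And>q x y. R q x y \<longrightarrow> R' q x y" and L: "lifts c c' k R p U V"
  show "lifts c c' k R' p U V"
    unfolding lifts_def
  proof
    fix x assume "x \<in> U"
    then obtain T where T: "T \<subseteq> dom c" "finite T" "card T \<le> k"
      "\<forall>q. Domain q = T \<longrightarrow> pbij c c' (p \<union> q) \<longrightarrow> (\<exists>y\<in>V. R q x y)"
      by (rule liftsD[OF L])
    have "\<exists>y\<in>V. R' q x y" if "Domain q = T" "pbij c c' (p \<union> q)" for q
    proof -
      from T(4) that obtain y where "y \<in> V" "R q x y" by auto
      with R show ?thesis by auto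
    qed
    with T show "\<exists>T\<subseteq>dom c. finite T \<and> card T \<le> k \<and>
      (\<forall>q. Domain q = T \<longrightarrow> pbij c c' (p \<union> q) \<longrightarrow> (\<exists>y\<in>V. R' q x y))"
      by metis
  qed
qed

definition ample :: "('a, 'v) colouring \<Rightarrow> nat \<Rightarrow> bool" where
  "ample c N \<longleftrightarrow> finite (dom c) \<and> (\<forall>v. N \<le> card (colour_class c v))"

text \<open>\<open>T\<close> may meet the domain of \<open>p\<close>; there the extension has to
  repeat the pairs of \<open>p\<close>. Elsewhere a fresh atom of the right colour exists, since
  fewer than \<open>N\<close> atoms are in use.\<close>

lemma pbij_extend:
  assumes p: "pbij c c' p" and c': "ample c' N" and T: "finite T" "T \<subseteq> dom c" "card p + card T \<le> N"
  shows "\<exists>q. Domain q = T \<and> pbij c c' (p \<union> q)"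
  using T
proof (induction T rule: finite_induct)
  case empty
  show ?case using p by (intro exI[of _ "{}"]) auto
next
  case (insert a T)
  then obtain q where q: "Domain q = T" "pbij c c' (p \<union> q)" by auto
  have "\<exists>b. pbij c c' (insert (a, b) (p \<union> q))"
  proof (cases "a \<in> Domain (p \<union> q)")
    case True
    then show ?thesis using q(2) by (metis DomainE insert_absorb)
  next
    case False
    obtain v where v: "c a = Some v" using insert.prems by auto
    have fq: "pbij c c' q" using q(2) by (rule pbij_subset) auto
    have "card (Range (p \<union> q)) = card (p \<union> q)" using q(2) by (rule pbij_card_Range)
    also have "\<dots> \<le> card p + card q" by (rule card_Un_le)
    also have "card q = card T" using pbij_card_Domain[OF fq] q(1) by simp
    also have "card p + card T < card (colour_class c' v)"
      using insert.prems insert.hyps c' by (auto simp: ample_def intro: less_le_trans)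
    finally have "\<not> colour_class c' v \<subseteq> Range (p \<union> q)"
      using pbijD(1)[OF q(2)] by (meson card_mono finite_Range leD)
    then obtain b where b: "c' b = Some v" "b \<notin> Range (p \<union> q)" by (auto simp: colour_class_def)
    have "pbij c c' (insert (a, b) (p \<union> q))"
    proof (rule pbijI)
      show "finite (insert (a, b) (p \<union> q))" using pbijD(1)[OF q(2)] by simp
    next
      fix x y assume "(x, y) \<in> insert (a, b) (p \<union> q)"
      then show "x \<in> dom c \<and> c' y = c x" using pbijD(4,5)[OF q(2), of x y] v b by auto
    next
      fix x y y' assume "(x, y) \<in> insert (a, b) (p \<union> q)" "(x, y') \<in> insert (a, b) (p \<union> q)"
      then show "y = y'" using pbijD(2)[OF q(2), of x y y'] False by auto
    next
      fix x y y' assume "(x, y) \<in> insert (a, b) (p \<union> q)" "(y', y) \<in> insert (a, b) (p \<union> q)"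
      then show "x = y'" using pbijD(3)[OF q(2), of x y y'] b by auto
    qed
    then show ?thesis ..
  qed
  then obtain b where "pbij c c' (insert (a, b) (p \<union> q))" ..
  then show ?case using q(1) by (intro exI[of _ "insert (a, b) q"]) auto
qed

lemma pbij_extend_converse:
  assumes p: "pbij c c' p" and c: "ample c N" and T: "finite T" "T \<subseteq> dom c'" "card p + card T \<le> N"
  shows "\<exists>q. Range q = T \<and> pbij c c' (p \<union> q)"
proof -
  have "pbij c' c (p\<inverse>)" using p by (simp add: pbij_converse)
  then obtain q where "Domain q = T" "pbij c' c (p\<inverse> \<union> q)"
    using pbij_extend[OF _ c T(1,2), of "p\<inverse>"] T(3) by (metis card_inverse)
  then show ?thesis by (intro exI[of _ "q\<inverse>"]) (auto simp: pbij_Un_converse)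
qed

text \<open>The elements are related along \<open>q\<close> alone; \<open>p\<close> only has to be
  compatible with \<open>q\<close>. So the partial bijections do not accumulate on the way down, and
  at most \<open>k\<close> pairs suffice at every depth below the top. The second clause is stated
  with converses in order to avoid a mutual definition of \<open>sim\<close> and its mirror
  image.\<close>

inductive sim :: "('a, 'v) colouring \<Rightarrow> ('b, 'v) colouring \<Rightarrow> nat \<Rightarrow> ('a \<times> 'b) set \<Rightarrow> 'a obj \<Rightarrow> 'b obj \<Rightarrow> bool"
  for c c' k where
  sim_Atom: "(a, b) \<in> p \<Longrightarrow> sim c c' k p (Atom a) (Atom b)"
| sim_HSet: "lifts c c' k (\<lambda>q x y. sim c c' k q x y) p (fset F) (fset F') \<Longrightarrow>
    lifts c' c k (\<lambda>q y x. sim c c' k (q\<inverse>) x y) (p\<inverse>) (fset F') (fset F) \<Longrightarrow>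
    sim c c' k p (HSet F) (HSet F')"

inductive_simps sim_Atom_iff [simp]: "sim c c' k p (Atom a) y"
inductive_simps sim_Atom_iff2 [simp]: "sim c c' k p y (Atom a)"
inductive_cases sim_HSetE: "sim c c' k p (HSet F) y"

lemma lifts_weaken:
  assumes "lifts c c' k R p U V" "p \<subseteq> p'" "k \<le> k'"
  shows "lifts c c' k' R p' U V"
  unfolding lifts_def
proof
  fix x assume "x \<in> U"
  then obtain T where T: "T \<subseteq> dom c" "finite T" "card T \<le> k"
    "\<forall>q. Domain q = T \<longrightarrow> pbij c c' (p \<union> q) \<longrightarrow> (\<exists>y\<in>V. R q x y)"
    by (rule liftsD[OF assms(1)])
  have "pbij c c' (p \<union> q)" if "pbij c c' (p' \<union> q)" for q
    using that assms(2) by (auto elim: pbij_subset)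
  then show "\<exists>T\<subseteq>dom c. finite T \<and> card T \<le> k' \<and>
     (\<forall>q. Domain q = T \<longrightarrow> pbij c c' (p' \<union> q) \<longrightarrow> (\<exists>y\<in>V. R q x y))"
    using T assms(3) by (intro exI[of _ T]) auto
qed

lemma sim_weaken:
  assumes "sim c c' k p x y" "p \<subseteq> p'" "k \<le> k'"
  shows "sim c c' k' p' x y"
  using assms(1,2)
proof (induction arbitrary: p' rule: sim.induct)
  case (sim_HSet p F F')
  have R: "lifts c c' k (\<lambda>q x y. sim c c' k' q x y) p (fset F) (fset F')"
    "lifts c' c k (\<lambda>q y x. sim c c' k' (q\<inverse>) x y) (p\<inverse>) (fset F') (fset F)"
    using sim_HSet.IH by (auto elim!: lifts_mono_rel[rule_format, rotated])
  show ?case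
    using sim_HSet.prems assms(3) by (intro sim.sim_HSet lifts_weaken[OF R(1)] lifts_weaken[OF R(2)]) auto
qed (auto intro: sim.sim_Atom)

lemma sim_converse: "sim c c' k p x y \<longleftrightarrow> sim c' c k (p\<inverse>) y x"
proof
  show "sim c' c k (p\<inverse>) y x" if "sim c c' k p x y" for c c' k p x y
    using that
  proof (induction rule: sim.induct)
    case (sim_HSet p F F')
    have R: "lifts c c' k (\<lambda>q x y. sim c' c k (q\<inverse>) y x) p (fset F) (fset F')"
      "lifts c' c k (\<lambda>q y x. sim c' c k q y x) (p\<inverse>) (fset F') (fset F)"
      using sim_HSet.IH by (auto elim!: lifts_mono_rel[rule_format, rotated])
    show ?case using R by (intro sim.sim_HSet) auto
  qed (auto intro: sim.sim_Atom)
  from this[of c' c k "p\<inverse>" y x] show "sim c' c k (p\<inverse>) y x \<Longrightarrow> sim c c' k p x y"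
    by simp
qed

lemma sim_elems1:
  assumes "sim c c' k p x x'"
  shows "lifts c c' k (sim c c' k) p (fset (elems x)) (fset (elems x'))"
  using assms by cases (auto simp: lifts_def)

lemma sim_elems:
  assumes "sim c c' k p x x'"
  shows "lifts c c' k (sim c c' k) p (fset (elems x)) (fset (elems x'))"
    "lifts c' c k (sim c' c k) (p\<inverse>) (fset (elems x')) (fset (elems x))"
proof -
  show "lifts c c' k (sim c c' k) p (fset (elems x)) (fset (elems x'))"
    by (rule sim_elems1[OF assms])
  show "lifts c' c k (sim c' c k) (p\<inverse>) (fset (elems x')) (fset (elems x))"
    by (rule sim_elems1) (use assms sim_converse in blast)
qed

lemma sim_HSetI:
  assumes "lifts c c' k (sim c c' k) p (fset F) (fset F')"
    "lifts c' c k (sim c' c k) (p\<inverse>) (fset F') (fset F)"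
  shows "sim c c' k p (HSet F) (HSet F')"
proof (rule sim_HSet)
  show "lifts c c' k (\<lambda>q x y. sim c c' k q x y) p (fset F) (fset F')" using assms(1) by simp
  have "(\<lambda>q y x. sim c c' k (q\<inverse>) x y) = sim c' c k"
    by (intro ext) (metis sim_converse converse_converse)
  then show "lifts c' c k (\<lambda>q y x. sim c c' k (q\<inverse>) x y) (p\<inverse>) (fset F') (fset F)" using assms(2) by simp
qed

section \<open>Uniqueness of matches; transfer of equality and membership\<close>

locale two_colourings =
  fixes c :: "('a, 'v) colouring" and c' :: "('b, 'v) colouring" and N :: nat
  assumes ample: "ample c N" and ample': "ample c' N"
begin

lemma swap: "two_colourings c' c N"
  by (simp add: two_colourings_def ample ample')

text \<open>An element \<open>w\<close> of \<open>y\<close> is pulled back to some \<open>x\<close>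
  in \<open>F\<close> along an extension \<open>r\<close>, and \<open>x\<close> is pushed forward to
  an element \<open>v\<close> of \<open>z\<close> along an extension \<open>s\<close> compatible
  with everything before; induction gives \<open>w = v\<close>. The two extensions account for
  \<open>2 * k\<close>. The induction hypothesis is applied to \<open>r\<close> and
  \<open>s\<close>, of at most \<open>k\<close> pairs each, whence
  \<open>4 * k \<le> N\<close>.\<close>

lemma sim_unique:
  assumes "4 * k \<le> N" "pbij c c' (p \<union> q)" "card p + card q + 2 * k \<le> N"
    "sim c c' k p x y" "sim c c' k q x z"
  shows "y = z"
  using assms(2-)
proof (induction x arbitrary: p q y z)
  case (Atom a)
  then show ?case by (auto dest: pbijD)
next
  case (HSet F)
  have sub: "elems y |\<subseteq>| elems z"
    if pq: "pbij c c' (p \<union> q)" "card p + card q + 2 * k \<le> N"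
      and y: "sim c c' k p (HSet F) y" and z: "sim c c' k q (HSet F) z" for p q y z
  proof
    fix w assume "w |\<in>| elems y"
    then obtain T where T: "T \<subseteq> dom c'" "finite T" "card T \<le> k"
      "\<forall>r. Domain r = T \<longrightarrow> pbij c' c (p\<inverse> \<union> r) \<longrightarrow> (\<exists>x\<in>fset F. sim c' c k r w x)"
      by (rule liftsD[OF sim_elems(2)[OF y, unfolded elems.simps]])
    have "card (p \<union> q) + card T \<le> N"
      using card_Un_le[of p q] pq(2) T(3) by linarith
    then obtain r where r: "Range r = T" "pbij c c' (p \<union> q \<union> r)"
      using pbij_extend_converse[OF pq(1) ample T(2,1)] by auto
    have "pbij c c' (p \<union> r)" using r(2) by (rule pbij_subset) auto
    then have "pbij c' c (p\<inverse> \<union> r\<inverse>)" by (simp add: pbij_Un_converse)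
    then obtain x where x: "x |\<in>| F" "sim c c' k r x w"
      using T(4)[rule_format, of "r\<inverse>"] r(1) sim_converse[of c c' k r] by auto
    obtain S where S: "S \<subseteq> dom c" "finite S" "card S \<le> k"
      "\<forall>s. Domain s = S \<longrightarrow> pbij c c' (q \<union> s) \<longrightarrow> (\<exists>v\<in>fset (elems z). sim c c' k s x v)"
      by (rule liftsD[OF sim_elems(1)[OF z, unfolded elems.simps] x(1)])
    have "card r = card T"
      using r by (metis pbij_card_Range pbij_subset sup_ge2)
    then have "card (p \<union> q \<union> r) + card S \<le> N"
      using card_Un_le[of "p \<union> q" r] card_Un_le[of p q] pq(2) T(3) S(3) by linarith
    then obtain s where s: "Domain s = S" "pbij c c' (p \<union> q \<union> r \<union> s)"
      using pbij_extend[OF r(2) ample' S(2,1)] by auto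
    have "pbij c c' (q \<union> s)" using s(2) by (rule pbij_subset) auto
    then obtain v where v: "v |\<in>| elems z" "sim c c' k s x v" using S(4) s(1) by blast
    have "card s = card S"
      using s by (metis pbij_card_Domain pbij_subset sup_ge2)
    have "w = v"
    proof (rule HSet.IH[OF _ _ _ x(2) v(2)])
      show "x \<in> fset F" by (rule x(1))
      show "pbij c c' (r \<union> s)" using s(2) by (rule pbij_subset) auto
      show "card r + card s + 2 * k \<le> N"
        using \<open>card r = card T\<close> \<open>card s = card S\<close> T(3) S(3) assms(1) by linarith
    qed
    then show "w |\<in>| elems z" using v by simp
  qed
  obtain G where G: "y = HSet G" using HSet.prems(3) by (auto elim: sim_HSetE)
  obtain H where H: "z = HSet H" using HSet.prems(4) by (auto elim: sim_HSetE)
  have "elems y |\<subseteq>| elems z" by (rule sub[OF HSet.prems])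
  moreover have "elems z |\<subseteq>| elems y"
    by (rule sub[OF _ _ HSet.prems(4,3)]) (use HSet.prems in \<open>simp_all add: Un_commute\<close>)
  ultimately show ?case using G H by auto
qed

lemma sim_eq_iff:
  assumes "4 * k \<le> N" "pbij c c' (p \<union> q)" "card p + card q + 2 * k \<le> N"
    "sim c c' k p x x'" "sim c c' k q y y'"
  shows "x = y \<longleftrightarrow> x' = y'"
proof
  show "x = y \<Longrightarrow> x' = y'" using sim_unique assms by blast
  interpret s: two_colourings c' c N by (rule swap)
  have "pbij c' c (p\<inverse> \<union> q\<inverse>)" "card (p\<inverse>) + card (q\<inverse>) + 2 * k \<le> N"
    using assms by (auto simp: pbij_Un_converse card_inverse)
  from s.sim_unique[OF assms(1) this] show "x' = y' \<Longrightarrow> x = y"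
    using assms(4,5) sim_converse by blast
qed

text \<open>As an element of \<open>y\<close>, \<open>x\<close> has a match in \<open>y'\<close>,
  which \<open>sim_unique\<close> identifies with \<open>x'\<close>. The extension leading to that
  match is the reason for the third \<open>k\<close>.\<close>

lemma sim_mem:
  assumes "4 * k \<le> N" "pbij c c' (p \<union> q)" "card p + card q + 3 * k \<le> N"
    "sim c c' k p x x'" "sim c c' k q y y'" "x |\<in>| elems y"
  shows "x' |\<in>| elems y'"
proof -
  obtain T where T: "T \<subseteq> dom c" "finite T" "card T \<le> k"
    "\<forall>s. Domain s = T \<longrightarrow> pbij c c' (q \<union> s) \<longrightarrow> (\<exists>v\<in>fset (elems y'). sim c c' k s x v)"
    by (rule liftsD[OF sim_elems(1)[OF assms(5)] assms(6)])
  have "card (p \<union> q) + card T \<le> N" using card_Un_le[of p q] assms(3) T(3) by linarith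
  then obtain s where s: "Domain s = T" "pbij c c' (p \<union> q \<union> s)"
    using pbij_extend[OF assms(2) ample' T(2,1)] by auto
  have "pbij c c' (q \<union> s)" using s(2) by (rule pbij_subset) auto
  then obtain v where v: "v |\<in>| elems y'" "sim c c' k s x v" using T(4) s(1) by blast
  have "card s = card T" using s by (metis pbij_card_Domain pbij_subset sup_ge2)
  moreover have "pbij c c' (p \<union> s)" using s(2) by (rule pbij_subset) auto
  ultimately have "x' = v"
    using sim_unique[OF assms(1) _ _ assms(4) v(2)] assms(3) T(3) by simp
  then show ?thesis using v by simp
qed

lemma sim_mem_iff:
  assumes "4 * k \<le> N" "pbij c c' (p \<union> q)" "card p + card q + 3 * k \<le> N"
    "sim c c' k p x x'" "sim c c' k q y y'"
  shows "x |\<in>| elems y \<longleftrightarrow> x' |\<in>| elems y'"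
proof
  show "x |\<in>| elems y \<Longrightarrow> x' |\<in>| elems y'" using sim_mem assms by blast
  interpret s: two_colourings c' c N by (rule swap)
  have "pbij c' c (p\<inverse> \<union> q\<inverse>)" "card (p\<inverse>) + card (q\<inverse>) + 3 * k \<le> N"
    using assms by (auto simp: pbij_Un_converse card_inverse)
  from s.sim_mem[OF assms(1) this] show "x' |\<in>| elems y' \<Longrightarrow> x |\<in>| elems y"
    using assms(4,5) sim_converse by blast
qed

end

section \<open>Colour-preserving permutations acting on the second side\<close>

abbreviation rmap :: "('b \<Rightarrow> 'b) \<Rightarrow> ('a \<times> 'b) set \<Rightarrow> ('a \<times> 'b) set" where
  "rmap \<pi> p \<equiv> map_prod id \<pi> ` p"

lemma rmap_simps:
  "Domain (rmap \<pi> p) = Domain p" "Range (rmap \<pi> p) = \<pi> ` Range p"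
  "bij \<pi> \<Longrightarrow> rmap \<pi> (rmap (inv \<pi>) p) = p" "bij \<pi> \<Longrightarrow> rmap (inv \<pi>) (rmap \<pi> p) = p"
  by (force simp: map_prod_def image_image bij_is_inj bij_is_surj surj_f_inv_f)+

lemma pbij_rmap:
  assumes "cperm c' \<pi>" "pbij c c' p"
  shows "pbij c c' (rmap \<pi> p)"
proof (rule pbijI)
  have inj: "inj \<pi>" using cperm_bij[OF assms(1)] by (rule bij_is_inj)
  show "finite (rmap \<pi> p)" using pbijD(1)[OF assms(2)] by simp
  show "b = b'" if "(a, b) \<in> rmap \<pi> p" "(a, b') \<in> rmap \<pi> p" for a b b'
    using that by (auto dest: pbijD(2)[OF assms(2)])
  show "a = a'" if "(a, b) \<in> rmap \<pi> p" "(a', b) \<in> rmap \<pi> p" for a a' b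
    using that inj by (auto simp: inj_eq dest: pbijD(3)[OF assms(2)])
  show "a \<in> dom c \<and> c' b = c a" if ab: "(a, b) \<in> rmap \<pi> p" for a b
  proof -
    obtain d where "(a, d) \<in> p" "b = \<pi> d" using ab by auto
    then show ?thesis using pbijD(4,5)[OF assms(2), of a d] cperm_colour[OF assms(1), of d] by auto
  qed
qed

text \<open>Extensions of the moved \<open>p\<close> are translated back by
  \<open>inv \<pi>\<close>; the sets \<open>T\<close> on the second side are replaced by
  \<open>\<pi>\<close> followed by image, which preserves colours and size.\<close>

lemma sim_rmap:
  assumes \<pi>: "cperm c' \<pi>" and "sim c c' k p x y"
  shows "sim c c' k (rmap \<pi> p) x (map_obj \<pi> y)"
  using assms(2)
proof (induction rule: sim.induct)
  case (sim_HSet p F F')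
  have b: "bij \<pi>" "bij (inv \<pi>)" using cperm_bij[OF \<pi>] cperm_bij[OF cperm_inv[OF \<pi>]] by auto
  have 1: "lifts c c' k (sim c c' k) (rmap \<pi> p) (fset F) (fset (map_obj \<pi> |`| F'))"
    unfolding lifts_def
  proof
    fix x assume "x \<in> fset F"
    then obtain T where T: "T \<subseteq> dom c" "finite T" "card T \<le> k"
      "\<forall>q. Domain q = T \<longrightarrow> pbij c c' (p \<union> q) \<longrightarrow>
        (\<exists>y\<in>fset F'. sim c c' k q x y \<and> sim c c' k (rmap \<pi> q) x (map_obj \<pi> y))"
      by (rule liftsD[OF sim_HSet.IH(1)])
    have "\<exists>y\<in>fset (map_obj \<pi> |`| F'). sim c c' k q x y"
      if q: "Domain q = T" "pbij c c' (rmap \<pi> p \<union> q)" for q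
    proof -
      have "pbij c c' (rmap (inv \<pi>) (rmap \<pi> p \<union> q))"
        by (rule pbij_rmap[OF cperm_inv[OF \<pi>] q(2)])
      then have "pbij c c' (p \<union> rmap (inv \<pi>) q)" by (simp add: image_Un rmap_simps b)
      then obtain y where "y \<in> fset F'" "sim c c' k (rmap \<pi> (rmap (inv \<pi>) q)) x (map_obj \<pi> y)"
        using T(4) q(1) rmap_simps(1)[of "inv \<pi>" q] by metis
      then show ?thesis by (auto simp: rmap_simps b)
    qed
    with T show "\<exists>T\<subseteq>dom c. finite T \<and> card T \<le> k \<and> (\<forall>q. Domain q = T \<longrightarrow>
       pbij c c' (rmap \<pi> p \<union> q) \<longrightarrow> (\<exists>y\<in>fset (map_obj \<pi> |`| F'). sim c c' k q x y))"
      by (intro exI[of _ T] conjI allI impI)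
  qed
  have 2: "lifts c' c k (sim c' c k) ((rmap \<pi> p)\<inverse>) (fset (map_obj \<pi> |`| F')) (fset F)"
    unfolding lifts_def
  proof
    fix y assume "y \<in> fset (map_obj \<pi> |`| F')"
    then obtain y' where y': "y' \<in> fset F'" "y = map_obj \<pi> y'" by auto
    obtain T where T: "T \<subseteq> dom c'" "finite T" "card T \<le> k"
      "\<forall>q. Domain q = T \<longrightarrow> pbij c' c (p\<inverse> \<union> q) \<longrightarrow>
        (\<exists>x\<in>fset F. sim c c' k (q\<inverse>) x y' \<and> sim c c' k (rmap \<pi> (q\<inverse>)) x (map_obj \<pi> y'))"
      by (rule liftsD[OF sim_HSet.IH(2) y'(1)])
    have "\<exists>x\<in>fset F. sim c' c k q y x"
      if q: "Domain q = \<pi> ` T" "pbij c' c ((rmap \<pi> p)\<inverse> \<union> q)" for q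
    proof -
      define r where "r = (rmap (inv \<pi>) (q\<inverse>))\<inverse>"
      have "pbij c c' (rmap \<pi> p \<union> q\<inverse>)" using q(2) by (simp add: pbij_Un_converse)
      then have "pbij c c' (rmap (inv \<pi>) (rmap \<pi> p \<union> q\<inverse>))"
        by (rule pbij_rmap[OF cperm_inv[OF \<pi>]])
      then have "pbij c c' (p \<union> r\<inverse>)" by (simp add: image_Un rmap_simps b r_def)
      then have 1: "pbij c' c (p\<inverse> \<union> r)" by (simp add: pbij_Un_converse)
      have "Domain r = inv \<pi> ` Range (q\<inverse>)"
        unfolding r_def by (simp only: Domain_converse rmap_simps)
      also have "\<dots> = T" using q(1) b(1) by (simp add: image_comp bij_is_inj)
      finally obtain x where "x \<in> fset F" "sim c c' k (rmap \<pi> (r\<inverse>)) x (map_obj \<pi> y')"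
        using T(4) 1 by metis
      moreover have "rmap \<pi> (r\<inverse>) = q\<inverse>" by (simp add: r_def rmap_simps b)
      ultimately show ?thesis using sim_converse y'(2) by (metis converse_converse)
    qed
    moreover have "\<pi> ` T \<subseteq> dom c'" using T(1) cperm_colour[OF \<pi>] by (auto simp: domIff subset_iff)
    moreover have "card (\<pi> ` T) \<le> k" using T(2,3) card_image_le le_trans by blast
    ultimately show "\<exists>T\<subseteq>dom c'. finite T \<and> card T \<le> k \<and> (\<forall>q. Domain q = T \<longrightarrow>
       pbij c' c ((rmap \<pi> p)\<inverse> \<union> q) \<longrightarrow> (\<exists>x\<in>fset F. sim c' c k q y x))"
      using T(2) by (intro exI[of _ "\<pi> ` T"] conjI allI impI) auto
  qed
  show ?case using sim_HSetI[OF 1 2] by (simp only: obj.map)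
qed (auto intro: sim.sim_Atom)

lemma rmap_eq_self:
  assumes "\<And>b. b \<in> Range p \<Longrightarrow> \<pi> b = b"
  shows "rmap \<pi> p = p"
proof -
  have "rmap \<pi> p = id ` p"
    by (rule image_cong) (use assms[OF RangeI] in auto)
  then show ?thesis by simp
qed

section \<open>Hereditarily supported objects\<close>

definition hsupp :: "('a, 'v) colouring \<Rightarrow> nat \<Rightarrow> 'a obj \<Rightarrow> bool" where
  "hsupp c k x \<longleftrightarrow> (\<forall>y\<in>TC x. \<exists>S\<subseteq>dom c. finite S \<and> card S \<le> k \<and> supports c S y)"

lemma TC_unfold: "z \<in> TC x \<longleftrightarrow> z = x \<or> (\<exists>y. y |\<in>| elems x \<and> z \<in> TC y)"
proof
  show "z \<in> TC x \<Longrightarrow> z = x \<or> (\<exists>y. y |\<in>| elems x \<and> z \<in> TC y)"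
    by (induction rule: TC.induct) (auto intro: TC.intros)
  have "z \<in> TC x" if "z \<in> TC y" "y |\<in>| elems x" for y
    using that by (induction rule: TC.induct) (auto intro: TC.intros)
  then show "z = x \<or> (\<exists>y. y |\<in>| elems x \<and> z \<in> TC y) \<Longrightarrow> z \<in> TC x"
    by (auto intro: TC.intros)
qed

lemma hsupp_unfold:
  "hsupp c k x \<longleftrightarrow> (\<exists>S\<subseteq>dom c. finite S \<and> card S \<le> k \<and> supports c S x) \<and> (\<forall>y. y |\<in>| elems x \<longrightarrow> hsupp c k y)"
  unfolding hsupp_def Ball_def TC_unfold[of _ x] by blast

lemma hsupp_elem: "hsupp c k x \<Longrightarrow> y |\<in>| elems x \<Longrightarrow> hsupp c k y"
  by (subst (asm) hsupp_unfold) simp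

abbreviation big_union :: "'a obj \<Rightarrow> 'a obj" where
  "big_union x \<equiv> HSet (ffUnion (elems |`| elems x))"

lemma map_obj_big_union: "map_obj \<pi> (big_union x) = big_union (map_obj \<pi> x)"
proof -
  have "fset (map_obj \<pi> |`| ffUnion (elems |`| elems x)) = fset (ffUnion (elems |`| elems (map_obj \<pi> x)))"
    by (simp add: ffUnion.rep_eq elems_map_obj image_UN)
  then show ?thesis by (simp only: obj.map fset_inject)
qed

text \<open>\<open>K\<close> bounds the parameter of \<open>sim\<close>, and the partial bijections
  that are compared have at most \<open>2 * K\<close> pairs. Comparing two related pairs of objects
  then takes \<open>2 * K + 2 * K + 2 * k\<close>, for which \<open>8 * K + 1\<close> atoms of each
  colour leave ample room.\<close>

locale back_and_forth =
  fixes c :: "('a, 'v) colouring" and c' :: "('b, 'v) colouring" and K :: nat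
  assumes ample: "ample c (8 * K + 1)" and ample': "ample c' (8 * K + 1)"
begin

sublocale two_colourings c c' "8 * K + 1"
  using ample ample' by (intro two_colourings.intro)

lemma swapped: "back_and_forth c' c K"
  using ample ample' by (intro back_and_forth.intro)

lemma related_eq_iff:
  assumes "k \<le> K" "pbij c c' (p \<union> q)" "card p \<le> 2 * K" "card q \<le> 2 * K"
    "sim c c' k p x x'" "sim c c' k q y y'"
  shows "x = y \<longleftrightarrow> x' = y'"
  using assms by (intro sim_eq_iff[of k p q]) auto

text \<open>If \<open>\<pi>\<close> fixes the range of \<open>q\<close> pointwise, then
  \<open>rmap \<pi> q = q\<close>, so \<open>x\<close> is related along \<open>q\<close> to
  \<open>x'\<close> and to its image under \<open>\<pi>\<close>; uniqueness makes these equal. Thus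
  matched atoms form supports automatically.\<close>

lemma sim_supports_Range:
  assumes "k \<le> K" "pbij c c' q" "card q \<le> 2 * K" "sim c c' k q x x'"
  shows "supports c' (Range q) x'"
  unfolding supports_def
proof (intro allI impI)
  fix \<pi> assume \<pi>: "cperm c' \<pi>" "\<forall>b\<in>Range q. \<pi> b = b"
  then have "sim c c' k q x (map_obj \<pi> x')"
    using sim_rmap[OF \<pi>(1) assms(4)] rmap_eq_self[of q \<pi>] by simp
  then show "map_obj \<pi> x' = x'"
    using related_eq_iff[of k q q x x' x "map_obj \<pi> x'"] assms by simp
qed

lemma sim_supports_Domain:
  assumes "k \<le> K" "pbij c c' q" "card q \<le> 2 * K" "sim c c' k q x x'"
  shows "supports c (Domain q) x"
proof -
  interpret s: back_and_forth c' c K by (rule swapped)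
  show ?thesis
    using s.sim_supports_Range[of k "q\<inverse>" x' x] assms sim_converse pbij_converse by fastforce
qed

text \<open>Uniqueness cannot compare \<open>q\<close> with \<open>rmap \<pi> q\<close> directly,
  since the two need not be compatible. Instead \<open>\<pi>\<close> is imitated on the first side:
  \<open>r\<close> matches the same range as \<open>rmap \<pi> q\<close> but is compatible with
  \<open>q\<close>, and the passage between their domains extends to some \<open>\<sigma>\<close>
  fixing \<open>Domain p\<close>. As \<open>\<sigma>\<close> fixes \<open>x\<close>, the latter is
  related along \<open>r\<close> to the image of \<open>x'\<close>, which is therefore
  \<open>x'\<close>.\<close>

lemma supports_transfer:
  assumes "k \<le> K" "pbij c c' q" "card q \<le> 2 * K" "sim c c' k q x x'"
    and "p \<subseteq> q" "supports c (Domain p) x"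
  shows "supports c' (Range p) x'"
  unfolding supports_def
proof (intro allI impI)
  fix \<pi> assume \<pi>: "cperm c' \<pi>" "\<forall>b\<in>Range p. \<pi> b = b"
  let ?q = "rmap \<pi> q"
  have q': "pbij c c' ?q" by (rule pbij_rmap[OF \<pi>(1) assms(2)])
  have "Range ?q \<subseteq> dom c'" using pbijD(4,5)[OF q'] by (force simp: Range_iff domIff)
  moreover have "finite (Range ?q)" "card (Range ?q) \<le> 2 * K"
    using pbijD(1)[OF q'] pbij_card_Range[OF q'] pbijD(1)[OF assms(2)] assms(3) card_image_le[of q "map_prod id \<pi>"]
    by (auto intro: finite_Range)
  ultimately obtain r where r: "Range r = Range ?q" "pbij c c' (q \<union> r)"
    using pbij_extend_converse[OF assms(2) ample, of "Range ?q"] assms(3) by auto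
  have rb: "pbij c c' r" using r(2) by (rule pbij_subset) auto
  have sb: "pbij c c (?q O r\<inverse>)"
    by (rule pbij_relcomp[OF q']) (simp add: pbij_converse rb)
  obtain \<sigma> where \<sigma>: "cperm c \<sigma>" "\<forall>(a, d)\<in>?q O r\<inverse>. \<sigma> a = d"
    using cperm_extend[of "?q O r\<inverse>" c] sb unfolding pbij_def by blast
  have \<sigma>2: "\<sigma> a = d" if "(a, d) \<in> ?q O r\<inverse>" for a d
    using bspec[OF \<sigma>(2) that] by simp
  have "\<sigma> a = a" if "a \<in> Domain p" for a
  proof -
    obtain b where ab: "(a, b) \<in> p" using \<open>a \<in> Domain p\<close> by auto
    then have "(a, b) \<in> q" "\<pi> b = b" using assms(5) \<pi>(2) by auto
    then have "(a, b) \<in> ?q" by (metis (no_types, lifting) id_apply image_eqI map_prod_simp)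
    then obtain a' where "(a', b) \<in> r" using r(1) by blast
    then have "(a, a') \<in> ?q O r\<inverse>" "a' = a"
      using \<open>(a, b) \<in> ?q\<close> \<open>(a, b) \<in> q\<close> pbijD(3)[OF r(2), of a' b a] by auto
    then show ?thesis using \<sigma>2[of a a'] by simp
  qed
  then have \<sigma>x: "map_obj \<sigma> x = x" using supportsD[OF assms(6) \<sigma>(1)] by blast
  have "sim c' c k (rmap \<sigma> (?q\<inverse>)) (map_obj \<pi> x') (map_obj \<sigma> x)"
    by (rule sim_rmap[OF \<sigma>(1)]) (use sim_rmap[OF \<pi>(1) assms(4)] sim_converse in blast)
  moreover have "rmap \<sigma> (?q\<inverse>) \<subseteq> r\<inverse>"
  proof
    fix z assume "z \<in> rmap \<sigma> (?q\<inverse>)"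
    then obtain w where w: "w \<in> ?q\<inverse>" "z = map_prod id \<sigma> w" by (rule imageE)
    obtain b a where "w = (b, a)" by (cases w)
    with w have ab: "(a, b) \<in> ?q" "z = (b, \<sigma> a)" by (simp_all only: converse_iff map_prod_simp id_apply)
    then obtain d where "(d, b) \<in> r" using r(1) by blast
    moreover from this ab have "\<sigma> a = d" by (intro \<sigma>2 relcompI converseI)
    ultimately show "z \<in> r\<inverse>" using ab by auto
  qed
  ultimately have "sim c' c k (r\<inverse>) (map_obj \<pi> x') x"
    using sim_weaken \<sigma>x by fastforce
  then have "sim c c' k r x (map_obj \<pi> x')" using sim_converse by blast
  moreover have "card r \<le> 2 * K"
    using \<open>card (Range ?q) \<le> 2 * K\<close> r(1) pbij_card_Range[OF rb] by simp
  ultimately show "map_obj \<pi> x' = x'"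
    using related_eq_iff[OF assms(1) r(2) assms(3) _ assms(4)] by metis
qed

text \<open>By symmetry it suffices to match \<open>y\<close> for a single extension \<open>s\<close> of \<open>p\<close>, provided that \<open>p\<close> and \<open>s\<close>
  contain supports of the objects concerned.\<close>

lemma lifts_transfer:
  assumes "k \<le> K"
    and supp: "supports c' (Range p) (HSet V)"
    and one: "\<And>y T. y \<in> U \<Longrightarrow> T \<subseteq> dom c \<Longrightarrow> finite T \<Longrightarrow> card T \<le> k \<Longrightarrow>
       \<exists>s y'. T \<subseteq> Domain s \<and> pbij c c' (p \<union> s) \<and> card s \<le> 2 * K \<and> y' |\<in>| V \<and> sim c c' m s y y'"
    and hs: "\<And>y. y \<in> U \<Longrightarrow> hsupp c k y"
    and R: "\<And>y y' s r. y \<in> U \<Longrightarrow> y' |\<in>| V \<Longrightarrow> sim c c' m s y y' \<Longrightarrow> pbij c c' s \<Longrightarrow>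
       card s \<le> 2 * K \<Longrightarrow> r \<subseteq> s \<Longrightarrow> supports c (Domain r) y \<Longrightarrow> R r y y'"
  shows "lifts c c' k R p U (fset V)"
  unfolding lifts_def
proof
  fix y assume y: "y \<in> U"
  obtain T where T: "T \<subseteq> dom c" "finite T" "card T \<le> k" "supports c T y"
    using hs[OF y] by (subst (asm) hsupp_unfold) blast
  obtain s y' where s: "T \<subseteq> Domain s" "pbij c c' (p \<union> s)" "card s \<le> 2 * K"
      and y': "y' |\<in>| V" "sim c c' m s y y'"
    using one[OF y T(1-3)] by blast
  have sb: "pbij c c' s" using s(2) by (rule pbij_subset) auto
  have "\<exists>y'\<in>fset V. R r y y'" if r: "Domain r = T" "pbij c c' (p \<union> r)" for r
  proof -
    have "pbij c c' (p \<union> {(a, b) \<in> s. a \<in> T})"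
      using s(2) by (rule pbij_subset) auto
    then have "pbij c' c' ((p \<union> {(a, b) \<in> s. a \<in> T})\<inverse> O (p \<union> r))"
      by (intro pbij_relcomp[OF _ r(2)]) (simp add: pbij_converse)
    \<comment> \<open>\<open>\<pi>\<close> moves the match found over \<open>s\<close> to one over
      the prescribed \<open>r\<close>. It fixes the range of \<open>p\<close>, hence the set
      \<open>V\<close>, so the moved match is still an element of \<open>V\<close>.\<close>
    then obtain \<pi> where \<pi>: "cperm c' \<pi>" "\<forall>(a, d)\<in>(p \<union> {(a, b) \<in> s. a \<in> T})\<inverse> O (p \<union> r). \<pi> a = d"
      using cperm_extend[of _ c'] unfolding pbij_def by blast
    have \<pi>2: "\<pi> b = d" if "(a, b) \<in> p \<union> {(a, b) \<in> s. a \<in> T}" "(a, d) \<in> p \<union> r" for a b d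
    proof -
      have "(b, d) \<in> (p \<union> {(a, b) \<in> s. a \<in> T})\<inverse> O (p \<union> r)"
        by (rule relcompI[OF converseI[OF that(1)] that(2)])
      from bspec[OF \<pi>(2) this] show ?thesis by simp
    qed
    have fix_p: "\<pi> b = b" if "b \<in> Range p" for b
    proof -
      obtain a where "(a, b) \<in> p" using \<open>b \<in> Range p\<close> by auto
      then show ?thesis by (intro \<pi>2) auto
    qed
    have sub: "r \<subseteq> rmap \<pi> s"
    proof
      fix z assume "z \<in> r"
      then obtain a b' where z: "z = (a, b')" "(a, b') \<in> r" by (cases z) auto
      then obtain b where "(a, b) \<in> s" "a \<in> T" using r(1) s(1) by blast
      moreover from this z have "\<pi> b = b'" by (intro \<pi>2) auto
      ultimately show "z \<in> rmap \<pi> s" using z(1) by force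
    qed
    have "map_obj \<pi> (HSet V) = HSet V" using supportsD[OF supp \<pi>(1)] fix_p by blast
    then have mem: "map_obj \<pi> y' |\<in>| V"
      using map_obj_mem_iff[OF cperm_bij[OF \<pi>(1)], of y' "HSet V"] y'(1) by simp
    have "R r y (map_obj \<pi> y')"
    proof (rule R[OF y mem sim_rmap[OF \<pi>(1) y'(2)] pbij_rmap[OF \<pi>(1) sb] _ sub])
      show "card (rmap \<pi> s) \<le> 2 * K"
        using s(3) card_image_le[OF pbijD(1)[OF sb], of "map_prod id \<pi>"] by linarith
      show "supports c (Domain r) y" using T(4) r(1) by simp
    qed
    then show ?thesis using mem by blast
  qed
  with T show "\<exists>T\<subseteq>dom c. finite T \<and> card T \<le> k \<and>
        (\<forall>q. Domain q = T \<longrightarrow> pbij c c' (p \<union> q) \<longrightarrow> (\<exists>y'\<in>fset V. R q y y'))"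
    by (intro exI[of _ T] conjI allI impI)
qed

text \<open>\<open>T\<close> is a set that the domain of \<open>s\<close> is wanted to contain,
  usually a support of \<open>y\<close>; \<open>p\<close> is a further partial bijection with which
  \<open>s\<close> must stay compatible.\<close>

lemma sim_elem_extend:
  assumes "sim c c' m q x x'" "pbij c c' (p \<union> q)" "card (p \<union> q) + m + card T \<le> 8 * K + 1"
    and "y |\<in>| elems x" and T: "T \<subseteq> dom c" "finite T"
  shows "\<exists>s y'. T \<subseteq> Domain s \<and> pbij c c' (p \<union> q \<union> s) \<and> card s \<le> m + card T \<and>
    y' |\<in>| elems x' \<and> sim c c' m s y y'"
proof -
  obtain U where U: "U \<subseteq> dom c" "finite U" "card U \<le> m"
    "\<forall>s. Domain s = U \<longrightarrow> pbij c c' (q \<union> s) \<longrightarrow> (\<exists>y'\<in>fset (elems x'). sim c c' m s y y')"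
    by (rule liftsD[OF sim_elems(1)[OF assms(1)] assms(4)])
  have card: "card (U \<union> T) \<le> m + card T" using card_Un_le[of U T] U(3) by linarith
  then obtain s where s: "Domain s = U \<union> T" "pbij c c' (p \<union> q \<union> s)"
    using pbij_extend[OF assms(2) ample', of "U \<union> T"] T U(1,2) assms(3) by auto
  have sb: "pbij c c' s" using s(2) by (rule pbij_subset) auto
  have cs: "card s \<le> m + card T" using pbij_card_Domain[OF sb] s(1) card by simp
  define sU where "sU = {(a, b) \<in> s. a \<in> U}"
  have "Domain sU = U" unfolding sU_def using s(1) by auto
  moreover have "pbij c c' (q \<union> sU)" using s(2) by (rule pbij_subset) (auto simp: sU_def)
  ultimately obtain y' where y': "y' |\<in>| elems x'" "sim c c' m sU y y'" using U(4) by blast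
  have "sim c c' m s y y'" using sim_weaken[OF y'(2), of s m] by (auto simp: sU_def)
  then show ?thesis using s cs y'(1) by blast
qed

lemma lifts_reduce:
  assumes "k \<le> K" "m \<le> K" "sim c c' m q x x'" "pbij c c' q" "card q \<le> 2 * K" "p \<subseteq> q"
    and supp: "supports c' (Range p) (HSet (elems x'))"
    and hs: "\<And>y. y |\<in>| elems x \<Longrightarrow> hsupp c k y"
    and R: "\<And>y y' s r. y |\<in>| elems x \<Longrightarrow> y' |\<in>| elems x' \<Longrightarrow> sim c c' m s y y' \<Longrightarrow> pbij c c' s \<Longrightarrow>
       card s \<le> 2 * K \<Longrightarrow> r \<subseteq> s \<Longrightarrow> supports c (Domain r) y \<Longrightarrow> R r y y'"
  shows "lifts c c' k R p (fset (elems x)) (fset (elems x'))"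
proof (rule lifts_transfer[OF assms(1) supp _ hs R])
  fix y T assume *: "y |\<in>| elems x" "T \<subseteq> dom c" "finite T" "card T \<le> k"
  obtain s y' where s: "T \<subseteq> Domain s" "pbij c c' (p \<union> q \<union> s)" "card s \<le> m + card T"
      "y' |\<in>| elems x'" "sim c c' m s y y'"
    using sim_elem_extend[OF assms(3) _ _ *(1-3), of p] assms(1,2,4-6) *(4)
    by (auto simp: Un_absorb1)
  moreover have "pbij c c' (p \<union> s)" using s(2) by (rule pbij_subset) auto
  moreover have "card s \<le> 2 * K" using s(3) *(4) assms(1,2) by linarith
  ultimately show "\<exists>s y'. T \<subseteq> Domain s \<and> pbij c c' (p \<union> s) \<and> card s \<le> 2 * K \<and> y' |\<in>| elems x' \<and>
      sim c c' m s y y'" by blast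
qed

text \<open>Undoes the growth of the bound and of the partial bijection. The support
  \<open>Domain p\<close> of \<open>x\<close> transfers to \<open>x'\<close>, so by
  \<open>lifts_transfer\<close> a single match per element suffices; the given relation provides it,
  over a domain enlarged by a small support of the element, and induction cuts it down to that
  support.\<close>

lemma sim_reduce:
  assumes "k \<le> K" "m \<le> K" "sim c c' m q x x'" "pbij c c' q" "card q \<le> 2 * K" "p \<subseteq> q"
    and "supports c (Domain p) x"
    and "\<And>y. y |\<in>| elems x \<Longrightarrow> hsupp c k y" "\<And>y. y |\<in>| elems x' \<Longrightarrow> hsupp c' k y"
  shows "sim c c' k p x x'"
  using assms(3-)
proof (induction x arbitrary: q p x')
  case (Atom a)
  then obtain b where b: "x' = Atom b" "(a, b) \<in> q" by auto
  then obtain v where v: "c a = Some v" using pbijD(4)[OF Atom.prems(2)] by blast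
  \<comment> \<open>Otherwise the colour class of \<open>a\<close>, being larger than
    \<open>Domain p\<close> with \<open>a\<close> added, would contain another atom \<open>d\<close>
    outside, and exchanging \<open>a\<close> with \<open>d\<close> would have to fix
    \<open>Atom a\<close>.\<close>
  have "a \<in> Domain p"
  proof (rule ccontr)
    assume a: "a \<notin> Domain p"
    have pb: "pbij c c' p" by (rule pbij_subset[OF Atom.prems(2,4)])
    have "card (insert a (Domain p)) \<le> card p + 1"
      using pbij_card_Domain[OF pb] by (simp add: card_insert_le_m1 card_insert_if a)
    also have "\<dots> \<le> 2 * K + 1"
      using Atom.prems(3) card_mono[OF pbijD(1)[OF Atom.prems(2)] Atom.prems(4)] by simp
    finally have "card (insert a (Domain p)) \<le> 2 * K + 1" .
    moreover have "8 * K + 1 \<le> card (colour_class c v)" using ample by (simp add: ample_def)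
    moreover have "1 \<le> K"
      using Atom.prems(3) b(2) pbijD(1)[OF Atom.prems(2)] by (cases K) auto
    ultimately have "\<not> colour_class c v \<subseteq> insert a (Domain p)"
      using card_mono[of "insert a (Domain p)" "colour_class c v"] pbijD(1)[OF pb] finite_Domain by fastforce
    then obtain d where d: "c d = Some v" "d \<noteq> a" "d \<notin> Domain p" by (auto simp: colour_class_def)
    have "cperm c (transpose a d)" using v d by (intro cperm_transpose) auto
    then have "map_obj (transpose a d) (Atom a) = Atom a"
      by (rule supportsD[OF Atom.prems(5)]) (use a d in \<open>auto simp: transpose_def\<close>)
    then show False using d by simp
  qed
  then obtain b' where "(a, b') \<in> p" by blast
  then have "b' = b" using pbijD(2)[OF Atom.prems(2), of a b' b] Atom.prems(4) b by auto
  then show ?case using b \<open>(a, b') \<in> p\<close> by simp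
next
  case (HSet F)
  interpret s: back_and_forth c' c K by (rule swapped)
  obtain F' where F': "x' = HSet F'" using HSet.prems(1) by (auto elim: sim_HSetE)
  have supp: "supports c' (Range p) (HSet (elems x'))"
    using supports_transfer[OF assms(2) HSet.prems(2,3,1,4,5)] F' by simp
  have "lifts c c' k (sim c c' k) p (fset (elems (HSet F))) (fset (elems x'))"
  proof (rule lifts_reduce[OF assms(1,2) HSet.prems(1-4) supp HSet.prems(6)])
    fix y y' s r
    assume *: "y |\<in>| elems (HSet F)" "y' |\<in>| elems x'" "sim c c' m s y y'" "pbij c c' s" "card s \<le> 2 * K"
      "r \<subseteq> s" "supports c (Domain r) y"
    show "sim c c' k r y y'"
    proof (rule HSet.IH[OF _ *(3-7)])
      show "y \<in> fset F" using *(1) by simp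
      show "hsupp c k z" if "z |\<in>| elems y" for z by (rule hsupp_elem[OF HSet.prems(6)[OF *(1)] that])
      show "hsupp c' k z" if "z |\<in>| elems y'" for z by (rule hsupp_elem[OF HSet.prems(7)[OF *(2)] that])
    qed
  qed
  moreover have "lifts c' c k (sim c' c k) (p\<inverse>) (fset (elems x')) (fset (elems (HSet F)))"
  proof (rule s.lifts_reduce[OF assms(1,2), of "q\<inverse>"])
    show "sim c' c m (q\<inverse>) x' (HSet F)" using HSet.prems(1) sim_converse by blast
    show "pbij c' c (q\<inverse>)" using HSet.prems(2) by (simp add: pbij_converse)
    show "supports c (Range (p\<inverse>)) (HSet (elems (HSet F)))" using HSet.prems(5) by simp
    fix y y' s r
    assume *: "y' |\<in>| elems x'" "y |\<in>| elems (HSet F)" "sim c' c m s y' y" "pbij c' c s" "card s \<le> 2 * K"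
      "r \<subseteq> s" "supports c' (Domain r) y'"
    have "supports c (Range r) y"
      by (rule s.supports_transfer[OF assms(2) *(4,5,3,6,7)])
    have "sim c c' k (r\<inverse>) y y'"
    proof (rule HSet.IH)
      show "y \<in> fset F" using *(2) by simp
      show "sim c c' m (s\<inverse>) y y'" using *(3) sim_converse by blast
      show "pbij c c' (s\<inverse>)" using *(4) by (simp add: pbij_converse)
      show "card (s\<inverse>) \<le> 2 * K" "r\<inverse> \<subseteq> s\<inverse>" using *(5,6) by auto
      show "supports c (Domain (r\<inverse>)) y" using \<open>supports c (Range r) y\<close> by simp
      show "hsupp c k z" if "z |\<in>| elems y" for z by (rule hsupp_elem[OF HSet.prems(6)[OF *(2)] that])
      show "hsupp c' k z" if "z |\<in>| elems y'" for z by (rule hsupp_elem[OF HSet.prems(7)[OF *(1)] that])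
    qed
    then show "sim c' c k r y' y" using sim_converse by blast
  qed (use HSet.prems in auto)
  ultimately show ?case using F' by (auto intro: sim_HSetI)
qed

text \<open>An element is related to its match along at most \<open>k\<close> pairs, whose domain
  then supports it. So the hypotheses of \<open>sim_reduce\<close> on elements come for free when
  the relation already has the bound \<open>k\<close>, even for objects that are not active.\<close>

lemma sim_elem_hsupp:
  assumes "k \<le> K" "sim c c' k p x x'" "pbij c c' p" "card p \<le> 2 * K" "y |\<in>| elems x"
  shows "hsupp c k y"
  using assms(2-)
proof (induction x arbitrary: p x' y)
  case (HSet F)
  obtain T where T: "T \<subseteq> dom c" "finite T" "card T \<le> k"
    "\<forall>q. Domain q = T \<longrightarrow> pbij c c' (p \<union> q) \<longrightarrow> (\<exists>y'\<in>fset (elems x'). sim c c' k q y y')"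
    by (rule liftsD[OF sim_elems(1)[OF HSet.prems(1)] HSet.prems(4)])
  obtain q where q: "Domain q = T" "pbij c c' (p \<union> q)"
    using pbij_extend[OF HSet.prems(2) ample' T(2,1)] T(3) HSet.prems(3) assms(1) by auto
  then obtain y' where y': "sim c c' k q y y'" using T(4) by blast
  have qb: "pbij c c' q" using q(2) by (rule pbij_subset) auto
  have cq: "card q \<le> 2 * K" using pbij_card_Domain[OF qb] q(1) T(3) assms(1) by simp
  have "supports c T y" using sim_supports_Domain[OF assms(1) qb cq y'] q(1) by simp
  moreover have "hsupp c k z" if "z |\<in>| elems y" for z
    using HSet.IH[OF _ y' qb cq that] HSet.prems(4) by simp
  ultimately show ?case using T by (subst hsupp_unfold) blast
qed auto

lemma sim_elem_hsupp':
  assumes "k \<le> K" "sim c c' k p x x'" "pbij c c' p" "card p \<le> 2 * K" "y |\<in>| elems x'"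
  shows "hsupp c' k y"
proof -
  interpret s: back_and_forth c' c K by (rule swapped)
  show ?thesis
    using s.sim_elem_hsupp[of k "p\<inverse>" x' x y] assms sim_converse pbij_converse by fastforce
qed

text \<open>The match \<open>y'\<close> of \<open>y\<close> is first found over an extension of
  \<open>p\<close>. Any other \<open>z\<close> in \<open>x'\<close> could only be matched back to
  \<open>y\<close>, so \<open>z = y'\<close>. A permutation fixing \<open>x\<close> fixes its only
  element; hence \<open>Domain p\<close> supports \<open>y\<close> and \<open>sim_reduce\<close>
  removes the extension.\<close>

lemma sim_singleton:
  assumes "k \<le> K" "sim c c' k p x x'" "pbij c c' p" "card p \<le> K" "elems x = {|y|}"
  shows "\<exists>y'. elems x' = {|y'|} \<and> sim c c' k p y y'"
proof -
  obtain T where T: "T \<subseteq> dom c" "finite T" "card T \<le> k"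
    "\<forall>q. Domain q = T \<longrightarrow> pbij c c' (p \<union> q) \<longrightarrow> (\<exists>y'\<in>fset (elems x'). sim c c' k q y y')"
    by (rule liftsD[OF sim_elems(1)[OF assms(2)], of y]) (use assms(5) in auto)
  obtain q where q: "Domain q = T" "pbij c c' (p \<union> q)"
    using pbij_extend[OF assms(3) ample' T(2,1)] T(3) assms(1,4) by auto
  then obtain y' where y': "y' |\<in>| elems x'" "sim c c' k q y y'" using T(4) by blast
  have qb: "pbij c c' q" using q(2) by (rule pbij_subset) auto
  have cq: "card q \<le> K" using pbij_card_Domain[OF qb] q(1) T(3) assms(1) by simp
  have cpq: "card (p \<union> q) \<le> 2 * K" using card_Un_le[of p q] cq assms(4) by linarith
  have "z = y'" if z: "z |\<in>| elems x'" for z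
  proof -
    obtain U where U: "U \<subseteq> dom c'" "finite U" "card U \<le> k"
      "\<forall>q. Domain q = U \<longrightarrow> pbij c' c (p\<inverse> \<union> q) \<longrightarrow> (\<exists>y'\<in>fset (elems x). sim c' c k q z y')"
      by (rule liftsD[OF sim_elems(2)[OF assms(2)] z])
    obtain r where r: "Range r = U" "pbij c c' (p \<union> q \<union> r)"
      using pbij_extend_converse[OF q(2) ample U(2,1)] U(3) assms(1) cpq by auto
    have rb: "pbij c c' r" using r(2) by (rule pbij_subset) auto
    have cr: "card r \<le> K" using pbij_card_Range[OF rb] r(1) U(3) assms(1) by simp
    have "pbij c c' (p \<union> r)" using r(2) by (rule pbij_subset) auto
    then have "pbij c' c (p\<inverse> \<union> r\<inverse>)" by (simp add: pbij_Un_converse)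
    then have "sim c' c k (r\<inverse>) z y" using U(4) r(1) assms(5) by auto
    then have "sim c c' k r y z" using sim_converse by blast
    moreover have "pbij c c' (q \<union> r)" using r(2) by (rule pbij_subset) auto
    ultimately show ?thesis using related_eq_iff[OF assms(1) _ _ _ y'(2), of r y z] cq cr by auto
  qed
  then have "elems x' = {|y'|}" using y'(1) by (intro fset_eqI) blast
  moreover have "sim c c' k p y y'"
  proof (rule sim_reduce[OF assms(1,1) _ q(2) cpq])
    show sim: "sim c c' k (p \<union> q) y y'" using y'(2) by (rule sim_weaken) auto
    show "supports c (Domain p) y"
      unfolding supports_def
    proof (intro allI impI)
      fix \<pi> assume \<pi>: "cperm c \<pi>" "\<forall>a\<in>Domain p. \<pi> a = a"
      have "supports c (Domain p) x"
        using sim_supports_Domain[OF assms(1,3) _ assms(2)] assms(4) by simp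
      then have "map_obj \<pi> x = x" using \<pi> by (simp add: supports_def)
      then have "elems (map_obj \<pi> x) = elems x" by simp
      then show "map_obj \<pi> y = y" by (simp add: elems_map_obj assms(5))
    qed
    show "hsupp c k z" if "z |\<in>| elems y" for z
      by (rule sim_elem_hsupp[OF assms(1) sim q(2) cpq that])
    show "hsupp c' k z" if "z |\<in>| elems y'" for z
      by (rule sim_elem_hsupp'[OF assms(1) sim q(2) cpq that])
  qed auto
  ultimately show ?thesis by blast
qed

text \<open>An element \<open>z\<close> of some \<open>y\<close> in \<open>x\<close> gets its match
  by an extension for \<open>y\<close> followed by one for \<open>z\<close>. A support of
  \<open>z\<close> does not determine \<open>y\<close>, so the first extension has to be forgotten;
  \<open>lifts_transfer\<close> allows this.\<close>

lemma lifts_big_union: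
  assumes "k \<le> K" "sim c c' k p x x'" "pbij c c' p" "card p \<le> K"
  shows "lifts c c' k (sim c c' k) p (fset (ffUnion (elems |`| elems x))) (fset (ffUnion (elems |`| elems x')))"
proof (rule lifts_transfer[OF assms(1)])
  show "supports c' (Range p) (big_union x')"
    unfolding supports_def
  proof (intro allI impI)
    fix \<pi> assume \<pi>: "cperm c' \<pi>" "\<forall>b\<in>Range p. \<pi> b = b"
    from \<pi> have "map_obj \<pi> x' = x'"
      using sim_supports_Range[OF assms(1,3) _ assms(2)] assms(4) \<pi> by (auto simp: supports_def)
    then show "map_obj \<pi> (big_union x') = big_union x'" by (simp only: map_obj_big_union)
  qed
next
  fix z T assume z: "z \<in> fset (ffUnion (elems |`| elems x))" and T: "T \<subseteq> dom c" "finite T" "card T \<le> k"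
  then obtain y where y: "y |\<in>| elems x" "z |\<in>| elems y" by (auto simp: ffUnion.rep_eq)
  obtain s y' where s: "pbij c c' (p \<union> s)" "card s \<le> k" "y' |\<in>| elems x'" "sim c c' k s y y'"
    using sim_elem_extend[OF assms(2), of p "{}" y] assms y by auto
  have ps: "card (p \<union> s) \<le> 2 * K" using card_Un_le[of p s] s(2) assms(1,4) by linarith
  obtain t z' where t: "T \<subseteq> Domain t" "pbij c c' (p \<union> s \<union> t)" "card t \<le> k + card T"
      "z' |\<in>| elems y'" "sim c c' k t z z'"
    using sim_elem_extend[OF s(4,1) _ y(2) T(1,2)] ps T(3) assms(1) by auto
  have "pbij c c' (p \<union> t)" using t(2) by (rule pbij_subset) auto
  moreover have "z' |\<in>| ffUnion (elems |`| elems x')" using s(3) t(4) by (auto simp: ffUnion.rep_eq)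
  moreover have "card t \<le> 2 * K" using t(3) T(3) assms(1) by linarith
  ultimately show "\<exists>t z'. T \<subseteq> Domain t \<and> pbij c c' (p \<union> t) \<and> card t \<le> 2 * K \<and>
      z' |\<in>| ffUnion (elems |`| elems x') \<and> sim c c' k t z z'" using t by blast
next
  have p: "card p \<le> 2 * K" using assms(4) by simp
  fix z assume "z \<in> fset (ffUnion (elems |`| elems x))"
  then obtain y where y: "y |\<in>| elems x" "z |\<in>| elems y" by (auto simp: ffUnion.rep_eq)
  then show "hsupp c k z" using hsupp_elem[OF sim_elem_hsupp[OF assms(1-3) p]] by simp
  fix z' s r
  assume *: "z' |\<in>| ffUnion (elems |`| elems x')" "sim c c' k s z z'" "pbij c c' s"
       "card s \<le> 2 * K" "r \<subseteq> s" "supports c (Domain r) z"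
  obtain y' where y': "y' |\<in>| elems x'" "z' |\<in>| elems y'" using *(1) by (auto simp: ffUnion.rep_eq)
  show "sim c c' k r z z'"
  proof (rule sim_reduce[OF assms(1,1) *(2-6)])
    show "hsupp c k w" if "w |\<in>| elems z" for w
      by (rule hsupp_elem[OF hsupp_elem[OF sim_elem_hsupp[OF assms(1-3) p y(1)] y(2)] that])
    show "hsupp c' k w" if "w |\<in>| elems z'" for w
      by (rule hsupp_elem[OF hsupp_elem[OF sim_elem_hsupp'[OF assms(1-3) p y'(1)] y'(2)] that])
  qed
qed

lemma sim_big_union:
  assumes "k \<le> K" "sim c c' k p x x'" "pbij c c' p" "card p \<le> K"
  shows "sim c c' k p (big_union x) (big_union x')"
proof (rule sim_HSetI)
  interpret s: back_and_forth c' c K by (rule swapped)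
  show "lifts c c' k (sim c c' k) p (fset (ffUnion (elems |`| elems x))) (fset (ffUnion (elems |`| elems x')))"
    by (rule lifts_big_union[OF assms])
  show "lifts c' c k (sim c' c k) (p\<inverse>) (fset (ffUnion (elems |`| elems x'))) (fset (ffUnion (elems |`| elems x)))"
    using assms sim_converse[of c c' k p x x'] pbij_converse[of c' c p]
    by (intro s.lifts_big_union[OF assms(1)]) simp_all
qed

text \<open>The value of a comprehension at \<open>a\<close> depends on \<open>a\<close> and on the
  parameters matched by \<open>p\<close>, so \<open>T\<close> is \<open>Domain p\<close> together
  with the set offered for \<open>a\<close>. Nothing is reduced here: the bound grows to
  \<open>card p + m\<close>.\<close>

lemma lifts_image:
  assumes "sim c c' m p x x'" "pbij c c' p" "card p + m \<le> B"
    and R: "\<And>q a a'. a |\<in>| elems x \<Longrightarrow> a' |\<in>| elems x' \<Longrightarrow> p \<subseteq> q \<Longrightarrow> pbij c c' q \<Longrightarrow> card q \<le> card p + m \<Longrightarrow>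
       sim c c' m q a a' \<Longrightarrow> g a \<Longrightarrow> g' a' \<and> R q (h a) (h' a')"
  shows "lifts c c' B R p (h ` {a. a |\<in>| elems x \<and> g a}) (h' ` {a. a |\<in>| elems x' \<and> g' a})"
  unfolding lifts_def
proof
  fix y assume "y \<in> h ` {a. a |\<in>| elems x \<and> g a}"
  then obtain a where a: "a |\<in>| elems x" "g a" "y = h a" by auto
  obtain U where U: "U \<subseteq> dom c" "finite U" "card U \<le> m"
    "\<forall>s. Domain s = U \<longrightarrow> pbij c c' (p \<union> s) \<longrightarrow> (\<exists>a'\<in>fset (elems x'). sim c c' m s a a')"
    by (rule liftsD[OF sim_elems(1)[OF assms(1)] a(1)])
  have card: "card (Domain p \<union> U) \<le> card p + m"
    using card_Un_le[of "Domain p" U] U(3) pbij_card_Domain[OF assms(2)] by linarith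
  have "\<exists>y'\<in>h' ` {a. a |\<in>| elems x' \<and> g' a}. R q y y'"
    if q: "Domain q = Domain p \<union> U" "pbij c c' (p \<union> q)" for q
  proof -
    have qb: "pbij c c' q" using q(2) by (rule pbij_subset) auto
    \<comment> \<open>Compatible with \<open>p\<close> and defined on all of
      \<open>Domain p\<close>, \<open>q\<close> must contain \<open>p\<close>; everything related
      along \<open>p\<close> remains related along \<open>q\<close>.\<close>
    have pq: "p \<subseteq> q"
    proof
      fix z assume z: "z \<in> p"
      obtain a b where ab: "z = (a, b)" by (cases z)
      then have "a \<in> Domain q" using z q(1) by blast
      then obtain b' where "(a, b') \<in> q" by blast
      then show "z \<in> q" using pbijD(2)[OF q(2), of a b b'] z ab by simp
    qed
    define qU where "qU = {(a, b) \<in> q. a \<in> U}"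
    have "Domain qU = U" unfolding qU_def using q(1) by auto
    moreover have "pbij c c' (p \<union> qU)" using q(2) by (rule pbij_subset) (auto simp: qU_def)
    ultimately obtain a' where a': "a' |\<in>| elems x'" "sim c c' m qU a a'" using U(4) by blast
    have "sim c c' m q a a'" using sim_weaken[OF a'(2), of q m] by (auto simp: qU_def)
    then have "g' a' \<and> R q (h a) (h' a')"
      using R[OF a(1) a'(1) pq qb _ _ a(2)] pbij_card_Domain[OF qb] q(1) card by simp
    then show ?thesis using a(3) a'(1) by blast
  qed
  moreover have "Domain p \<subseteq> dom c" using pbijD(4)[OF assms(2)] by blast
  ultimately show "\<exists>T\<subseteq>dom c. finite T \<and> card T \<le> B \<and>
     (\<forall>q. Domain q = T \<longrightarrow> pbij c c' (p \<union> q) \<longrightarrow> (\<exists>y'\<in>h' ` {a. a |\<in>| elems x' \<and> g' a}. R q y y'))"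
    using U(1,2) card assms(3) pbijD(1)[OF assms(2)]
    by (intro exI[of _ "Domain p \<union> U"] conjI allI impI) (auto intro: finite_Domain)
qed

end

section \<open>Equivariance of runs\<close>

lemma map_obj_ff [simp]: "map_obj \<pi> ff = ff"
  by (simp add: ff_def)

lemma map_obj_tt [simp]: "map_obj \<pi> tt = tt"
  by (simp add: tt_def)

lemma map_obj_truth [simp]: "map_obj \<pi> (truth b) = truth b"
  by (simp add: truth_def)

lemma map_obj_ordinal [simp]: "map_obj \<pi> (ordinal n) = ordinal n"
  by (induction n) (simp_all flip: elems_map_obj)

lemma map_obj_eq_tt_iff: "bij \<pi> \<Longrightarrow> map_obj \<pi> x = tt \<longleftrightarrow> x = tt"
  by (metis map_obj_eq_iff map_obj_tt)

lemma boolean_map_obj: "bij \<pi> \<Longrightarrow> boolean (map_obj \<pi> x) \<longleftrightarrow> boolean x"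
  unfolding boolean_def by (metis map_obj_eq_iff map_obj_tt map_obj_ff)

lemma the_unique_simps:
  "elems x = {|y|} \<Longrightarrow> the_unique x = y"
  "\<nexists>y. elems x = {|y|} \<Longrightarrow> the_unique x = ff"
  by (simp_all add: the_unique_def)

lemma map_obj_the_unique:
  fixes \<pi> :: "'a \<Rightarrow> 'a"
  assumes "bij \<pi>"
  shows "map_obj \<pi> (the_unique x) = the_unique (map_obj \<pi> x)"
proof (cases "\<exists>y. elems x = {|y|}")
  case True
  then obtain y where "elems x = {|y|}" by blast
  then show ?thesis by (simp add: elems_map_obj the_unique_simps)
next
  case False
  have "elems (map_obj \<pi> x) \<noteq> {|z|}" for z
  proof
    assume "elems (map_obj \<pi> x) = {|z|}"
    then have "elems (map_obj (inv \<pi>) (map_obj \<pi> x)) = {|map_obj (inv \<pi>) z|}"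
      by (simp add: elems_map_obj)
    then show False using False map_obj_inv(1)[OF assms, of x] by metis
  qed
  then show ?thesis using False by (simp add: the_unique_simps)
qed

text \<open>The relations depend on colours only: every \<open>cperm\<close> is an automorphism, and
  one \<open>Q\<close> describes both instances, so partial bijections preserving colours preserve
  the input relations.\<close>

definition coloured_structure ::
  "('a, 'v) colouring \<Rightarrow> ('i \<Rightarrow> 'v option list \<Rightarrow> bool) \<Rightarrow> ('i, 'a) fin_structure" where
  "coloured_structure c Q =
     \<lparr>universe = Abs_fset (dom c), rel = \<lambda>P. {as. set as \<subseteq> dom c \<and> Q P (map c as)}\<rparr>"

lemma coloured_structure_simps:
  "finite (dom c) \<Longrightarrow> fset (universe (coloured_structure c Q)) = dom c"
  "rel (coloured_structure c Q) P = {as. set as \<subseteq> dom c \<and> Q P (map c as)}"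
  by (simp_all add: coloured_structure_def Abs_fset_inverse)

definition equivariant ::
  "('a, 'v) colouring \<Rightarrow> ('i \<Rightarrow> 'v option list \<Rightarrow> bool) \<Rightarrow> ('i, 'a) state \<Rightarrow> bool" where
  "equivariant c Q A \<longleftrightarrow> finite (dom c) \<and> structure_of A = coloured_structure c Q \<and>
     (\<forall>\<pi> f xs. cperm c \<pi> \<longrightarrow> dyn A f (map (map_obj \<pi>) xs) = map_obj \<pi> (dyn A f xs))"

lemma atoms_equivariant: "equivariant c Q A \<Longrightarrow> fset (atoms A) = dom c"
  by (simp add: equivariant_def atoms_def coloured_structure_simps)

lemma map_Atom_mem_iff:
  "xs \<in> map Atom ` rel (coloured_structure c Q) P \<longleftrightarrow>
     (\<exists>as. xs = map Atom as \<and> set as \<subseteq> dom c \<and> Q P (map c as))"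
  by (auto simp: coloured_structure_simps)

lemma interp_map_obj:
  assumes A: "equivariant c Q A" and \<pi>: "cperm c \<pi>" and ar: "name_arity \<Upsilon> f = Some (length xs)"
  shows "interp A f (map (map_obj \<pi>) xs) = map_obj \<pi> (interp A f xs)"
proof -
  have b: "bij \<pi>" using \<pi> by (rule cperm_bij)
  show ?thesis
  proof (cases f)
    case FAtoms
    have "\<pi> ` dom c = dom c" using \<pi> by (simp add: cperm_def permutes_image)
    then have "(\<pi> |`| atoms A) = atoms A"
      using atoms_equivariant[OF A] by (metis fimage.rep_eq fset_inject)
    then have "map_obj \<pi> |`| (Atom |`| atoms A) = Atom |`| atoms A"
      by (metis (no_types, lifting) fset.map_comp fset.map_cong0 comp_apply obj.map(1))
    then show ?thesis using FAtoms by simp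
  next
    case FUnion
    then have "map (map_obj \<pi>) xs ! 0 = map_obj \<pi> (xs ! 0)" using ar by (intro nth_map) auto
    then show ?thesis by (simp only: FUnion interp.simps map_obj_big_union)
  next
    case FTheUnique
    then have "map (map_obj \<pi>) xs ! 0 = map_obj \<pi> (xs ! 0)" using ar by (intro nth_map) auto
    then show ?thesis by (simp add: FTheUnique map_obj_the_unique b)
  next
    case FNot
    then have "map (map_obj \<pi>) xs ! 0 = map_obj \<pi> (xs ! 0)" using ar by (intro nth_map) auto
    then show ?thesis by (simp add: FNot map_obj_eq_tt_iff boolean_map_obj b)
  next
    case (FInput P)
    have S: "structure_of A = coloured_structure c Q" using A by (simp add: equivariant_def)
    have *: "map (map_obj \<sigma>) xs \<in> map Atom ` rel (coloured_structure c Q) P"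
      if \<sigma>: "cperm c \<sigma>" and xs: "xs \<in> map Atom ` rel (coloured_structure c Q) P" for \<sigma> xs
    proof -
      obtain as where as: "xs = map Atom as" "set as \<subseteq> dom c" "Q P (map c as)"
        using xs[unfolded map_Atom_mem_iff] by blast
      have "map c as = map c (map \<sigma> as)" by (simp add: cperm_colour[OF \<sigma>])
      moreover have "set (map \<sigma> as) \<subseteq> dom c"
        using as(2) cperm_colour[OF \<sigma>] by (auto simp: domIff subset_iff)
      moreover have "map (map_obj \<sigma>) xs = map Atom (map \<sigma> as)" by (simp add: as(1))
      ultimately show ?thesis
        unfolding map_Atom_mem_iff using as(3)[unfolded \<open>map c as = map c (map \<sigma> as)\<close>]
        by (intro exI[of _ "map \<sigma> as"] conjI)
    qed
    have "map (map_obj (inv \<pi>)) (map (map_obj \<pi>) xs) = xs"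
      by (simp add: map_obj_inv b comp_def)
    then have "map (map_obj \<pi>) xs \<in> map Atom ` rel (coloured_structure c Q) P \<longleftrightarrow>
        xs \<in> map Atom ` rel (coloured_structure c Q) P"
      using *[OF \<pi>, of xs] *[OF cperm_inv[OF \<pi>], of "map (map_obj \<pi>) xs"] by auto
    then show ?thesis using FInput S by simp
  next
    case (FDyn h)
    then show ?thesis using A \<pi> by (simp add: equivariant_def)
  qed (use ar b in \<open>auto simp: connective_def map_obj_eq_tt_iff boolean_map_obj map_obj_mem_iff\<close>)
qed

lemma val_map_obj:
  assumes A: "equivariant c Q A" and \<pi>: "cperm c \<pi>" and "wf_tm \<Upsilon> t"
  shows "val A (\<lambda>u. map_obj \<pi> (\<rho> u)) t = map_obj \<pi> (val A \<rho> t)"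
  using assms(3)
proof (induction t arbitrary: \<rho>)
  case (App f ts)
  have "map (val A (\<lambda>u. map_obj \<pi> (\<rho> u))) ts = map (map_obj \<pi>) (map (val A \<rho>) ts)"
    using App by simp
  moreover have "name_arity \<Upsilon> f = Some (length (map (val A \<rho>) ts))" using App.prems by simp
  ultimately show ?case by (simp only: val.simps interp_map_obj[OF A \<pi>])
next
  case (Compr t v r g)
  have b: "bij \<pi>" using \<pi> by (rule cperm_bij)
  have upd: "(\<lambda>u. map_obj \<pi> (\<rho> u))(v := map_obj \<pi> a) = (\<lambda>u. map_obj \<pi> ((\<rho>(v := a)) u))" for a
    by (simp add: fun_eq_iff)
  have IH: "val A ((\<lambda>u. map_obj \<pi> (\<rho> u))(v := map_obj \<pi> a)) t = map_obj \<pi> (val A (\<rho>(v := a)) t)"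
    "val A ((\<lambda>u. map_obj \<pi> (\<rho> u))(v := map_obj \<pi> a)) g = map_obj \<pi> (val A (\<rho>(v := a)) g)"
    "val A (\<lambda>u. map_obj \<pi> (\<rho> u)) r = map_obj \<pi> (val A \<rho> r)" for a
    using Compr by (simp_all only: upd wf_tm.simps)
  have "fset ((\<lambda>a. val A ((\<lambda>u. map_obj \<pi> (\<rho> u))(v := a)) t) |`|
      ffilter (\<lambda>a. val A ((\<lambda>u. map_obj \<pi> (\<rho> u))(v := a)) g = tt) (map_obj \<pi> |`| elems (val A \<rho> r)))
    = fset (map_obj \<pi> |`| ((\<lambda>a. val A (\<rho>(v := a)) t) |`| ffilter (\<lambda>a. val A (\<rho>(v := a)) g = tt) (elems (val A \<rho> r))))"
    by (force simp: IH map_obj_eq_tt_iff b image_iff)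
  then show ?case by (simp only: val.simps IH obj.map elems_map_obj fset_inject)
qed simp

definition map_update :: "('a \<Rightarrow> 'a) \<Rightarrow> 'a update \<Rightarrow> 'a update" where
  "map_update \<pi> = (\<lambda>(f, xs, b). (f, map (map_obj \<pi>) xs, map_obj \<pi> b))"

lemma Den_map_obj:
  assumes A: "equivariant c Q A" and \<pi>: "cperm c \<pi>" and "wf_rule \<Upsilon> R"
  shows "Den R A (\<lambda>u. map_obj \<pi> (\<rho> u)) = map_update \<pi> ` Den R A \<rho>"
  using assms(3)
proof (induction R arbitrary: \<rho>)
  case (Update f ss t)
  then show ?case by (simp add: map_update_def val_map_obj[OF A \<pi>, of \<Upsilon>])
next
  case (Cond g R1 R2)
  then show ?case
    by (simp add: val_map_obj[OF A \<pi>, of \<Upsilon>] map_obj_eq_tt_iff cperm_bij[OF \<pi>])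
next
  case (Forall v r R)
  have upd: "(\<lambda>u. map_obj \<pi> (\<rho> u))(v := map_obj \<pi> a) = (\<lambda>u. map_obj \<pi> ((\<rho>(v := a)) u))" for a
    by (simp add: fun_eq_iff)
  have "val A (\<lambda>u. map_obj \<pi> (\<rho> u)) r = map_obj \<pi> (val A \<rho> r)"
    using Forall.prems by (simp add: val_map_obj[OF A \<pi>, of \<Upsilon>])
  then have "Den (Forall v r R) A (\<lambda>u. map_obj \<pi> (\<rho> u)) =
      (\<Union>a\<in>fset (elems (val A \<rho> r)). Den R A ((\<lambda>u. map_obj \<pi> (\<rho> u))(v := map_obj \<pi> a)))"
    by (simp add: elems_map_obj)
  also have "\<dots> = (\<Union>a\<in>fset (elems (val A \<rho> r)). map_update \<pi> ` Den R A (\<rho>(v := a)))"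
    using Forall by (simp only: upd wf_rule.simps)
  finally show ?case by (simp add: image_UN)
qed simp

lemma dyn_sequel:
  assumes "\<not> clash (Den R A (\<lambda>v. ff))"
  shows "(f, xs, b) \<in> Den R A (\<lambda>v. ff) \<Longrightarrow> dyn (sequel R A) f xs = b"
    "(\<And>b. (f, xs, b) \<notin> Den R A (\<lambda>v. ff)) \<Longrightarrow> dyn (sequel R A) f xs = dyn A f xs"
proof -
  assume b: "(f, xs, b) \<in> Den R A (\<lambda>v. ff)"
  then have "(THE b. (f, xs, b) \<in> Den R A (\<lambda>v. ff)) = b"
    using assms unfolding clash_def by blast
  then show "dyn (sequel R A) f xs = b"
    using b assms by (auto simp: sequel_def Let_def)
qed (use assms in \<open>auto simp: sequel_def Let_def\<close>)

lemma sequel_clash: "clash (Den R A (\<lambda>v. ff)) \<Longrightarrow> sequel R A = A"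
  by (simp add: sequel_def)

lemma structure_of_sequel [simp]: "structure_of (sequel R A) = structure_of A"
  by (simp add: sequel_def Let_def)

lemma equivariant_sequel:
  assumes A: "equivariant c Q A" and "wf_rule \<Upsilon> R"
  shows "equivariant c Q (sequel R A)"
proof (cases "clash (Den R A (\<lambda>v. ff))")
  case True
  then show ?thesis using A by (simp add: sequel_clash)
next
  case False
  have *: "(f, map (map_obj \<pi>) xs, map_obj \<pi> b) \<in> Den R A (\<lambda>v. ff)"
    if "(f, xs, b) \<in> Den R A (\<lambda>v. ff)" "cperm c \<pi>" for f xs b \<pi>
  proof -
    have "Den R A (\<lambda>v. ff) = map_update \<pi> ` Den R A (\<lambda>v. ff)"
      using Den_map_obj[OF A that(2) assms(2), of "\<lambda>v. ff"] by simp
    moreover have "map_update \<pi> (f, xs, b) \<in> map_update \<pi> ` Den R A (\<lambda>v. ff)"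
      using that(1) by (rule imageI)
    ultimately show ?thesis by (simp add: map_update_def)
  qed
  have "dyn (sequel R A) f (map (map_obj \<pi>) xs) = map_obj \<pi> (dyn (sequel R A) f xs)"
    if \<pi>: "cperm c \<pi>" for \<pi> f xs
  proof (cases "\<exists>b. (f, xs, b) \<in> Den R A (\<lambda>v. ff)")
    case True
    then obtain b where "(f, xs, b) \<in> Den R A (\<lambda>v. ff)" by blast
    then show ?thesis using dyn_sequel(1)[OF False] * \<pi> by metis
  next
    case none: False
    have "\<nexists>b. (f, map (map_obj \<pi>) xs, b) \<in> Den R A (\<lambda>v. ff)"
    proof
      assume "\<exists>b. (f, map (map_obj \<pi>) xs, b) \<in> Den R A (\<lambda>v. ff)"
      then obtain b where "(f, map (map_obj \<pi>) xs, b) \<in> Den R A (\<lambda>v. ff)" ..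
      from *[OF this cperm_inv[OF \<pi>]] none show False
        by (simp add: map_obj_inv[OF cperm_bij[OF \<pi>]] comp_def)
    qed
    then show ?thesis
      using none dyn_sequel(2)[OF False] A \<pi> by (simp add: equivariant_def)
  qed
  then show ?thesis using A by (simp add: equivariant_def)
qed

lemma equivariant_run_state:
  assumes "finite (dom c)" "wf_rule \<Upsilon> R"
  shows "equivariant c Q (run_state R (coloured_structure c Q) i)"
proof (induction i)
  case 0
  show ?case using assms(1) by (simp add: run_state_def equivariant_def initial_state_def)
next
  case (Suc i)
  then show ?case using equivariant_sequel[OF _ assms(2)] by (simp add: run_state_def)
qed

text \<open>Together with \<open>active_elem\<close>, this is the closure that
  \<open>small_support\<close> demands of the set whose cardinality is bounded.\<close>

lemma active_map_obj:
  assumes A: "equivariant c Q A" and \<pi>: "cperm c \<pi>" and "x \<in> active A"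
  shows "map_obj \<pi> x \<in> active A"
proof -
  have crit: "map_obj \<pi> y \<in> critical A" if y: "y \<in> critical A" for y
  proof -
    have dyn: "dyn A f (map (map_obj \<pi>) xs) = map_obj \<pi> (dyn A f xs)" for f xs
      using A \<pi> by (simp add: equivariant_def)
    consider a where "a \<in> dom c" "y = Atom a" | "y = ff" | "y = tt" | f xs where "y = dyn A f xs"
      | f xs where "dyn A f xs \<noteq> ff" "y \<in> set xs"
      using y by (auto simp: critical_def atoms_equivariant[OF A])
    then show ?thesis
    proof cases
      case 1
      then have "\<pi> a \<in> dom c" using cperm_colour[OF \<pi>, of a] by auto
      then show ?thesis using 1 by (simp add: critical_def atoms_equivariant[OF A])
    next
      case 4
      then have "map_obj \<pi> y = dyn A f (map (map_obj \<pi>) xs)" using dyn by simp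
      then show ?thesis unfolding critical_def by blast
    next
      case 5
      have "map_obj \<pi> (dyn A f xs) \<noteq> ff"
        using 5(1) cperm_bij[OF \<pi>] by (metis map_obj_eq_iff map_obj_ff)
      then have "dyn A f (map (map_obj \<pi>) xs) \<noteq> ff" "map_obj \<pi> y \<in> set (map (map_obj \<pi>) xs)"
        using dyn 5(2) by simp_all
      then show ?thesis unfolding critical_def by blast
    qed (simp_all add: critical_def)
  qed
  have "map_obj \<pi> x \<in> TC (map_obj \<pi> y)" if "x \<in> TC y" for y
    using that
  proof (induction rule: TC.induct)
    case (elem z w)
    then show ?case using map_obj_mem_iff[OF cperm_bij[OF \<pi>], of w z] TC.elem by metis
  qed (rule TC.self)
  with crit assms(3) show ?thesis unfolding active_def by blast
qed

lemma active_elem: "x \<in> active A \<Longrightarrow> y |\<in>| elems x \<Longrightarrow> y \<in> active A"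
  unfolding active_def by (blast intro: TC.elem)

lemma active_dyn: "dyn A f xs \<in> active A"
  unfolding active_def
proof (rule UN_I)
  show "dyn A f xs \<in> critical A" unfolding critical_def by blast
qed (rule TC.self)

section \<open>Simulation of terms and rules\<close>

lemma elems_ordinal: "fset (elems (ordinal n)) = ordinal ` {..<n}"
  by (induction n) (auto simp: lessThan_Suc)

lemma ff_ordinal: "ff = ordinal 0"
  by (simp add: ff_def)

lemma tt_ordinal: "tt = ordinal 1"
  by (simp add: tt_def ff_def)

text \<open>With \<open>T = Domain p\<close> the only compatible \<open>q\<close> is
  \<open>p\<close> itself, so no extension has to be considered.\<close>

lemma lifts_same:
  assumes "pbij c c' p" "card p \<le> k" "\<And>x. x \<in> U \<Longrightarrow> \<exists>y\<in>V. R p x y"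
  shows "lifts c c' k R p U V"
  unfolding lifts_def
proof
  fix x assume x: "x \<in> U"
  have "\<exists>y\<in>V. R q x y" if q: "Domain q = Domain p" "pbij c c' (p \<union> q)" for q
  proof -
    have "q = p"
    proof (intro equalityI subrelI)
      fix a b assume "(a, b) \<in> q"
      moreover from this obtain b' where "(a, b') \<in> p" using q(1) by blast
      ultimately show "(a, b) \<in> p" using pbijD(2)[OF q(2), of a b b'] by auto
    next
      fix a b assume "(a, b) \<in> p"
      moreover from this obtain b' where "(a, b') \<in> q" using q(1) by blast
      ultimately show "(a, b) \<in> q" using pbijD(2)[OF q(2), of a b b'] by auto
    qed
    then show ?thesis using assms(3)[OF x] by simp
  qed
  moreover have "Domain p \<subseteq> dom c" using pbijD(4)[OF assms(1)] by blast
  ultimately show "\<exists>T\<subseteq>dom c. finite T \<and> card T \<le> k \<and>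
      (\<forall>q. Domain q = T \<longrightarrow> pbij c c' (p \<union> q) \<longrightarrow> (\<exists>y\<in>V. R q x y))"
    using pbij_card_Domain[OF assms(1)] pbijD(1)[OF assms(1)] assms(2)
    by (intro exI[of _ "Domain p"] conjI allI impI) (auto intro: finite_Domain)
qed

lemma sim_ordinal: "sim c c' k p (ordinal n) (ordinal n)"
proof -
  have "sim c c' k {} (ordinal n) (ordinal n)"
  proof (induction n rule: less_induct)
    case (less n)
    have h: "(ordinal n :: 'z obj) = HSet (elems (ordinal n))" for n by (cases n) auto
    have "sim c c' k {} (HSet (elems (ordinal n))) (HSet (elems (ordinal n)))"
    proof (rule sim_HSetI)
      show "lifts c c' k (sim c c' k) {} (fset (elems (ordinal n))) (fset (elems (ordinal n)))"
        by (rule lifts_same) (use less in \<open>auto simp: elems_ordinal\<close>)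
      have "sim c' c k {} (ordinal i) (ordinal i)" if "i < n" for i
        using less[OF that] sim_converse[of c c' k "{}"] by simp
      then show "lifts c' c k (sim c' c k) ({}\<inverse>) (fset (elems (ordinal n))) (fset (elems (ordinal n)))"
        by (intro lifts_same) (auto simp: elems_ordinal intro!: bexI[rotated])
    qed
    then show ?case using h by metis
  qed
  then show ?thesis by (rule sim_weaken) auto
qed

lemma sim_ff: "sim c c' k p ff ff" and sim_tt: "sim c c' k p tt tt"
  unfolding ff_ordinal tt_ordinal by (rule sim_ordinal)+

lemma sim_truth: "sim c c' k p (truth b) (truth b)"
  by (simp add: truth_def sim_ff sim_tt)

lemma sim_pair:
  assumes "pbij c c' p" "card p \<le> k" "sim c c' k p x x'" "sim c c' k p y y'"
  shows "sim c c' k p (HSet {|x, y|}) (HSet {|x', y'|})"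
proof (rule sim_HSetI)
  show "lifts c c' k (sim c c' k) p (fset {|x, y|}) (fset {|x', y'|})"
    using assms by (intro lifts_same) auto
  have "sim c' c k (p\<inverse>) x' x" "sim c' c k (p\<inverse>) y' y" using assms(3,4) sim_converse by blast+
  then show "lifts c' c k (sim c' c k) (p\<inverse>) (fset {|x', y'|}) (fset {|x, y|})"
    using assms(1,2) by (intro lifts_same) (auto simp: pbij_converse)
qed

lemma lifts_atoms:
  assumes "1 \<le> k"
  shows "lifts c c' k (sim c c' k) p (Atom ` dom c) (Atom ` dom c')"
  unfolding lifts_def
proof
  fix x assume "x \<in> Atom ` dom c"
  then obtain a where a: "x = Atom a" "a \<in> dom c" by blast
  have "\<exists>y\<in>Atom ` dom c'. sim c c' k q x y" if q: "Domain q = {a}" "pbij c c' (p \<union> q)" for q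
  proof -
    obtain b where b: "(a, b) \<in> q" using q(1) by blast
    then have "b \<in> dom c'" using pbijD(5)[OF q(2), of a b] a(2) by auto
    then show ?thesis using a(1) b by (auto intro: sim_Atom)
  qed
  then show "\<exists>T\<subseteq>dom c. finite T \<and> card T \<le> k \<and>
      (\<forall>q. Domain q = T \<longrightarrow> pbij c c' (p \<union> q) \<longrightarrow> (\<exists>y\<in>Atom ` dom c'. sim c c' k q x y))"
    using a(2) assms by (intro exI[of _ "{a}"] conjI allI impI) auto
qed

lemma list_all2_sim_Atom:
  assumes "list_all2 (sim c c' k p) (map Atom as) xs"
  shows "\<exists>bs. xs = map Atom bs \<and> list_all2 (\<lambda>a b. (a, b) \<in> p) as bs"
  using assms
proof (induction as arbitrary: xs)
  case (Cons a as)
  then obtain y ys where y: "xs = y # ys" "sim c c' k p (Atom a) y" "list_all2 (sim c c' k p) (map Atom as) ys"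
    by (auto simp: list_all2_Cons1)
  obtain b where "y = Atom b" "(a, b) \<in> p" using y(2) by auto
  moreover obtain bs where "ys = map Atom bs" "list_all2 (\<lambda>a b. (a, b) \<in> p) as bs"
    using Cons.IH[OF y(3)] by blast
  ultimately show ?case using y(1) by (intro exI[of _ "b # bs"]) simp
qed simp

text \<open>Arguments may be compared with the bound \<open>K\<close>, as they are computed during a
  step, while the values come with \<open>k\<close>, from which the next step starts. This asymmetry
  lets the invariant survive any number of steps.\<close>

definition states_sim ::
  "('a, 'v) colouring \<Rightarrow> ('b, 'v) colouring \<Rightarrow> nat \<Rightarrow> nat \<Rightarrow> ('i, 'a) state \<Rightarrow> ('i, 'b) state \<Rightarrow> bool" where
  "states_sim c c' K k A A' \<longleftrightarrow> (\<forall>p f xs xs'. pbij c c' p \<longrightarrow> card p \<le> K \<longrightarrow>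
     list_all2 (sim c c' K p) xs xs' \<longrightarrow> sim c c' k p (dyn A f xs) (dyn A' f xs'))"

lemma list_all2_sim_converse:
  "list_all2 (sim c c' k p) xs ys \<longleftrightarrow> list_all2 (sim c' c k (p\<inverse>)) ys xs"
proof -
  have "sim c c' k p = (\<lambda>x y. sim c' c k (p\<inverse>) y x)" by (intro ext) (rule sim_converse)
  then show ?thesis by (metis list_all2_conv_all_nth)
qed

lemma states_sim_converse:
  assumes "states_sim c c' K k A A'"
  shows "states_sim c' c K k A' A"
  unfolding states_sim_def
proof (intro allI impI)
  fix p f xs xs' assume "pbij c' c p" "card p \<le> K" "list_all2 (sim c' c K p) xs xs'"
  then have "pbij c c' (p\<inverse>)" "card (p\<inverse>) \<le> K" "list_all2 (sim c c' K (p\<inverse>)) xs' xs"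
    using list_all2_sim_converse[of c' c K p xs xs'] by (simp_all add: pbij_converse)
  then have "sim c c' k (p\<inverse>) (dyn A f xs') (dyn A' f xs)"
    using assms unfolding states_sim_def by blast
  then show "sim c' c k p (dyn A' f xs) (dyn A f xs')" using sim_converse[of c c' k "p\<inverse>"] by simp
qed

text \<open>\<open>tm_bound t n\<close> bounds the supports that occur in the evaluation of \<open>t\<close> when those of the values of
  its variables have at most \<open>n\<close> elements.\<close>

fun tm_bound :: "'i tm \<Rightarrow> nat \<Rightarrow> nat" where
  "tm_bound (Var v) n = n"
| "tm_bound (App f ts) n = n + (\<Sum>t\<leftarrow>ts. tm_bound t n)"
| "tm_bound (Compr t v r g) n =
     (n + tm_bound r n) + tm_bound t (n + tm_bound r n) + tm_bound g (n + tm_bound r n)"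

primrec rule_bound :: "'i rule \<Rightarrow> nat \<Rightarrow> nat" where
  "rule_bound Skip n = n"
| "rule_bound (Update f ss t) n = n + (\<Sum>s\<leftarrow>ss. tm_bound s n) + tm_bound t n"
| "rule_bound (Cond g R1 R2) n = tm_bound g n + rule_bound R1 n + rule_bound R2 n"
| "rule_bound (Forall v r R) n = rule_bound R (n + tm_bound r n)"

lemma tm_bound_ge: "n \<le> tm_bound t n"
  by (cases t) auto

lemma rule_bound_ge: "n \<le> rule_bound R n"
proof (induction R arbitrary: n)
  case (Forall v r R)
  show ?case using Forall[of "n + tm_bound r n"] by simp
qed (auto intro: trans_le_add1 trans_le_add2)

locale simulation = back_and_forth c c' K
  for c :: "('a, 'v) colouring" and c' :: "('b, 'v) colouring" and K +
  fixes Q :: "'i \<Rightarrow> 'v option list \<Rightarrow> bool" and k :: nat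
    and A :: "('i, 'a) state" and A' :: "('i, 'b) state" and \<Upsilon> :: "'i vocabulary"
  assumes input: "structure_of A = coloured_structure c Q" "structure_of A' = coloured_structure c' Q"
    and same_size: "card (dom c) = card (dom c')"
    and states_sim: "states_sim c c' K k A A'"
begin

lemma swap_simulation: "simulation c' c K Q k A' A"
  by (intro simulation.intro simulation_axioms.intro swapped states_sim_converse[OF states_sim])
    (simp_all add: input same_size)

lemma finite_doms: "finite (dom c)" "finite (dom c')"
  using ample ample' by (auto simp: ample_def)

lemma atoms_A: "fset (atoms A) = dom c" "fset (atoms A') = dom c'"
  by (simp_all add: atoms_def input coloured_structure_simps finite_doms)

lemma tt_iff:
  assumes "n \<le> K" "pbij c c' p" "card p \<le> K" "sim c c' n p x x'"
  shows "x = tt \<longleftrightarrow> x' = tt" "boolean x \<longleftrightarrow> boolean x'"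
  using related_eq_iff[OF assms(1) _ _ _ assms(4) sim_tt, of p] related_eq_iff[OF assms(1) _ _ _ assms(4) sim_ff, of p]
    assms(2,3) by (auto simp: boolean_def)

lemma interp_FInput:
  assumes "list_all2 (sim c c' n p) xs xs'" "pbij c c' p"
    "xs \<in> map Atom ` rel (structure_of A) P"
  shows "xs' \<in> map Atom ` rel (structure_of A') P"
proof -
  obtain as where as: "xs = map Atom as" "set as \<subseteq> dom c" "Q P (map c as)"
    using assms(3)[unfolded input map_Atom_mem_iff] by blast
  obtain bs where bs: "xs' = map Atom bs" "list_all2 (\<lambda>a b. (a, b) \<in> p) as bs"
    using list_all2_sim_Atom assms(1) as(1) by blast
  have 1: "map c as = map c' bs"
    using bs(2) pbijD(5)[OF assms(2)] by (induction rule: list_all2_induct) auto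
  have 2: "set bs \<subseteq> dom c'"
    using bs(2) pbijD(4,5)[OF assms(2)] by (induction rule: list_all2_induct) (auto simp: domIff)
  show ?thesis
    unfolding input map_Atom_mem_iff using as(3) 1 2 bs(1) by (intro exI[of _ bs]) simp
qed

lemma interp_sim:
  assumes n: "n \<le> K" "1 \<le> n" "k \<le> n" and p: "pbij c c' p" "card p \<le> n"
    and xs: "list_all2 (sim c c' n p) xs xs'" and ar: "name_arity \<Upsilon> f = Some (length xs)"
  shows "sim c c' n p (interp A f xs) (interp A' f xs')"
proof -
  interpret s: simulation c' c K Q k A' A by (rule swap_simulation)
  have pK: "card p \<le> K" using p(2) n(1) by linarith
  have len: "length xs = length xs'" using xs by (rule list_all2_lengthD)
  have nth: "sim c c' n p (xs ! i) (xs' ! i)" if "i < length xs" for i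
    using xs that by (rule list_all2_nthD)
  have tt: "(xs ! i = tt) = (xs' ! i = tt)" "boolean (xs ! i) = boolean (xs' ! i)" if "i < length xs" for i
    using tt_iff[OF n(1) p(1) pK nth[OF that]] by auto
  have b: "sim c c' n p (truth b) (truth b')" if "b = b'" for b b' using that sim_truth by simp
  show ?thesis
  proof (cases f)
    case FEq
    then have "0 < length xs" "1 < length xs" using ar by auto
    then have "xs ! 0 = xs ! 1 \<longleftrightarrow> xs' ! 0 = xs' ! 1"
      using related_eq_iff[OF n(1) _ _ _ nth[of 0] nth[of 1]] p(1) pK by auto
    then show ?thesis using FEq by (simp add: b)
  next
    case FNot
    then have "0 < length xs" using ar by auto
    then show ?thesis using tt[of 0] by (simp add: FNot b)
  next
    case FAnd
    then have "0 < length xs" "1 < length xs" using ar by auto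
    then show ?thesis using tt[of 0] tt[of 1] by (simp add: FAnd b connective_def)
  next
    case FOr
    then have "0 < length xs" "1 < length xs" using ar by auto
    then show ?thesis using tt[of 0] tt[of 1] by (simp add: FOr b connective_def)
  next
    case FImp
    then have "0 < length xs" "1 < length xs" using ar by auto
    then show ?thesis using tt[of 0] tt[of 1] by (simp add: FImp b connective_def)
  next
    case FIff
    then have "0 < length xs" "1 < length xs" using ar by auto
    then show ?thesis using tt[of 0] tt[of 1] by (simp add: FIff b connective_def)
  next
    case FMem
    then have "0 < length xs" "1 < length xs" using ar by auto
    then have "xs ! 0 |\<in>| elems (xs ! 1) \<longleftrightarrow> xs' ! 0 |\<in>| elems (xs' ! 1)"
      using sim_mem_iff[OF _ _ _ nth[of 0] nth[of 1]] p(1) pK n(1) by auto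
    then show ?thesis by (simp add: FMem b)
  next
    case FAtoms
    \<comment> \<open>An element of this set needs one atom as its support; hence
      \<open>1 \<le> n\<close>.\<close>
    have "sim c c' n p (HSet (Atom |`| atoms A)) (HSet (Atom |`| atoms A'))"
      by (rule sim_HSetI) (simp_all add: atoms_A lifts_atoms[OF n(2)])
    then show ?thesis using FAtoms by simp
  next
    case FUnion
    then have "0 < length xs" using ar by auto
    then show ?thesis using sim_big_union[OF n(1) nth p(1) pK] by (simp add: FUnion)
  next
    case FTheUnique
    then have l: "0 < length xs" using ar by auto
    show ?thesis
    proof (cases "\<exists>y. elems (xs ! 0) = {|y|}")
      case True
      then obtain y where y: "elems (xs ! 0) = {|y|}" ..
      obtain y' where y': "elems (xs' ! 0) = {|y'|}" "sim c c' n p y y'"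
        using sim_singleton[OF n(1) nth[OF l] p(1) pK y] by blast
      show ?thesis using the_unique_simps(1)[OF y] the_unique_simps(1)[OF y'(1)] y'(2) FTheUnique by simp
    next
      case False
      have "\<not> (\<exists>y'. elems (xs' ! 0) = {|y'|})"
      proof
        assume "\<exists>y'. elems (xs' ! 0) = {|y'|}"
        then obtain y' where y': "elems (xs' ! 0) = {|y'|}" ..
        have "sim c' c n (p\<inverse>) (xs' ! 0) (xs ! 0)" using nth[OF l] sim_converse by blast
        then show False
          using s.sim_singleton[OF n(1) _ _ _ y', of "p\<inverse>" "xs ! 0"] p(1) pK False
          by (auto simp: pbij_converse)
      qed
      then have "the_unique (xs' ! 0) = ff" by (rule the_unique_simps(2))
      moreover have "the_unique (xs ! 0) = ff" using False by (rule the_unique_simps(2))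
      ultimately show ?thesis by (simp add: FTheUnique sim_ff)
    qed
  next
    case FPair
    then have "0 < length xs" "1 < length xs" using ar by auto
    then show ?thesis using sim_pair[OF p nth nth] by (simp add: FPair)
  next
    case FInputSize
    \<comment> \<open>Here the two instances must have the same number of vertices: related ordinals
      are equal ones.\<close>
    have "fcard (atoms A) = fcard (atoms A')" by (simp add: fcard.rep_eq atoms_A same_size)
    then show ?thesis using FInputSize sim_ordinal by simp
  next
    case (FInput P)
    have xs': "list_all2 (sim c' c n (p\<inverse>)) xs' xs" using xs list_all2_sim_converse by blast
    have "pbij c' c (p\<inverse>)" using p(1) by (simp add: pbij_converse)
    then have "xs \<in> map Atom ` rel (structure_of A) P \<longleftrightarrow> xs' \<in> map Atom ` rel (structure_of A') P"
      using interp_FInput[OF xs p(1)] s.interp_FInput[OF xs'] by blast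
    then show ?thesis using FInput b by simp
  next
    case (FDyn h)
    \<comment> \<open>The arguments, known with bound \<open>n\<close>, are weakened to
      \<open>K\<close>; the invariant returns a value with bound \<open>k\<close>, which does not
      exceed \<open>n\<close>.\<close>
    have "list_all2 (sim c c' K p) xs xs'"
      using xs by (rule list_all2_mono) (use sim_weaken n(1) in blast)
    then have "sim c c' k p (dyn A h xs) (dyn A' h xs')"
      using states_sim p(1) pK unfolding states_sim_def by blast
    then show ?thesis using FDyn sim_weaken[OF _ subset_refl n(3)] by simp
  next
    case FTrue
    then show ?thesis using sim_tt by simp
  next
    case FFalse
    then show ?thesis using sim_ff by simp
  next
    case FEmpty
    then show ?thesis using sim_ff[unfolded ff_def] by simp
  qed
qed

text \<open>The values of subterms need not be active, so no support theorem is available for them.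
  The relation itself is carried through the term instead, at the price of a bound that depends on
  the term and on \<open>n\<close>, but not on the instance.\<close>

lemma val_sim:
  assumes "wf_tm \<Upsilon> t" "tm_bound t n \<le> K" "1 \<le> n" "k \<le> n" "pbij c c' p" "card p \<le> n"
    and "\<And>v. v \<in> fv_tm t \<Longrightarrow> sim c c' n p (\<rho> v) (\<rho>' v)"
  shows "sim c c' (tm_bound t n) p (val A \<rho> t) (val A' \<rho>' t)"
  using assms
proof (induction t arbitrary: n p \<rho> \<rho>')
  case (App f ts)
  let ?B = "tm_bound (App f ts) n"
  have "sim c c' ?B p (val A \<rho> t) (val A' \<rho>' t)" if t: "t \<in> set ts" for t
  proof -
    have le: "tm_bound t n \<le> ?B"
      using member_le_sum_list[of "tm_bound t n" "map (\<lambda>t. tm_bound t n) ts"] t by auto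
    have "sim c c' (tm_bound t n) p (val A \<rho> t) (val A' \<rho>' t)"
      by (rule App.IH[OF t]) (use App.prems t le in auto)
    then show ?thesis by (rule sim_weaken) (use le in auto)
  qed
  then have "list_all2 (sim c c' ?B p) (map (val A \<rho>) ts) (map (val A' \<rho>') ts)"
    by (simp add: list_all2_conv_all_nth)
  then show ?case
    unfolding val.simps using App.prems by (intro interp_sim) auto
next
  case (Compr t v r g)
  interpret s: simulation c' c K Q k A' A by (rule swap_simulation)
  let ?B = "tm_bound (Compr t v r g) n"
  define m where "m = n + tm_bound r n"
  have B: "?B = m + tm_bound t m + tm_bound g m" by (simp add: m_def)
  have mB: "m \<le> ?B" "tm_bound t m \<le> ?B" "tm_bound g m \<le> ?B" "tm_bound r n \<le> ?B"
    by (simp_all add: m_def)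
  have r: "sim c c' (tm_bound r n) p (val A \<rho> r) (val A' \<rho>' r)"
    by (rule Compr.IH(2)) (use Compr.prems mB in auto)
  have card: "card p + tm_bound r n \<le> ?B" using mB(1) Compr.prems(6) by (simp add: m_def)
  let ?g = "\<lambda>a. val A (\<rho>(v := a)) g = tt" and ?g' = "\<lambda>a. val A' (\<rho>'(v := a)) g = tt"
  let ?h = "\<lambda>a. val A (\<rho>(v := a)) t" and ?h' = "\<lambda>a. val A' (\<rho>'(v := a)) t"
  have step: "(?g a \<longleftrightarrow> ?g' a') \<and> sim c c' ?B q (?h a) (?h' a')"
    if q: "p \<subseteq> q" "pbij c c' q" "card q \<le> card p + tm_bound r n" "sim c c' (tm_bound r n) q a a'"
    for q a a'
  proof -
    have qm: "card q \<le> m" using q(3) Compr.prems(6) by (simp add: m_def)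
    have env: "sim c c' m q ((\<rho>(v := a)) u) ((\<rho>'(v := a')) u)"
      if "u \<in> fv_tm t \<or> u \<in> fv_tm g" for u
    proof (cases "u = v")
      case True
      then show ?thesis using sim_weaken[OF q(4), of q m] by (simp add: m_def)
    next
      case False
      then have "sim c c' n p (\<rho> u) (\<rho>' u)" using Compr.prems(7)[of u] that by auto
      then show ?thesis using False sim_weaken[of c c' n p _ _ q m] q(1) by (simp add: m_def)
    qed
    have g: "sim c c' (tm_bound g m) q (val A (\<rho>(v := a)) g) (val A' (\<rho>'(v := a')) g)"
      by (rule Compr.IH(3)) (use Compr.prems q(2) qm mB(3) env in \<open>auto simp: m_def\<close>)
    have t: "sim c c' (tm_bound t m) q (?h a) (?h' a')"
      by (rule Compr.IH(1)) (use Compr.prems q(2) qm mB(2) env in \<open>auto simp: m_def\<close>)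
    have "card q \<le> K" using qm mB(1) Compr.prems(2) by linarith
    then have "?g a \<longleftrightarrow> ?g' a'"
      using tt_iff(1)[OF _ q(2) _ g] mB(3) Compr.prems(2) by linarith
    then show ?thesis using sim_weaken[OF t, of q ?B] mB(2) by blast
  qed
  have "lifts c c' ?B (sim c c' ?B) p (?h ` {a. a |\<in>| elems (val A \<rho> r) \<and> ?g a})
      (?h' ` {a. a |\<in>| elems (val A' \<rho>' r) \<and> ?g' a})"
    by (rule lifts_image[OF r Compr.prems(5) card]) (use step in blast)
  moreover have "lifts c' c ?B (sim c' c ?B) (p\<inverse>) (?h' ` {a. a |\<in>| elems (val A' \<rho>' r) \<and> ?g' a})
      (?h ` {a. a |\<in>| elems (val A \<rho> r) \<and> ?g a})"
  proof (rule s.lifts_image)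
    show "sim c' c (tm_bound r n) (p\<inverse>) (val A' \<rho>' r) (val A \<rho> r)" using r sim_converse by blast
    show "pbij c' c (p\<inverse>)" using Compr.prems(5) by (simp add: pbij_converse)
    show "card (p\<inverse>) + tm_bound r n \<le> ?B" using card by simp
    fix q a a'
    assume *: "p\<inverse> \<subseteq> q" "pbij c' c q" "card q \<le> card (p\<inverse>) + tm_bound r n" "sim c' c (tm_bound r n) q a' a"
      "?g' a'"
    have "sim c c' (tm_bound r n) (q\<inverse>) a a'" using *(4) sim_converse by blast
    moreover have "p \<subseteq> q\<inverse>" "pbij c c' (q\<inverse>)" "card (q\<inverse>) \<le> card p + tm_bound r n"
      using *(1-3) by (auto simp: pbij_converse)
    ultimately have "?g a \<longleftrightarrow> ?g' a'" "sim c c' ?B (q\<inverse>) (?h a) (?h' a')"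
      using step[of "q\<inverse>" a a'] by blast+
    then show "?g a \<and> sim c' c ?B q (?h' a') (?h a)"
      using *(5) sim_converse[of c c' ?B "q\<inverse>"] by simp
  qed
  ultimately show ?case
    unfolding val.simps by (intro sim_HSetI) (simp_all del: tm_bound.simps add: Collect_conj_eq Int_commute)
qed simp

text \<open>The matching update is found over an extension of \<open>p\<close> that is compatible with a prescribed \<open>p0\<close>;
  the freedom to choose \<open>p0\<close> makes it possible to compare it with other updates and with given arguments.\<close>

lemma Den_sim:
  assumes "wf_rule \<Upsilon> R" "rule_bound R n \<le> K" "1 \<le> n" "k \<le> n" "card p \<le> n"
    and "\<And>v. v \<in> fv_rule R \<Longrightarrow> sim c c' n p (\<rho> v) (\<rho>' v)"
    and "(f, xs, b) \<in> Den R A \<rho>" "pbij c c' (p0 \<union> p)" "card p0 \<le> 2 * K"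
  shows "\<exists>q xs' b'. pbij c c' (p0 \<union> q) \<and> card q \<le> K \<and> (f, xs', b') \<in> Den R A' \<rho>' \<and>
    list_all2 (sim c c' K q) xs xs' \<and> sim c c' K q b b'"
  using assms
proof (induction R arbitrary: n p \<rho> \<rho>')
  case (Update f' ss t)
  let ?B = "rule_bound (Update f' ss t) n"
  have p: "pbij c c' p" by (rule pbij_subset[OF Update.prems(8)]) simp
  have pK: "card p \<le> K" using Update.prems(2,5) rule_bound_ge[of n "Update f' ss t"] by linarith
  have val: "sim c c' K p (val A \<rho> s) (val A' \<rho>' s)" if s: "s \<in> set ss \<or> s = t" for s
  proof -
    have le: "tm_bound s n \<le> ?B"
      using member_le_sum_list[of "tm_bound s n" "map (\<lambda>t. tm_bound t n) ss"] s by auto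
    have "sim c c' (tm_bound s n) p (val A \<rho> s) (val A' \<rho>' s)"
      by (rule val_sim) (use Update.prems s le p in auto)
    then show ?thesis by (rule sim_weaken) (use le Update.prems(2) in auto)
  qed
  have eq: "f = f'" "xs = map (val A \<rho>) ss" "b = val A \<rho> t" using Update.prems(7) by auto
  show ?case
    using Update.prems(8) pK val
    by (intro exI[of _ p] exI[of _ "map (val A' \<rho>') ss"] exI[of _ "val A' \<rho>' t"])
      (simp add: eq list_all2_conv_all_nth)
next
  case (Cond g R1 R2)
  have p: "pbij c c' p" by (rule pbij_subset[OF Cond.prems(8)]) simp
  have le: "tm_bound g n \<le> K" "rule_bound R1 n \<le> K" "rule_bound R2 n \<le> K" using Cond.prems(2) by auto
  have "card p \<le> K" using Cond.prems(5) tm_bound_ge[of n g] le by linarith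
  moreover have "sim c c' (tm_bound g n) p (val A \<rho> g) (val A' \<rho>' g)"
    by (rule val_sim) (use Cond.prems le p in auto)
  ultimately have "val A \<rho> g = tt \<longleftrightarrow> val A' \<rho>' g = tt" using tt_iff(1) le(1) p by blast
  then show ?case
    using Cond.IH(1)[of n p \<rho> \<rho>'] Cond.IH(2)[of n p \<rho> \<rho>'] Cond.prems le by (auto split: if_splits)
next
  case (Forall v r R)
  have p: "pbij c c' p" by (rule pbij_subset[OF Forall.prems(8)]) simp
  define m where "m = n + tm_bound r n"
  have le: "rule_bound R m \<le> K" using Forall.prems(2) by (simp add: m_def)
  then have mK: "m \<le> K" using rule_bound_ge[of m R] by linarith
  then have rK: "tm_bound r n \<le> K" "n \<le> K" by (simp_all add: m_def)
  have r: "sim c c' (tm_bound r n) p (val A \<rho> r) (val A' \<rho>' r)"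
    by (rule val_sim) (use Forall.prems rK p in auto)
  obtain a where a: "a |\<in>| elems (val A \<rho> r)" "(f, xs, b) \<in> Den R A (\<rho>(v := a))"
    using Forall.prems(7) by auto
  have "card (p0 \<union> p) + tm_bound r n \<le> 8 * K + 1"
    using card_Un_le[of p0 p] Forall.prems(5,9) rK by linarith
  then obtain s a' where s: "pbij c c' (p0 \<union> p \<union> s)" "card s \<le> tm_bound r n" "a' |\<in>| elems (val A' \<rho>' r)"
      "sim c c' (tm_bound r n) s a a'"
    using sim_elem_extend[OF r Forall.prems(8) _ a(1), of "{}"] by auto
  have env: "sim c c' m (p \<union> s) ((\<rho>(v := a)) u) ((\<rho>'(v := a')) u)" if "u \<in> fv_rule R" for u
  proof (cases "u = v")
    case True
    then show ?thesis using sim_weaken[OF s(4), of "p \<union> s" m] by (simp add: m_def)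
  next
    case False
    then have "sim c c' n p (\<rho> u) (\<rho>' u)" using Forall.prems(6)[of u] that by auto
    then show ?thesis using False sim_weaken[of c c' n p _ _ "p \<union> s" m] by (simp add: m_def)
  qed
  have "\<exists>q xs' b'. pbij c c' (p0 \<union> q) \<and> card q \<le> K \<and> (f, xs', b') \<in> Den R A' (\<rho>'(v := a')) \<and>
      list_all2 (sim c c' K q) xs xs' \<and> sim c c' K q b b'"
  proof (rule Forall.IH[OF _ le _ _ _ env a(2) _ Forall.prems(9)])
    show "card (p \<union> s) \<le> m"
      using card_Un_le[of p s] s(2) Forall.prems(5) by (simp add: m_def)
    show "pbij c c' (p0 \<union> (p \<union> s))" using s(1) by (simp add: Un_assoc)
  qed (use Forall.prems in \<open>auto simp: m_def\<close>)
  then show ?case using s(3) by auto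
qed simp

end

section \<open>Runs in lockstep\<close>

context simulation
begin

text \<open>A closed rule can be evaluated along the empty partial bijection; \<open>max 1 k\<close>
  is the least bound that \<open>interp_sim\<close> admits.\<close>

lemma Den_sim_closed:
  assumes R: "wf_rule \<Upsilon> R" "fv_rule R = {}" "rule_bound R (max 1 k) \<le> K"
    and "(f, xs, b) \<in> Den R A (\<lambda>v. ff)" "pbij c c' p0" "card p0 \<le> 2 * K"
  shows "\<exists>q xs' b'. pbij c c' (p0 \<union> q) \<and> card q \<le> K \<and> (f, xs', b') \<in> Den R A' (\<lambda>v. ff) \<and>
    list_all2 (sim c c' K q) xs xs' \<and> sim c c' K q b b'"
  by (rule Den_sim[OF R(1,3), of "{}"]) (use assms in auto)

text \<open>The match of the second update is sought compatibly with that of the first. Then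
  equality of the two argument lists and inequality of the two values both transfer.\<close>

lemma clash_sim:
  assumes R: "wf_rule \<Upsilon> R" "fv_rule R = {}" "rule_bound R (max 1 k) \<le> K"
    and "clash (Den R A (\<lambda>v. ff))"
  shows "clash (Den R A' (\<lambda>v. ff))"
proof -
  obtain f xs b d where bd: "(f, xs, b) \<in> Den R A (\<lambda>v. ff)" "(f, xs, d) \<in> Den R A (\<lambda>v. ff)" "b \<noteq> d"
    using assms(4) by (auto simp: clash_def)
  obtain q ys b' where q: "pbij c c' q" "card q \<le> K" "(f, ys, b') \<in> Den R A' (\<lambda>v. ff)"
    "list_all2 (sim c c' K q) xs ys" "sim c c' K q b b'"
    using Den_sim_closed[OF R bd(1), of "{}"] by auto
  obtain r zs d' where r: "pbij c c' (q \<union> r)" "card r \<le> K" "(f, zs, d') \<in> Den R A' (\<lambda>v. ff)"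
    "list_all2 (sim c c' K r) xs zs" "sim c c' K r d d'"
    using Den_sim_closed[OF R bd(2) q(1)] q(2) by auto
  have eq: "x = y \<longleftrightarrow> x' = y'" if "sim c c' K q x x'" "sim c c' K r y y'" for x x' y y'
    using related_eq_iff[OF order_refl r(1) _ _ that] q(2) r(2) by simp
  have "ys = zs"
    using q(4) r(4) eq unfolding list_all2_conv_all_nth by (intro nth_equalityI) (simp, metis)
  moreover have "b' \<noteq> d'" using eq[OF q(5) r(5)] bd(3) by simp
  ultimately show ?thesis using q(3) r(3) unfolding clash_def by blast
qed

lemma clash_iff:
  assumes R: "wf_rule \<Upsilon> R" "fv_rule R = {}" "rule_bound R (max 1 k) \<le> K"
  shows "clash (Den R A (\<lambda>v. ff)) \<longleftrightarrow> clash (Den R A' (\<lambda>v. ff))"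
proof -
  interpret s: simulation c' c K Q k A' A by (rule swap_simulation)
  show ?thesis using clash_sim[OF R] s.clash_sim[OF R] by blast
qed

text \<open>With \<open>p\<close> as the prescribed partial bijection, the arguments of the matching
  update are related to \<open>xs\<close> compatibly with \<open>p\<close>, so uniqueness identifies
  them with \<open>xs'\<close>.\<close>

lemma Den_sim_args:
  assumes R: "wf_rule \<Upsilon> R" "fv_rule R = {}" "rule_bound R (max 1 k) \<le> K"
    and p: "pbij c c' p" "card p \<le> K" "list_all2 (sim c c' K p) xs xs'"
    and b: "(f, xs, b) \<in> Den R A (\<lambda>v. ff)"
  shows "\<exists>q b'. pbij c c' (p \<union> q) \<and> card (p \<union> q) \<le> 2 * K \<and> (f, xs', b') \<in> Den R A' (\<lambda>v. ff) \<and>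
     sim c c' K (p \<union> q) b b'"
proof -
  obtain q ys b' where q: "pbij c c' (p \<union> q)" "card q \<le> K" "(f, ys, b') \<in> Den R A' (\<lambda>v. ff)"
    "list_all2 (sim c c' K q) xs ys" "sim c c' K q b b'"
    using Den_sim_closed[OF R b p(1)] p(2) by auto
  have "x' = y'" if "sim c c' K p x x'" "sim c c' K q x y'" for x x' y'
    using related_eq_iff[OF order_refl q(1) _ _ that] q(2) p(2) by simp
  then have "ys = xs'"
    using q(4) p(3) unfolding list_all2_conv_all_nth by (intro nth_equalityI) (simp, metis)
  moreover have "sim c c' K (p \<union> q) b b'" by (rule sim_weaken[OF q(5)]) auto
  moreover have "card (p \<union> q) \<le> 2 * K" using card_Un_le[of p q] p(2) q(2) by linarith
  ultimately show ?thesis using q(1,3) by blast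
qed

text \<open>A new value \<open>b\<close> is at first related to its match only with bound
  \<open>K\<close> and along an extension \<open>p \<union> q\<close>. By equivariance it is fixed
  by every permutation fixing the arguments, hence supported by \<open>Domain p\<close>; with the
  assumption \<open>hs\<close> on its elements, \<open>sim_reduce\<close> restores \<open>k\<close>
  and \<open>p\<close>.\<close>

lemma states_sim_sequel:
  assumes R: "wf_rule \<Upsilon> R" "fv_rule R = {}" "rule_bound R (max 1 k) \<le> K"
    and A: "equivariant c Q A"
    and hs: "\<And>f xs. hsupp c k (dyn (sequel R A) f xs)" "\<And>f xs. hsupp c' k (dyn (sequel R A') f xs)"
  shows "states_sim c c' K k (sequel R A) (sequel R A')"
proof (cases "clash (Den R A (\<lambda>v. ff))")
  case True
  then show ?thesis using clash_iff[OF R] states_sim by (simp add: sequel_clash)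
next
  case False
  then have False': "\<not> clash (Den R A' (\<lambda>v. ff))" using clash_iff[OF R] by simp
  interpret s: simulation c' c K Q k A' A by (rule swap_simulation)
  have "max 1 k \<le> K" using rule_bound_ge[of "max 1 k" R] R(3) by linarith
  then have kK: "k \<le> K" by simp
  show ?thesis
    unfolding states_sim_def
  proof (intro allI impI)
    fix p f xs xs' assume p: "pbij c c' p" "card p \<le> K" "list_all2 (sim c c' K p) xs xs'"
    show "sim c c' k p (dyn (sequel R A) f xs) (dyn (sequel R A') f xs')"
    proof (cases "\<exists>b. (f, xs, b) \<in> Den R A (\<lambda>v. ff)")
      case True
      then obtain b where b: "(f, xs, b) \<in> Den R A (\<lambda>v. ff)" ..
      obtain q b' where q: "pbij c c' (p \<union> q)" "card (p \<union> q) \<le> 2 * K" "(f, xs', b') \<in> Den R A' (\<lambda>v. ff)"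
          "sim c c' K (p \<union> q) b b'"
        using Den_sim_args[OF R p b] by blast
      have dyn: "dyn (sequel R A) f xs = b" "dyn (sequel R A') f xs' = b'"
        using dyn_sequel(1)[OF False b] dyn_sequel(1)[OF False' q(3)] by auto
      have "supports c (Domain p) b"
        unfolding supports_def
      proof (intro allI impI)
        fix \<pi> assume \<pi>: "cperm c \<pi>" "\<forall>a\<in>Domain p. \<pi> a = a"
        have "map_obj \<pi> x = x" if x: "x \<in> set xs" for x
        proof -
          obtain x' where "sim c c' K p x x'"
            using p(3) x by (metis in_set_conv_nth list_all2_nthD)
          then have "supports c (Domain p) x" using sim_supports_Domain[OF order_refl p(1)] p(2) by simp
          then show ?thesis using \<pi> by (simp add: supports_def)
        qed
        then have "map (map_obj \<pi>) xs = xs" by (simp add: map_idI)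
        then show "map_obj \<pi> b = b"
          using equivariant_sequel[OF A R(1)] \<pi>(1) dyn(1) unfolding equivariant_def by metis
      qed
      then have "sim c c' k p b b'"
        using hsupp_elem[OF hs(1)[of f xs]] hsupp_elem[OF hs(2)[of f xs']] dyn
        by (intro sim_reduce[OF kK order_refl q(4,1,2)]) auto
      then show ?thesis using dyn by simp
    next
      case none: False
      have "(f, xs', b') \<notin> Den R A' (\<lambda>v. ff)" for b'
      proof
        assume b': "(f, xs', b') \<in> Den R A' (\<lambda>v. ff)"
        have "pbij c' c (p\<inverse>)" "card (p\<inverse>) \<le> K" "list_all2 (sim c' c K (p\<inverse>)) xs' xs"
          using p list_all2_sim_converse[of c c' K p xs xs'] by (simp_all add: pbij_converse)
        from s.Den_sim_args[OF R this b'] none show False by blast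
      qed
      then have "dyn (sequel R A') f xs' = dyn A' f xs'" using dyn_sequel(2)[OF False'] by blast
      moreover have "dyn (sequel R A) f xs = dyn A f xs" using dyn_sequel(2)[OF False] none by blast
      ultimately show ?thesis using states_sim p unfolding states_sim_def by simp
    qed
  qed
qed

end

lemma run_states_sim:
  assumes bf: "back_and_forth c c' K" and size: "card (dom c) = card (dom c')"
    and R: "wf_rule \<Upsilon> R" "fv_rule R = {}" "rule_bound R (max 1 k) \<le> K"
    and hs: "\<And>i f xs. i \<le> l \<Longrightarrow> hsupp c k (dyn (run_state R (coloured_structure c Q) i) f xs)"
      "\<And>i f xs. i \<le> l \<Longrightarrow> hsupp c' k (dyn (run_state R (coloured_structure c' Q) i) f xs)"
    and "i \<le> l"
  shows "states_sim c c' K k (run_state R (coloured_structure c Q) i) (run_state R (coloured_structure c' Q) i)"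
  using \<open>i \<le> l\<close>
proof (induction i)
  case 0
  show ?case by (simp add: states_sim_def run_state_def initial_state_def sim_ff)
next
  case (Suc i)
  let ?A = "run_state R (coloured_structure c Q) i" and ?A' = "run_state R (coloured_structure c' Q) i"
  have fin: "finite (dom c)" "finite (dom c')"
    using bf by (auto simp: back_and_forth_def ample_def)
  have eqv: "equivariant c Q ?A" "equivariant c' Q ?A'"
    by (rule equivariant_run_state[OF fin(1) R(1)], rule equivariant_run_state[OF fin(2) R(1)])
  interpret simulation c c' K Q k ?A ?A' \<Upsilon>
  proof (intro simulation.intro simulation_axioms.intro bf size)
    show "structure_of ?A = coloured_structure c Q" "structure_of ?A' = coloured_structure c' Q"
      using eqv by (simp_all add: equivariant_def)
    show "states_sim c c' K k ?A ?A'" using Suc by simp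
  qed
  show ?case
    using states_sim_sequel[OF R eqv(1)] hs[OF Suc.prems] by (simp add: run_state_def)
qed

text \<open>\<open>small_support\<close> is applied to the set of all objects active up to time
  \<open>l\<close>. That set contains \<open>TC x\<close> for each of its members \<open>x\<close>,
  so the supports obtained are hereditary.\<close>

lemma active_hsupp:
  fixes c :: "('a, 'v::finite) colouring"
  assumes fin: "finite (dom c)" and wf: "wf_rule \<Upsilon> (prog P)" and k: "1 \<le> k"
    and wb: "within_bounds P (coloured_structure c Q) l"
    and t: "poly (space_bound P) (int (card (dom c))) < 2 ^ t" and M: "t * (CARD('v) * k + 2) \<le> M"
    and large: "\<And>v. 2 * M < card (colour_class c v)"
      "\<And>v e. k < e \<Longrightarrow> e \<le> M \<Longrightarrow> poly (space_bound P) (int (card (dom c))) < int (card (colour_class c v) choose e)"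
    and "i \<le> l"
  shows "hsupp c (CARD('v) * k) (dyn (run_state (prog P) (coloured_structure c Q) i) f xs)"
proof -
  let ?A = "\<lambda>i. run_state (prog P) (coloured_structure c Q) i"
  define act where "act = (\<Union>i\<le>l. active (?A i))"
  have "fcard (universe (coloured_structure c Q)) = card (dom c)"
    using fin by (simp add: fcard.rep_eq coloured_structure_simps)
  then have act: "finite act" "int (card act) \<le> poly (space_bound P) (int (card (dom c)))"
    using wb by (simp_all add: within_bounds_def act_def Let_def)
  have eqv: "equivariant c Q (?A i)" for i
    by (rule equivariant_run_state[OF fin wf])
  have elem: "y \<in> act" if "x \<in> act" "y |\<in>| elems x" for x y
    using that active_elem unfolding act_def by blast
  have supp: "\<exists>S. finite S \<and> S \<subseteq> dom c \<and> card S \<le> CARD('v) * k \<and> supports c S x" if "x \<in> act" for x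
  proof (rule small_support[OF fin act(1) k _ elem _ M large(1) _ that])
    show "map_obj \<pi> x \<in> act" if "x \<in> act" "cperm c \<pi>" for x \<pi>
      using that active_map_obj[OF eqv] unfolding act_def by blast
    have "int (card act) < 2 ^ t" using act(2) t by linarith
    then show "card act < 2 ^ t" by (metis of_nat_less_iff of_nat_numeral of_nat_power)
    show "card act < card (colour_class c v) choose e" if "k < e" "e \<le> M" for v e
      using act(2) large(2)[OF that, of v] by linarith
  qed
  have "dyn (?A i) f xs \<in> act" using active_dyn \<open>i \<le> l\<close> unfolding act_def by blast
  moreover have "y \<in> act" if "y \<in> TC x" "x \<in> act" for x y
    using that by (induction rule: TC.induct) (auto intro: elem)
  ultimately show ?thesis using supp unfolding hsupp_def by meson
qed

text \<open>\<open>Halt\<close> and \<open>Output\<close> are read without arguments, so their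
  values are related along the empty partial bijection and agree on being \<open>tt\<close>. The
  states are compared up to \<open>min l l'\<close> only, since supports are controlled only within
  the bounded runs; the earlier halt then forces the other.\<close>

lemma no_separation:
  fixes c c' :: "('a, 'v::finite) colouring"
  assumes R: "wf_rule \<Upsilon> (prog P)" "fv_rule (prog P) = {}"
    and bf: "back_and_forth c c' K" and size: "card (dom c) = n" "card (dom c') = n"
    and k: "1 \<le> k" and K: "rule_bound (prog P) (max 1 (CARD('v) * k)) \<le> K"
    and t: "poly (space_bound P) (int n) < 2 ^ t" and M: "t * (CARD('v) * k + 2) \<le> M"
    and large: "\<And>v. 2 * M < card (colour_class c v)" "\<And>v. 2 * M < card (colour_class c' v)"
      "\<And>v e. k < e \<Longrightarrow> e \<le> M \<Longrightarrow> poly (space_bound P) (int n) < int (card (colour_class c v) choose e)"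
      "\<And>v e. k < e \<Longrightarrow> e \<le> M \<Longrightarrow> poly (space_bound P) (int n) < int (card (colour_class c' v) choose e)"
    and acc: "accepts P (coloured_structure c Q)" and rej: "rejects P (coloured_structure c' Q)"
  shows False
proof -
  let ?A = "\<lambda>i. run_state (prog P) (coloured_structure c Q) i"
  let ?A' = "\<lambda>i. run_state (prog P) (coloured_structure c' Q) i"
  let ?k = "CARD('v) * k"
  have fin: "finite (dom c)" "finite (dom c')"
    using bf by (auto simp: back_and_forth_def ample_def)
  obtain l where l: "final_index P (coloured_structure c Q) l" "halted (?A l)" "dyn (?A l) Output [] = tt"
    using acc by (auto simp: accepts_def)
  obtain l' where l': "final_index P (coloured_structure c' Q) l'" "halted (?A' l')" "dyn (?A' l') Output [] = ff"
    using rej by (auto simp: rejects_def)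
  have hs: "hsupp c ?k (dyn (?A i) f xs)" if "i \<le> l" for i f xs
    using l(1) active_hsupp[OF fin(1) R(1) k _ _ M large(1) _ that] t large(3) size(1)
    by (simp add: final_index_def)
  have hs': "hsupp c' ?k (dyn (?A' i) f xs)" if "i \<le> l'" for i f xs
    using l'(1) active_hsupp[OF fin(2) R(1) k _ _ M large(2) _ that] t large(4) size(2)
    by (simp add: final_index_def)
  have sim: "sim c c' ?k {} (dyn (?A i) f []) (dyn (?A' i) f [])" if "i \<le> min l l'" for i f
  proof -
    have "states_sim c c' K ?k (?A i) (?A' i)"
      by (rule run_states_sim[OF bf _ R K _ _ that]) (use hs hs' size in auto)
    then show ?thesis by (simp add: states_sim_def)
  qed
  interpret back_and_forth c c' K by (rule bf)
  have kK: "?k \<le> K" using K rule_bound_ge[of "max 1 ?k" "prog P"] by linarith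
  have tt: "x = tt \<longleftrightarrow> x' = tt" if "sim c c' ?k {} x x'" for x x'
    using related_eq_iff[OF kK _ _ _ that sim_tt, of "{}"] by simp
  have "l = l'"
  proof (rule linorder_cases)
    assume "l < l'"
    then have "halted (?A' l)" using l(2) tt[OF sim, of l] by (simp add: halted_def)
    then show ?thesis using l'(1) \<open>l < l'\<close> by (auto simp: final_index_def in_run_def)
  next
    assume "l' < l"
    then have "halted (?A l')" using l'(2) tt[OF sim, of l'] by (simp add: halted_def)
    then show ?thesis using l(1) \<open>l' < l\<close> by (auto simp: final_index_def in_run_def)
  qed
  then have "(ff :: 'a obj) = tt" using tt[OF sim, of l] l(3) l'(3) by simp
  then show False by (simp add: ff_def tt_def) (metis finsert_not_fempty)
qed

section \<open>Unions of two complete bipartite graphs\<close>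

lemma colouring_exists:
  fixes w :: "'v::{finite,countable} \<Rightarrow> nat"
  assumes "infinite (UNIV :: 'a set)"
  shows "\<exists>c :: ('a, 'v) colouring. finite (dom c) \<and> (\<forall>v. card (colour_class c v) = w v)"
proof -
  obtain h :: "nat \<Rightarrow> 'a" where h: "inj h"
    using infinite_countable_subset[OF assms] by blast
  define H where "H = h \<circ> (to_nat :: 'v \<times> nat \<Rightarrow> nat)"
  have H: "inj H" unfolding H_def using h by (intro inj_compose) auto
  define c where "c a = (if \<exists>v i. a = H (v, i) \<and> i < w v then Some (fst (inv H a)) else None)" for a
  have cls: "colour_class c v = (\<lambda>i. H (v, i)) ` {..<w v}" for v
    unfolding colour_class_def c_def using H by (auto simp: inv_f_f inj_eq)
  have inj: "inj_on (\<lambda>i. H (v, i)) {..<w v}" for v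
    using H by (auto simp: inj_on_def)
  have "finite (colour_class c v)" "card (colour_class c v) = w v" for v
    unfolding cls card_image[OF inj] by simp_all
  moreover have "dom c = (\<Union>v. colour_class c v)" by (auto simp: colour_class_def)
  ultimately have "finite (dom c)" "\<forall>v. card (colour_class c v) = w v" by simp_all
  then show ?thesis by blast
qed

lemma card_dom_colouring:
  fixes c :: "('a, 'v::finite) colouring"
  assumes "finite (dom c)"
  shows "card (dom c) = (\<Sum>v\<in>UNIV. card (colour_class c v))"
proof -
  have "dom c = (\<Union>v. colour_class c v)" by (auto simp: colour_class_def)
  moreover have "finite (colour_class c v)" for v
    by (rule finite_subset[OF _ assms]) (auto simp: colour_class_def)
  ultimately show ?thesis
    by (simp only:) (rule card_UN_disjoint, auto simp: colour_class_def)
qed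

text \<open>Colour \<open>(g, s)\<close>: the vertex is a girl iff \<open>g\<close>, and it lies in the component \<open>s\<close>.\<close>

fun two_components :: "gname \<Rightarrow> (bool \<times> bool) option list \<Rightarrow> bool" where
  "two_components Boy [Some (g, s)] \<longleftrightarrow> \<not> g"
| "two_components Girl [Some (g, s)] \<longleftrightarrow> g"
| "two_components Edge [Some (g, s), Some (g', s')] \<longleftrightarrow> g \<noteq> g' \<and> s = s'"
| "two_components _ _ \<longleftrightarrow> False"

lemma two_components_arity: "two_components P vs \<Longrightarrow> graph_arity P = Some (length vs)"
  by (induction P vs rule: two_components.induct) auto

abbreviation graph_of :: "('a, bool \<times> bool) colouring \<Rightarrow> (gname, 'a) fin_structure" where
  "graph_of c \<equiv> coloured_structure c two_components"

lemma two_components_iff: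
  "two_components Boy [x] \<longleftrightarrow> (\<exists>s. x = Some (False, s))"
  "two_components Girl [x] \<longleftrightarrow> (\<exists>s. x = Some (True, s))"
  "two_components Edge [x, y] \<longleftrightarrow> (\<exists>g g' s. x = Some (g, s) \<and> y = Some (g', s) \<and> g \<noteq> g')"
proof -
  show "two_components Boy [x] \<longleftrightarrow> (\<exists>s. x = Some (False, s))"
    and "two_components Girl [x] \<longleftrightarrow> (\<exists>s. x = Some (True, s))"
    by (cases x; fastforce)+
  show "two_components Edge [x, y] \<longleftrightarrow> (\<exists>g g' s. x = Some (g, s) \<and> y = Some (g', s) \<and> g \<noteq> g')"
  proof (cases "x = None \<or> y = None")
    case True
    then show ?thesis by (cases x) auto
  next
    case False
    then obtain g s g' s' where "x = Some (g, s)" "y = Some (g', s')" by auto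
    then show ?thesis by auto
  qed
qed

lemma rel_graph_of:
  "[v] \<in> rel (graph_of c) Boy \<longleftrightarrow> (\<exists>s. c v = Some (False, s))"
  "[v] \<in> rel (graph_of c) Girl \<longleftrightarrow> (\<exists>s. c v = Some (True, s))"
  "[u, v] \<in> rel (graph_of c) Edge \<longleftrightarrow> (\<exists>g g' s. c u = Some (g, s) \<and> c v = Some (g', s) \<and> g \<noteq> g')"
  by (auto simp: coloured_structure_simps two_components_iff)

section \<open>Perfect matchings in the two kinds of instances\<close>

lemma boys_graph_of: "boys (graph_of c) = (\<Union>s. colour_class c (False, s))"
  and girls_graph_of: "girls (graph_of c) = (\<Union>s. colour_class c (True, s))"
  by (auto simp: boys_def girls_def rel_graph_of colour_class_def)

lemma matching_instance_graph_of:
  assumes fin: "finite (dom c)"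
    and card: "(\<Sum>s\<in>UNIV. card (colour_class c (False, s))) = (\<Sum>s\<in>UNIV. card (colour_class c (True, s)))"
  shows "matching_instance (graph_of c)"
proof -
  have "finite (colour_class c v)" for v
    by (rule finite_subset[OF _ fin]) (auto simp: colour_class_def)
  then have "card (\<Union>s. colour_class c (g, s)) = (\<Sum>s\<in>UNIV. card (colour_class c (g, s)))" for g
    by (intro card_UN_disjoint) (auto simp: colour_class_def)
  then have "card (boys (graph_of c)) = card (girls (graph_of c))"
    using card by (simp only: boys_graph_of girls_graph_of)
  moreover have "is_structure graph_arity (graph_of c)"
    using two_components_arity by (fastforce simp: is_structure_def coloured_structure_simps fin)
  moreover have "boys (graph_of c) \<union> girls (graph_of c) = fset (universe (graph_of c))"
    by (auto simp: boys_graph_of girls_graph_of coloured_structure_simps fin colour_class_def)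
  moreover have "boys (graph_of c) \<inter> girls (graph_of c) = {}"
    by (auto simp: boys_graph_of girls_graph_of colour_class_def)
  moreover have "u \<in> boys (graph_of c) \<longleftrightarrow> v \<in> girls (graph_of c)" "[v, u] \<in> rel (graph_of c) Edge"
    if "[u, v] \<in> rel (graph_of c) Edge" for u v
    using that by (auto simp: rel_graph_of boys_def girls_def)
  ultimately show ?thesis unfolding matching_instance_def by blast
qed

lemma perfect_matching_graph_of:
  assumes fin: "finite (dom c)"
    and card: "\<And>s. card (colour_class c (False, s)) = card (colour_class c (True, s))"
  shows "has_perfect_matching (graph_of c)"
proof -
  have fc: "finite (colour_class c v)" for v
    by (rule finite_subset[OF _ fin]) (auto simp: colour_class_def)
  have "\<forall>s. \<exists>h. bij_betw h (colour_class c (False, s)) (colour_class c (True, s))"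
    using finite_same_card_bij[OF fc fc card] by blast
  then obtain h where h: "\<And>s. bij_betw (h s) (colour_class c (False, s)) (colour_class c (True, s))"
    by metis
  define F where "F = {{a, h s a} | a s. c a = Some (False, s)}"
  have hc: "c (h s a) = Some (True, s)" if "c a = Some (False, s)" for a s
    using bij_betwE[OF h[of s]] that by (auto simp: colour_class_def)
  have inj: "a = b" if "c a = Some (False, s)" "c b = Some (False, s)" "h s a = h s b" for a b s
    using h[of s] that by (auto simp: bij_betw_def inj_on_def colour_class_def)
  have "F \<subseteq> edges (graph_of c)"
  proof
    fix e assume "e \<in> F"
    then obtain a s where as: "e = {a, h s a}" "c a = Some (False, s)" by (auto simp: F_def)
    then have "[a, h s a] \<in> rel (graph_of c) Edge" unfolding rel_graph_of using as(2) hc[OF as(2)] by blast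
    then show "e \<in> edges (graph_of c)" using as(1) unfolding edges_def by blast
  qed
  moreover have "\<exists>!e. e \<in> F \<and> v \<in> e" if "v \<in> fset (universe (graph_of c))" for v
  proof -
    have "v \<in> dom c" using that by (simp add: coloured_structure_simps fin)
    then obtain g s where v: "c v = Some (g, s)" by auto
    show ?thesis
    proof (cases g)
      case False
      have "{v, h s v} \<in> F" using v False by (auto simp: F_def)
      moreover have "e = {v, h s v}" if "e \<in> F" "v \<in> e" for e
        using that v False hc by (fastforce simp: F_def)
      ultimately show ?thesis by blast
    next
      case True
      then have "v \<in> colour_class c (True, s)" using v by (simp add: colour_class_def)
      then obtain a where a: "c a = Some (False, s)" "v = h s a"
        using h[of s] by (auto simp: bij_betw_def colour_class_def)
      then have "{a, v} \<in> F" by (auto simp: F_def)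
      moreover have "e = {a, v}" if e: "e \<in> F" "v \<in> e" for e
      proof -
        obtain b s' where b: "e = {b, h s' b}" "c b = Some (False, s')" using e(1) by (auto simp: F_def)
        then have "v = h s' b" using e(2) v True by auto
        then have "s' = s" using hc[OF b(2)] v by simp
        then have "b = a" using inj[OF b(2)] a \<open>v = h s' b\<close> by auto
        then show ?thesis using b(1) \<open>v = h s' b\<close> by simp
      qed
      ultimately show ?thesis by blast
    qed
  qed
  ultimately show ?thesis unfolding has_perfect_matching_def by (intro exI[of _ F] conjI ballI)
qed

text \<open>The mate of a boy in component \<open>s\<close> is a girl of the same component, and
  boys have distinct mates because a girl lies on only one edge of \<open>F\<close>. More boys than
  girls in one component is therefore fatal.\<close>

lemma no_perfect_matching_graph_of:
  assumes fin: "finite (dom c)"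
    and card: "card (colour_class c (True, s)) < card (colour_class c (False, s))"
  shows "\<not> has_perfect_matching (graph_of c)"
proof
  assume "has_perfect_matching (graph_of c)"
  then obtain F where F: "F \<subseteq> edges (graph_of c)" "\<And>v. v \<in> dom c \<Longrightarrow> \<exists>!e. e \<in> F \<and> v \<in> e"
    by (auto simp: has_perfect_matching_def coloured_structure_simps fin)
  have "\<exists>b. {a, b} \<in> F \<and> c b = Some (True, s)" if "c a = Some (False, s)" for a
  proof -
    have "a \<in> dom c" using that by auto
    then obtain e where e: "e \<in> F" "a \<in> e" using F(2) by blast
    then obtain u v where uv: "e = {u, v}" "[u, v] \<in> rel (graph_of c) Edge"
      using F(1) by (auto simp: edges_def)
    then obtain g g' s' where "c u = Some (g, s')" "c v = Some (g', s')" "g \<noteq> g'" by (auto simp: rel_graph_of)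
    with e uv(1) that consider "a = u" "c v = Some (True, s)" | "a = v" "c u = Some (True, s)" by auto
    then show ?thesis using e(1) uv(1) by cases (auto simp: insert_commute)
  qed
  then obtain h where h: "\<And>a. c a = Some (False, s) \<Longrightarrow> {a, h a} \<in> F \<and> c (h a) = Some (True, s)"
    by metis
  have "inj_on h (colour_class c (False, s))"
  proof (rule inj_onI)
    fix a b assume ab: "a \<in> colour_class c (False, s)" "b \<in> colour_class c (False, s)" "h a = h b"
    then have c: "c a = Some (False, s)" "c b = Some (False, s)" by (auto simp: colour_class_def)
    have "h a \<in> dom c" using h[OF c(1)] by auto
    then have "{a, h a} = {b, h a}" using F(2)[of "h a"] h[OF c(1)] h[OF c(2)] ab(3) by auto
    then show "a = b" by (auto simp: doubleton_eq_iff)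
  qed
  moreover have "h ` colour_class c (False, s) \<subseteq> colour_class c (True, s)"
    using h by (auto simp: colour_class_def)
  moreover have "finite (colour_class c (True, s))"
    by (rule finite_subset[OF _ fin]) (auto simp: colour_class_def)
  ultimately show False using card card_inj_on_le leD by blast
qed

section \<open>Choice of the parameters\<close>

text \<open>One extra power of \<open>n\<close> absorbs the sum of the absolute values of the
  coefficients. It also ensures \<open>d \<ge> 1\<close>, wanted because \<open>d\<close> becomes
  the bound on exceptional atoms per colour.\<close>

lemma poly_le_power:
  fixes q :: "int poly"
  shows "\<exists>d\<ge>1. \<forall>\<^sub>F n in sequentially. poly q (int n) \<le> int n ^ d"
proof -
  define C where "C = (\<Sum>i\<le>degree q. \<bar>coeff q i\<bar>)"
  have "poly q (int n) \<le> int n ^ (degree q + 1)" if n: "n \<ge> nat C + 1" for n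
  proof -
    have "poly q (int n) = (\<Sum>i\<le>degree q. coeff q i * int n ^ i)" by (rule poly_altdef)
    also have "\<dots> \<le> (\<Sum>i\<le>degree q. \<bar>coeff q i\<bar> * int n ^ degree q)"
      using n by (intro sum_mono mult_mono power_increasing) auto
    also have "\<dots> = C * int n ^ degree q" by (simp add: C_def sum_distrib_right)
    also have "\<dots> \<le> int n * int n ^ degree q" using n by (intro mult_right_mono) auto
    finally show ?thesis by simp
  qed
  then have "\<forall>\<^sub>F n in sequentially. poly q (int n) \<le> int n ^ (degree q + 1)"
    unfolding eventually_sequentially by blast
  then show ?thesis by (intro exI[of _ "degree q + 1"]) simp
qed

text \<open>From \<open>(u / e) ^ e \<le> u choose e\<close>, replacing \<open>e\<close> by
  \<open>M\<close> in the base and then by \<open>Suc d\<close> in the exponent, where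
  \<open>M \<le> u\<close> is used. One inequality thus serves every \<open>e\<close> from
  \<open>Suc d\<close> to \<open>M\<close>.\<close>

lemma choose_gt:
  fixes u e M d L :: nat
  assumes "d < e" "e \<le> M" "M \<le> u" "M ^ Suc d * L < u ^ Suc d"
  shows "L < u choose e"
proof -
  have M: "0 < real M" "0 < real e" using assms(1,2) by auto
  have "real M ^ Suc d * real L < real u ^ Suc d"
    using assms(4) by (metis of_nat_less_iff of_nat_mult of_nat_power)
  then have "real L < real u ^ Suc d / real M ^ Suc d"
    using M by (simp add: field_simps del: power_Suc)
  also have "\<dots> = (real u / real M) ^ Suc d" by (rule power_divide[symmetric])
  also have "\<dots> \<le> (real u / real M) ^ e" using assms M by (intro power_increasing) auto
  also have "\<dots> \<le> (real u / real e) ^ e"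
    using assms M by (intro power_mono divide_left_mono) auto
  also have "\<dots> \<le> real (u choose e)"
    using assms by (intro binomial_ge_n_over_k_pow_k) auto
  finally show ?thesis by simp
qed

text \<open>In the application \<open>2 ^ s - 1\<close> is the smallest class size,
  \<open>4 * 2 ^ s\<close> the number of vertices and \<open>t s * a\<close> the bound
  \<open>M\<close>. As \<open>M\<close> is linear in \<open>s\<close>, the last inequality, divided
  by \<open>(2 ^ s) ^ d\<close>, compares a polynomial in \<open>s\<close> with
  \<open>2 ^ s\<close>.\<close>

lemma eventually_parameters:
  fixes d a K :: nat
  assumes "1 \<le> d"
  defines "t \<equiv> \<lambda>s. d * (s + 2) + 1"
  shows "\<forall>\<^sub>F s in sequentially. 8 * K + 1 \<le> 2 ^ s - 1 \<and> 2 * (t s * a) < 2 ^ s - (1::nat) \<and>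
     (t s * a) ^ Suc d * (4 * 2 ^ s) ^ d < (2 ^ s - 1) ^ Suc d"
proof -
  have 1: "\<forall>\<^sub>F s in sequentially. 8 * real K + 1 \<le> 2 ^ s - 1"
    by real_asymp
  have 2: "\<forall>\<^sub>F s in sequentially. 2 * ((real d * (real s + 2) + 1) * real a) < 2 ^ s - 1"
    by real_asymp
  \<comment> \<open>For \<open>s \<ge> 1\<close> the bound \<open>M\<close> is at most
    \<open>s * ((3 * d + 1) * a)\<close>. The factor \<open>16 ^ Suc d\<close> will dominate
    \<open>2 * 8 ^ d\<close>, which arises from \<open>(4 * 2 ^ s) ^ d\<close> and from estimating
    \<open>2 ^ s - 1\<close> by \<open>2 ^ s / 2\<close>. Dividing by \<open>D + 1\<close> avoids
    division by zero.\<close>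
  define D where "D = (16 * ((3 * real d + 1) * real a)) ^ Suc d"
  have "0 < 1 / (D + 1)" unfolding D_def by (intro divide_pos_pos add_nonneg_pos) auto
  moreover have "(\<lambda>s. real s ^ Suc d / 2 ^ s) \<longlonglongrightarrow> 0"
    by real_asymp
  ultimately have "\<forall>\<^sub>F s in sequentially. real s ^ Suc d / 2 ^ s < 1 / (D + 1)"
    by (rule order_tendstoD(2)[rotated])
  then have 3: "\<forall>\<^sub>F s in sequentially. ((real d * (real s + 2) + 1) * real a) ^ Suc d * 16 ^ Suc d < 2 ^ s"
    using eventually_gt_at_top[of 0]
  proof eventually_elim
    case (elim s)
    have D: "0 \<le> D" unfolding D_def by simp
    have "real d * (real s + 2) + 1 \<le> real s * (3 * real d + 1)"
      using elim(2) mult_left_mono[of 1 "real s" "real d"] by (simp add: algebra_simps)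
    then have "(real d * (real s + 2) + 1) * real a \<le> real s * ((3 * real d + 1) * real a)"
      by (metis mult.assoc mult_right_mono of_nat_0_le_iff)
    then have "((real d * (real s + 2) + 1) * real a) ^ Suc d \<le> (real s * ((3 * real d + 1) * real a)) ^ Suc d"
      by (intro power_mono) auto
    then have "((real d * (real s + 2) + 1) * real a) ^ Suc d * 16 ^ Suc d
        \<le> (real s * ((3 * real d + 1) * real a)) ^ Suc d * 16 ^ Suc d"
      by (intro mult_right_mono) auto
    also have "\<dots> = real s ^ Suc d * D" unfolding D_def power_mult_distrib by (simp only: ac_simps)
    also have "\<dots> \<le> real s ^ Suc d * (D + 1)" by (intro mult_left_mono) auto
    also have "\<dots> < 2 ^ s" using elim(1) D by (simp add: field_simps)
    finally show ?case .
  qed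
  show ?thesis
    using 1 2 3
  proof eventually_elim
    case (elim s)
    have s: "1 \<le> (2::nat) ^ s" by simp
    have r: "real (2 ^ s - 1) = 2 ^ s - 1" using s by (simp add: of_nat_diff)
    have t: "real (t s * a) = (real d * (real s + 2) + 1) * real a" by (simp add: t_def algebra_simps)
    have "real (8 * K + 1) \<le> real (2 ^ s - 1)" using elim(1) r by simp
    moreover have "real (2 * (t s * a)) < real (2 ^ s - 1)"
      using elim(2) by (simp only: r of_nat_mult[of 2 "t s * a"] t of_nat_numeral)
    moreover have "real ((t s * a) ^ Suc d * (4 * 2 ^ s) ^ d) < real ((2 ^ s - 1) ^ Suc d)"
    proof -
      have "2 ^ s \<ge> (2::real)" using elim(1) by linarith
      then have "(2 ^ s / 2) ^ Suc d \<le> real (2 ^ s - 1) ^ Suc d"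
        unfolding r by (intro power_mono) auto
      moreover have "real ((t s * a) ^ Suc d * (4 * 2 ^ s) ^ d) < (2 ^ s / 2) ^ Suc d"
      proof -
        have "(4::real) ^ d * 2 ^ d = 8 ^ d" by (simp flip: power_mult_distrib)
        then have "T * (4 * X) ^ d * 2 ^ Suc d = T * (2 * 8 ^ d) * X ^ d" for T X :: real
          by (simp add: power_mult_distrib)
        then have "real ((t s * a) ^ Suc d * (4 * 2 ^ s) ^ d) * 2 ^ Suc d =
            real (t s * a) ^ Suc d * (2 * 8 ^ d) * (2 ^ s) ^ d"
          by (simp only: of_nat_mult of_nat_power of_nat_numeral)
        also have "\<dots> \<le> real (t s * a) ^ Suc d * 16 ^ Suc d * (2 ^ s) ^ d"
        proof -
          have "(8::real) ^ d \<le> 16 ^ d" by (intro power_mono) auto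
          moreover have "0 \<le> (16::real) ^ d" by simp
          ultimately have "2 * (8::real) ^ d \<le> 16 ^ Suc d" unfolding power_Suc by linarith
          then show ?thesis by (intro mult_right_mono mult_left_mono) auto
        qed
        also have "\<dots> < 2 ^ s * (2 ^ s) ^ d"
          unfolding t using elim(3) by (intro mult_strict_right_mono) auto
        finally have "real ((t s * a) ^ Suc d * (4 * 2 ^ s) ^ d) * 2 ^ Suc d < (2 ^ s) ^ Suc d"
          by (simp only: power_Suc)
        then show ?thesis by (simp only: power_divide pos_less_divide_eq zero_less_power zero_less_numeral)
      qed
      ultimately show ?thesis by simp
    qed
    ultimately show ?case by (simp only: of_nat_less_iff of_nat_le_iff)
  qed
qed

theorem corollary8:
  shows "(matching_yes :: (gname, 'a::infinite) fin_structure set, matching_no) \<notin> CPTime_plus graph_arity"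
proof
  assume "(matching_yes :: (gname, 'a) fin_structure set, matching_no) \<in> CPTime_plus graph_arity"
  then obtain P where P: "is_ptime_program P" "\<forall>I\<in>matching_yes. accepts P (I :: (gname, 'a) fin_structure)"
      "\<forall>I\<in>matching_no. rejects P (I :: (gname, 'a) fin_structure)"
    by (auto simp: CPTime_plus_def)
  have R: "wf_rule (vocab P) (prog P)" "fv_rule (prog P) = {}"
    using P(1) by (auto simp: is_ptime_program_def is_program_def)
  obtain d where d: "1 \<le> d" "\<forall>\<^sub>F n in sequentially. poly (space_bound P) (int n) \<le> int n ^ d"
    using poly_le_power by blast
  \<comment> \<open>\<open>K\<close> and \<open>a\<close> depend on the program only, so the
    instances can be chosen afterwards and large enough. \<open>a\<close> is the number of atoms
    spent per transposition in \<open>many_images\<close> with supports of size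
    \<open>4 * d\<close>.\<close>
  define K where "K = rule_bound (prog P) (max 1 (CARD(bool \<times> bool) * d))"
  define a where "a = CARD(bool \<times> bool) * d + 2"
  have "filterlim (\<lambda>s::nat. 4 * 2 ^ s :: nat) sequentially sequentially"
    by (rule filterlim_subseq) (auto intro!: strict_monoI)
  then have "\<forall>\<^sub>F s in sequentially. poly (space_bound P) (int (4 * 2 ^ s)) \<le> int (4 * 2 ^ s) ^ d"
    by (rule eventually_compose_filterlim[OF d(2)])
  from eventually_happens'[OF sequentially_bot eventually_conj[OF this eventually_parameters[OF d(1), of K a]]]
  obtain s where s: "poly (space_bound P) (int (4 * 2 ^ s)) \<le> int (4 * 2 ^ s) ^ d"
      "8 * K + 1 \<le> 2 ^ s - 1" "2 * ((d * (s + 2) + 1) * a) < 2 ^ s - (1::nat)"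
      "((d * (s + 2) + 1) * a) ^ Suc d * (4 * 2 ^ s) ^ d < (2 ^ s - 1) ^ Suc d"
    by blast
  \<comment> \<open>With a power of two, the number \<open>4 * m\<close> of vertices is
    \<open>2 ^ (s + 2)\<close>, and \<open>t\<close>, one more than the exponent of
    \<open>(4 * m) ^ d\<close>, is an exact logarithmic bound.\<close>
  define m :: nat where "m = 2 ^ s"
  define t where "t = d * (s + 2) + 1"
  have m: "2 \<le> m" using s(2) unfolding m_def by linarith
  have poly: "poly (space_bound P) (int (4 * m)) \<le> int ((4 * m) ^ d)"
    using s(1) by (simp add: m_def)
  have "(4 * m) ^ d < 2 ^ t"
  proof -
    have "4 * m = 2 ^ (s + 2)" by (simp add: m_def)
    then have "(4 * m) ^ d = 2 ^ ((s + 2) * d)" by (simp only: power_mult)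
    also have "\<dots> < 2 ^ t" unfolding t_def by (intro power_strict_increasing) auto
    finally show ?thesis .
  qed
  then have t: "poly (space_bound P) (int (4 * m)) < 2 ^ t"
    using poly by (metis (mono_tags, lifting) le_less_trans of_nat_less_iff of_nat_numeral of_nat_power)
  \<comment> \<open>Stated for all \<open>u \<ge> m - 1\<close>, so that the class sizes
    \<open>m - 1\<close>, \<open>m\<close> and \<open>m + 1\<close> are covered at once.\<close>
  have u: "8 * K + 1 \<le> u" "2 * (t * a) < u"
    "\<And>e. d < e \<Longrightarrow> e \<le> t * a \<Longrightarrow> poly (space_bound P) (int (4 * m)) < int (u choose e)"
    if u: "m - 1 \<le> u" for u
  proof -
    show "8 * K + 1 \<le> u" "2 * (t * a) < u" using s(2,3) u by (simp_all add: m_def t_def)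
    show "poly (space_bound P) (int (4 * m)) < int (u choose e)" if e: "d < e" "e \<le> t * a" for e
    proof -
      have "(t * a) ^ Suc d * (4 * m) ^ d < (m - 1) ^ Suc d" using s(4) by (simp only: m_def t_def)
      also have "\<dots> \<le> u ^ Suc d" using u by (rule power_mono) simp
      finally have "(4 * m) ^ d < u choose e"
        using \<open>2 * (t * a) < u\<close> by (intro choose_gt[OF e]) auto
      then show ?thesis using poly by linarith
    qed
  qed
  have inf: "infinite (UNIV :: 'a set)" by (rule infinite_UNIV)
  obtain c :: "('a, bool \<times> bool) colouring" where c: "finite (dom c)" "\<And>v. card (colour_class c v) = m"
    using colouring_exists[OF inf, of "\<lambda>v. m"] by blast
  \<comment> \<open>Moving one boy from component \<open>True\<close> to component
    \<open>False\<close> keeps the totals of boys and girls at \<open>2 * m\<close> each, so this is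
    still an instance, of the same size.\<close>
  define w where "w v = (if v = (False, False) then m + 1 else if v = (False, True) then m - 1 else m)"
    for v :: "bool \<times> bool"
  obtain c' :: "('a, bool \<times> bool) colouring" where c': "finite (dom c')" "\<And>v. card (colour_class c' v) = w v"
    using colouring_exists[OF inf, of w] by blast
  have w: "m - 1 \<le> w v" for v by (auto simp: w_def)
  have size: "card (dom c) = 4 * m" "card (dom c') = 4 * m"
    using m by (simp_all add: card_dom_colouring c c' w_def UNIV_bool flip: UNIV_Times_UNIV)
  have "graph_of c \<in> matching_yes"
    using matching_instance_graph_of[OF c(1)] perfect_matching_graph_of[OF c(1)] c(2)
    by (simp add: matching_yes_def)
  moreover have "graph_of c' \<in> matching_no"
    using matching_instance_graph_of[OF c'(1)] no_perfect_matching_graph_of[OF c'(1), of False] c'(2) m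
    by (simp add: matching_no_def w_def UNIV_bool)
  ultimately have acc: "accepts P (graph_of c)" "rejects P (graph_of c')"
    using P by auto
  show False
  proof (rule no_separation[OF R _ size d(1) _ _ _ _ _ _ _ acc])
    show "back_and_forth c c' K"
      using u(1)[of m] u(1)[OF w] by (simp add: back_and_forth_def ample_def c c')
    show "rule_bound (prog P) (max 1 (CARD(bool \<times> bool) * d)) \<le> K" by (simp only: K_def order_refl)
    show "poly (space_bound P) (int (4 * m)) < 2 ^ t" by (rule t)
    show "t * (CARD(bool \<times> bool) * d + 2) \<le> t * a" by (simp only: a_def order_refl)
    show "2 * (t * a) < card (colour_class c v)" "2 * (t * a) < card (colour_class c' v)" for v
      using u(2)[of m] u(2)[OF w] by (simp_all add: c c')
    show "poly (space_bound P) (int (4 * m)) < int (card (colour_class c v) choose e)"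
      "poly (space_bound P) (int (4 * m)) < int (card (colour_class c' v) choose e)"
      if "d < e" "e \<le> t * a" for v e
      using u(3)[OF _ that, of m] u(3)[OF w that] by (simp_all add: c c')
  qed
qed

end
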